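(* Let $\mathcal A$ be a restriction category and $C$ a coverage on $\mathcal A$. The unit $\eta\colon\mathcal A\to\Phi\Psi(\mathcal O_C)$, at the object $\mathcal O_C\colon\mathcal A\to\mathrm{Loc}_p$ of $\mathrm{rCat}/\!/\mathrm{Loc}_p$, of the adjunction $\Psi\dashv\Phi\colon\mathrm{pCat}_c(\mathrm{Loc}_p)\to\mathrm{rCat}/\!/\mathrm{Loc}_p$ exhibits $\Phi\Psi(\mathcal O_C)$ as the relative join completion of $\mathcal A$ with respect to $C$.
   Context: RESTRICTION CATEGORIES. A restriction category is a category with an operation assigning to each $f\colon A\to B$ a map $\bar f\colon A\to A$ such that $f\bar f=f$; $\bar f\bar g=\bar g\bar f$ and $\overline{g\bar f}=\bar g\bar f$ for $f\colon A\to B$, $g\colon A\to C$; and $\bar g f=f\,\overline{gf}$ for $f\colon A\to B$, $g\colon B\to C$. $\mathcal O(A)$ is the meet-semilattice of restriction idempotents on $A$ (maps $e\colon A\to A$ with $\bar e=e$), with composition as meet. A map $f$ is total if $\bar f=1$. For parallel maps, $f\leqslant g$ iff $f=g\bar f$, and $f\smile g$ (compatible) iff $f\bar g=g\bar f$. A restriction functor satisfies $F\bar f=\overline{Ff}$. A join restriction category is a restriction category in which every pairwise-compatible family of parallel maps has a join for $\leqslant$, preserved by precomposition; a join restriction functor is a restriction functor preserving these joins. A partial isomorphism is a map $s$ with a (unique) partial inverse $s^*$: $s^*s=\bar s$, $ss^*=\overline{s^*}$. A local homeomorphism is a total map which is a join of partial isomorphisms. A local atlas on $X$ is a set $I$ and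 a family $\varphi_{ij}\in\mathcal O(X)$ with $\varphi_{ij}=\varphi_{ji}$ and $\varphi_{jk}\varphi_{ij}\leqslant\varphi_{ik}$; a glueing of it is a local homeomorphism $p=\bigvee_i p_i\colon A\to X$, with each $p_i$ a partial isomorphism with partial inverse $s_i$, such that $\varphi_{ij}=p_js_i$. A partial section of a total map $p\colon A\to X$ is $s\colon X\to A$ with $ps=\bar s$. COVERAGES. A sieve on a map $f\colon i\to j$ of $\mathcal A$ is a down-closed subset of $\{g\in\mathcal A(i,j):g\leqslant f\}$. A coverage $C$ on $\mathcal A$ specifies for each map $f$ a collection $C(f)$ of sieves on $f$ such that (i) if $f\in\mathcal A(i,j)$, $g\in\mathcal A(j,k)$ and $X\in C(g)$ then $Xf\in C(gf)$, where $Xf$ is the sieve generated by $\{xf:x\in X\}$; (ii) $X\in C(f)$ iff $\overline X=\{\bar x:x\in X\}\in C(\bar f)$. For a join restriction category $\mathcal B$, a restriction functor $F\colon\mathcal A\to\mathcal B$ is a cover-to-join map if $\bigvee_{x\in X}Fx=Ff$ for all $f$ and all $X\in C(f)$. A relative join completion of $\mathcal A$ with respect to $C$ is a join restriction category $\mathrm j_C(\mathcal A)$ with a cover-to-join map $\eta\colon\mathcal A\to\mathrm j_C(\mathcal A)$ such that every cover-to-join map $F\colon\mathcal A\to\mathcal B$ into a join restriction category factors as $F=F'\eta$ for a unique join restriction functor $F'$. THE FUNCTOR $\mathcal O_C$. $\mathrm{Loc}_p$ has as objects locales (complete lattices with $a\wedge\bigvee_ib_i=\bigvee_ia\wedge b_i$);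 a map $f\colon A\to B$ is a function $f^*\colon B\to A$ preserving binary meets and arbitrary joins; $\bar f^*(a)=f^*(\top)\wedge a$. It is a join restriction category in which every local atlas has a glueing. For $i\in\mathcal A$, $\mathcal O_C(i)$ is the locale of $C$-closed ideals of $\mathcal O(i)$: down-closed $D\subseteq\mathcal O(i)$ such that $X\subseteq D$ and $X\in C(e)$, $e\in\mathcal O(i)$, imply $e\in D$. Write $\eta(e)\in\mathcal O_C(i)$ for the $C$-closed ideal generated by $e$. For $f\colon i\to j$, $\mathcal O_C(f)\colon\mathcal O_C(i)\to\mathcal O_C(j)$ is the unique map of $\mathrm{Loc}_p$ with $\mathcal O_C(f)^*(\eta(e))=\eta(\overline{ef})$ for all $e\in\mathcal O(j)$. This is a restriction functor $\mathcal O_C\colon\mathcal A\to\mathrm{Loc}_p$. THE ADJUNCTION (with $\mathcal C=\mathrm{Loc}_p$). An $I$-partite internal category $\mathbb A$ in $\mathcal C$ comprises objects $A_i$ ($i\in I$); objects $A_{ij}$ with total maps $\sigma_{ij}\colon A_{ij}\to A_i$, $\tau_{ij}\colon A_{ij}\to A_j$, $\sigma_{ij}$ admitting pullbacks along total maps; identities $\eta_i\colon A_i\to A_{ii}$ and composition $\mu_{ijk}\colon A_{jk}\times_{A_j}A_{ij}\to A_{ik}$ compatible with source and target and satisfying the evident unit and associativity laws. These form a category $\mathrm{pCat}_c(\mathcal C)$ with partite cofunctors as maps. $\mathrm{rCat}/\!/\mathcal C$ has as objects restriction functors $P\colon\mathcal A\to\mathcal C$ out of restriction categories, and as maps $(\mathcal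 A,P)\to(\mathcal B,Q)$ pairs of a restriction functor $F\colon\mathcal A\to\mathcal B$ and a natural transformation $QF\Rightarrow P$ with total components. $\Phi(\mathbb A)=(\Phi\mathbb A,\pi_{\mathbb A})$: object-set $I$; $\Phi\mathbb A(i,j)$ the partial sections of $\sigma_{ij}$; identities $\eta_i$; composite of $s\colon i\to j$, $t\colon j\to k$ is $\mu_{ijk}\circ\tau_{ij}^*(t)\circ s$ with $\tau_{ij}^*(t)=(t\tau_{ij},\overline{t\tau_{ij}})\colon A_{ij}\to A_{jk}\times_{A_j}A_{ij}$; restriction of $s$ is $\eta_i\bar s$; $\pi_{\mathbb A}(i)=A_i$, $\pi_{\mathbb A}(s)=\tau_{ij}s$. It has a left adjoint $\Psi$: given $P\colon\mathcal A\to\mathcal C$ and $f,g\in\mathcal A(i,j)$ put $[\![f=_Pg]\!]=\bigvee\{Pe: e\in\mathcal O(i),\ e\leqslant\bar f\bar g,\ fe=ge\}\in\mathcal O(Pi)$; then $\Psi P$ is the $\mathrm{ob}(\mathcal A)$-partite internal category with objects $Pi$, $\sigma_{ij}\colon\Psi P_{ij}\to Pi$ a glueing of the local atlas $([\![f=_Pg]\!])_{f,g\in\mathcal A(i,j)}$ with associated partial sections $s_f$, $\tau_{ij}$ unique with $\tau_{ij}s_f=Pf$, $\eta_i=s_{1_i}$, and $\mu_{ijk}$ unique with $\mu_{ijk}\tau_{ij}^*(s_g)s_f=s_{gf}$. The unit at $P$ is the functor $\mathcal A\to\Phi\Psi P$ which is the identity on objects and sends $f$ to $s_f$. *)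

theory Defs
  imports "HOL-Algebra.Complete_Lattice"
begin

section \<open>Restriction categories\<close>

record ('o, 'm) rcat =
  Ob :: "'o set"
  Ar :: "'m set"
  Dom :: "'m \<Rightarrow> 'o"
  Cod :: "'m \<Rightarrow> 'o"
  Ide :: "'o \<Rightarrow> 'm"
  Cmp :: "'m \<Rightarrow> 'm \<Rightarrow> 'm" (infixr \<open>\<cdot>\<index>\<close> 70)
  Rst :: "'m \<Rightarrow> 'm"

definition Hom :: "('o, 'm) rcat \<Rightarrow> 'o \<Rightarrow> 'o \<Rightarrow> 'm set" where
  "Hom A a b = {f \<in> Ar A. Dom A f = a \<and> Cod A f = b}"

text \<open>Composition is written in the usual order: \<open>g \<cdot> f\<close> is \<open>g\<close> after \<open>f\<close>.\<close>

locale restriction_category =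
  fixes A :: "('o, 'm) rcat" (structure)
  assumes dom_obj: "f \<in> Ar A \<Longrightarrow> Dom A f \<in> Ob A"
    and cod_obj: "f \<in> Ar A \<Longrightarrow> Cod A f \<in> Ob A"
    and ide_hom: "a \<in> Ob A \<Longrightarrow> Ide A a \<in> Hom A a a"
    and cmp_hom: "f \<in> Hom A a b \<Longrightarrow> g \<in> Hom A b c \<Longrightarrow> g \<cdot> f \<in> Hom A a c"
    and cmp_ide: "f \<in> Hom A a b \<Longrightarrow> f \<cdot> Ide A a = f"
    and ide_cmp: "f \<in> Hom A a b \<Longrightarrow> Ide A b \<cdot> f = f"
    and cmp_assoc: "f \<in> Hom A a b \<Longrightarrow> g \<in> Hom A b c \<Longrightarrow> h \<in> Hom A c d \<Longrightarrow>
      (h \<cdot> g) \<cdot> f = h \<cdot> (g \<cdot> f)"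
    and rst_hom: "f \<in> Hom A a b \<Longrightarrow> Rst A f \<in> Hom A a a"
    and cmp_rst: "f \<in> Hom A a b \<Longrightarrow> f \<cdot> Rst A f = f"
    and rst_commute: "f \<in> Hom A a b \<Longrightarrow> g \<in> Hom A a c \<Longrightarrow>
      Rst A f \<cdot> Rst A g = Rst A g \<cdot> Rst A f"
    and rst_cmp_rst: "f \<in> Hom A a b \<Longrightarrow> g \<in> Hom A a c \<Longrightarrow>
      Rst A (g \<cdot> Rst A f) = Rst A g \<cdot> Rst A f"
    and rst_cmp: "f \<in> Hom A a b \<Longrightarrow> g \<in> Hom A b c \<Longrightarrow>
      Rst A g \<cdot> f = f \<cdot> Rst A (g \<cdot> f)"

definition ridem :: "('o, 'm) rcat \<Rightarrow> 'o \<Rightarrow> 'm set" where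
  "ridem A a = {e \<in> Hom A a a. Rst A e = e}"

definition total_map :: "('o, 'm) rcat \<Rightarrow> 'm \<Rightarrow> bool" where
  "total_map A f \<longleftrightarrow> f \<in> Ar A \<and> Rst A f = Ide A (Dom A f)"

definition rle :: "('o, 'm) rcat \<Rightarrow> 'm \<Rightarrow> 'm \<Rightarrow> bool" where
  "rle A f g \<longleftrightarrow> f \<in> Ar A \<and> g \<in> Ar A \<and> Dom A f = Dom A g \<and> Cod A f = Cod A g \<and>
     f = g \<cdot>\<^bsub>A\<^esub> Rst A f"

definition compatible :: "('o, 'm) rcat \<Rightarrow> 'm \<Rightarrow> 'm \<Rightarrow> bool" where
  "compatible A f g \<longleftrightarrow> f \<in> Ar A \<and> g \<in> Ar A \<and> Dom A f = Dom A g \<and> Cod A f = Cod A g \<and>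
     f \<cdot>\<^bsub>A\<^esub> Rst A g = g \<cdot>\<^bsub>A\<^esub> Rst A f"

text \<open>The hom-set is an explicit argument, since the family \<open>S\<close> may be empty.\<close>

definition is_join :: "('o, 'm) rcat \<Rightarrow> 'o \<Rightarrow> 'o \<Rightarrow> 'm set \<Rightarrow> 'm \<Rightarrow> bool" where
  "is_join A a b S g \<longleftrightarrow> S \<subseteq> Hom A a b \<and> g \<in> Hom A a b \<and> (\<forall>f\<in>S. rle A f g) \<and>
     (\<forall>h\<in>Hom A a b. (\<forall>f\<in>S. rle A f h) \<longrightarrow> rle A g h)"

definition join_of :: "('o, 'm) rcat \<Rightarrow> 'o \<Rightarrow> 'o \<Rightarrow> 'm set \<Rightarrow> 'm" where
  "join_of A a b S = (THE g. is_join A a b S g)"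

definition compatible_family :: "('o, 'm) rcat \<Rightarrow> 'o \<Rightarrow> 'o \<Rightarrow> 'm set \<Rightarrow> bool" where
  "compatible_family A a b S \<longleftrightarrow> S \<subseteq> Hom A a b \<and> (\<forall>f\<in>S. \<forall>g\<in>S. compatible A f g)"

locale join_restriction_category = restriction_category +
  assumes joins: "a \<in> Ob A \<Longrightarrow> b \<in> Ob A \<Longrightarrow> compatible_family A a b S \<Longrightarrow>
    \<exists>g. is_join A a b S g \<and>
      (\<forall>c\<in>Ob A. \<forall>h\<in>Hom A c a. is_join A c b ((\<lambda>f. f \<cdot> h) ` S) (g \<cdot> h))"


section \<open>Functors\<close>

record ('o, 'm, 'p, 'n) fctr =
  FO :: "'o \<Rightarrow> 'p"
  FM :: "'m \<Rightarrow> 'n"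

text \<open>Functors are extensional, so that equality of functors is equality in HOL.\<close>

definition restriction_functor ::
  "('o, 'm) rcat \<Rightarrow> ('p, 'n) rcat \<Rightarrow> ('o, 'm, 'p, 'n) fctr \<Rightarrow> bool" where
  "restriction_functor A B F \<longleftrightarrow>
     FO F \<in> Ob A \<rightarrow>\<^sub>E Ob B \<and> FM F \<in> Ar A \<rightarrow>\<^sub>E Ar B \<and>
     (\<forall>f\<in>Ar A. Dom B (FM F f) = FO F (Dom A f) \<and> Cod B (FM F f) = FO F (Cod A f)) \<and>
     (\<forall>a\<in>Ob A. FM F (Ide A a) = Ide B (FO F a)) \<and>
     (\<forall>f\<in>Ar A. \<forall>g\<in>Ar A. Dom A g = Cod A f \<longrightarrow> FM F (g \<cdot>\<^bsub>A\<^esub> f) = FM F g \<cdot>\<^bsub>B\<^esub> FM F f) \<and>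
     (\<forall>f\<in>Ar A. FM F (Rst A f) = Rst B (FM F f))"

definition join_restriction_functor ::
  "('o, 'm) rcat \<Rightarrow> ('p, 'n) rcat \<Rightarrow> ('o, 'm, 'p, 'n) fctr \<Rightarrow> bool" where
  "join_restriction_functor A B F \<longleftrightarrow> restriction_functor A B F \<and>
     (\<forall>a\<in>Ob A. \<forall>b\<in>Ob A. \<forall>S g. compatible_family A a b S \<longrightarrow> is_join A a b S g \<longrightarrow>
        is_join B (FO F a) (FO F b) (FM F ` S) (FM F g))"

definition fcomp ::
  "('o, 'm) rcat \<Rightarrow> ('p, 'n, 'q, 'k) fctr \<Rightarrow> ('o, 'm, 'p, 'n) fctr \<Rightarrow> ('o, 'm, 'q, 'k) fctr" where
  "fcomp A G F = \<lparr>FO = compose (Ob A) (FO G) (FO F), FM = compose (Ar A) (FM G) (FM F)\<rparr>"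


section \<open>Coverages and relative join completions\<close>

definition sieve :: "('o, 'm) rcat \<Rightarrow> 'm \<Rightarrow> 'm set \<Rightarrow> bool" where
  "sieve A f X \<longleftrightarrow> (\<forall>g\<in>X. rle A g f) \<and> (\<forall>g\<in>X. \<forall>h. rle A h g \<longrightarrow> h \<in> X)"

definition down :: "('o, 'm) rcat \<Rightarrow> 'm set \<Rightarrow> 'm set" where
  "down A S = {h. \<exists>g\<in>S. rle A h g}"

text \<open>\<open>C f\<close> is the collection of covering sieves on \<open>f\<close>; it is irrelevant when \<open>f\<close> is not an
  arrow of \<open>A\<close>.\<close>

locale coverage = restriction_category A for A :: "('o, 'm) rcat" (structure) +
  fixes C :: "'m \<Rightarrow> 'm set set"
  assumes cover_sieve: "f \<in> Ar A \<Longrightarrow> X \<in> C f \<Longrightarrow> sieve A f X"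
    and cover_precomp: "f \<in> Hom A i j \<Longrightarrow> g \<in> Hom A j k \<Longrightarrow> X \<in> C g \<Longrightarrow>
      down A ((\<lambda>x. x \<cdot> f) ` X) \<in> C (g \<cdot> f)"
    and cover_rst: "f \<in> Ar A \<Longrightarrow> sieve A f X \<Longrightarrow> X \<in> C f \<longleftrightarrow> Rst A ` X \<in> C (Rst A f)"

definition cover_to_join_map ::
  "('o, 'm) rcat \<Rightarrow> ('m \<Rightarrow> 'm set set) \<Rightarrow> ('p, 'n) rcat \<Rightarrow> ('o, 'm, 'p, 'n) fctr \<Rightarrow> bool" where
  "cover_to_join_map A C B F \<longleftrightarrow> restriction_functor A B F \<and>
     (\<forall>f\<in>Ar A. \<forall>X\<in>C f.
        is_join B (FO F (Dom A f)) (FO F (Cod A f)) (FM F ` X) (FM F f))"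

text \<open>The universal property quantifies over all join restriction categories whose objects and
  arrows lie in the types named by the first argument.  These types are arbitrary: they occur as
  type variables in the theorem.\<close>

definition relative_join_completion ::
  "('p \<times> 'n) itself \<Rightarrow> ('o, 'm) rcat \<Rightarrow> ('m \<Rightarrow> 'm set set) \<Rightarrow>
   ('q, 'k) rcat \<Rightarrow> ('o, 'm, 'q, 'k) fctr \<Rightarrow> bool" where
  "relative_join_completion T A C J \<eta> \<longleftrightarrow>
     join_restriction_category J \<and> cover_to_join_map A C J \<eta> \<and>
     (\<forall>(B :: ('p, 'n) rcat) F. join_restriction_category B \<longrightarrow> cover_to_join_map A C B F \<longrightarrow>
        (\<exists>!F'. join_restriction_functor J B F' \<and> F = fcomp A F' \<eta>))"


section \<open>Local homeomorphisms, local atlases and glueings\<close>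

definition partial_inverse :: "('o, 'm) rcat \<Rightarrow> 'm \<Rightarrow> 'm \<Rightarrow> bool" where
  "partial_inverse A s t \<longleftrightarrow> s \<in> Ar A \<and> t \<in> Hom A (Cod A s) (Dom A s) \<and>
     t \<cdot>\<^bsub>A\<^esub> s = Rst A s \<and> s \<cdot>\<^bsub>A\<^esub> t = Rst A t"

definition partial_iso :: "('o, 'm) rcat \<Rightarrow> 'm \<Rightarrow> bool" where
  "partial_iso A s \<longleftrightarrow> (\<exists>t. partial_inverse A s t)"

definition local_homeo :: "('o, 'm) rcat \<Rightarrow> 'm \<Rightarrow> bool" where
  "local_homeo A p \<longleftrightarrow> total_map A p \<and>
     (\<exists>S. (\<forall>s\<in>S. partial_iso A s) \<and> is_join A (Dom A p) (Cod A p) S p)"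

definition local_atlas :: "('o, 'm) rcat \<Rightarrow> 'o \<Rightarrow> 'i set \<Rightarrow> ('i \<Rightarrow> 'i \<Rightarrow> 'm) \<Rightarrow> bool" where
  "local_atlas A x I \<phi> \<longleftrightarrow> x \<in> Ob A \<and>
     (\<forall>i\<in>I. \<forall>j\<in>I. \<phi> i j \<in> ridem A x \<and> \<phi> i j = \<phi> j i) \<and>
     (\<forall>i\<in>I. \<forall>j\<in>I. \<forall>k\<in>I. rle A (\<phi> j k \<cdot>\<^bsub>A\<^esub> \<phi> i j) (\<phi> i k))"

text \<open>\<open>p : y \<rightarrow> x\<close> is a glueing of \<open>\<phi>\<close>, with associated partial sections \<open>s i : x \<rightarrow> y\<close>.\<close>

definition glueing ::
  "('o, 'm) rcat \<Rightarrow> 'o \<Rightarrow> 'i set \<Rightarrow> ('i \<Rightarrow> 'i \<Rightarrow> 'm) \<Rightarrow> 'o \<Rightarrow> 'm \<Rightarrow> ('i \<Rightarrow> 'm) \<Rightarrow> bool" where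
  "glueing A x I \<phi> y p s \<longleftrightarrow> local_atlas A x I \<phi> \<and> y \<in> Ob A \<and> p \<in> Hom A y x \<and> local_homeo A p \<and>
     (\<exists>q. (\<forall>i\<in>I. q i \<in> Hom A y x \<and> partial_inverse A (q i) (s i)) \<and>
          is_join A y x (q ` I) p \<and>
          (\<forall>i\<in>I. \<forall>j\<in>I. \<phi> i j = q j \<cdot>\<^bsub>A\<^esub> s i))"

definition partial_section :: "('o, 'm) rcat \<Rightarrow> 'm \<Rightarrow> 'm \<Rightarrow> bool" where
  "partial_section A p s \<longleftrightarrow> s \<in> Hom A (Cod A p) (Dom A p) \<and> p \<cdot>\<^bsub>A\<^esub> s = Rst A s"


section \<open>Partite internal categories\<close>

text \<open>Pullbacks are pullbacks in the underlying category, so the test maps \<open>a\<close>, \<open>b\<close> may be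
  partial.\<close>

definition is_pullback :: "('o, 'm) rcat \<Rightarrow> 'm \<Rightarrow> 'm \<Rightarrow> 'o \<Rightarrow> 'm \<Rightarrow> 'm \<Rightarrow> bool" where
  "is_pullback A f g P p q \<longleftrightarrow> f \<in> Ar A \<and> g \<in> Ar A \<and> Cod A f = Cod A g \<and> P \<in> Ob A \<and>
     p \<in> Hom A P (Dom A f) \<and> q \<in> Hom A P (Dom A g) \<and> f \<cdot>\<^bsub>A\<^esub> p = g \<cdot>\<^bsub>A\<^esub> q \<and>
     (\<forall>T\<in>Ob A. \<forall>a\<in>Hom A T (Dom A f). \<forall>b\<in>Hom A T (Dom A g). f \<cdot>\<^bsub>A\<^esub> a = g \<cdot>\<^bsub>A\<^esub> b \<longrightarrow>
        (\<exists>!u. u \<in> Hom A T P \<and> p \<cdot>\<^bsub>A\<^esub> u = a \<and> q \<cdot>\<^bsub>A\<^esub> u = b))"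

text \<open>\<open>PB i j k\<close>, with projections \<open>Pr1 i j k\<close> and \<open>Pr2 i j k\<close> to \<open>A\<^sub>j\<^sub>k\<close> and \<open>A\<^sub>i\<^sub>j\<close>, is a chosen
  pullback of \<open>\<sigma>\<^sub>j\<^sub>k\<close> along \<open>\<tau>\<^sub>i\<^sub>j\<close>.\<close>

record ('i, 'c, 'k) pcat =
  Idx :: "'i set"
  PO :: "'i \<Rightarrow> 'c"
  PA :: "'i \<Rightarrow> 'i \<Rightarrow> 'c"
  Sg :: "'i \<Rightarrow> 'i \<Rightarrow> 'k"
  Tg :: "'i \<Rightarrow> 'i \<Rightarrow> 'k"
  PB :: "'i \<Rightarrow> 'i \<Rightarrow> 'i \<Rightarrow> 'c"
  Pr1 :: "'i \<Rightarrow> 'i \<Rightarrow> 'i \<Rightarrow> 'k"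
  Pr2 :: "'i \<Rightarrow> 'i \<Rightarrow> 'i \<Rightarrow> 'k"
  Unt :: "'i \<Rightarrow> 'k"
  Mu :: "'i \<Rightarrow> 'i \<Rightarrow> 'i \<Rightarrow> 'k"

definition pairing ::
  "('c, 'k) rcat \<Rightarrow> ('i, 'c, 'k) pcat \<Rightarrow> 'i \<Rightarrow> 'i \<Rightarrow> 'i \<Rightarrow> 'k \<Rightarrow> 'k \<Rightarrow> 'k" where
  "pairing K AA i j k a b = (THE u. u \<in> Hom K (Dom K a) (PB AA i j k) \<and>
     Pr1 AA i j k \<cdot>\<^bsub>K\<^esub> u = a \<and> Pr2 AA i j k \<cdot>\<^bsub>K\<^esub> u = b)"

text \<open>Associativity is stated on generalised elements \<open>h\<close>, \<open>g\<close>, \<open>f\<close> of \<open>A\<^sub>k\<^sub>l\<close>, \<open>A\<^sub>j\<^sub>k\<close>, \<open>A\<^sub>i\<^sub>j\<close>, that is,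
  on maps out of a common object \<open>T\<close>; this avoids choosing triple pullbacks.\<close>

locale partite_internal_category =
  fixes K :: "('c, 'k) rcat" (structure)
    and AA :: "('i, 'c, 'k) pcat"
  assumes po_obj: "i \<in> Idx AA \<Longrightarrow> PO AA i \<in> Ob K"
    and pa_obj: "i \<in> Idx AA \<Longrightarrow> j \<in> Idx AA \<Longrightarrow> PA AA i j \<in> Ob K"
    and source: "i \<in> Idx AA \<Longrightarrow> j \<in> Idx AA \<Longrightarrow>
      Sg AA i j \<in> Hom K (PA AA i j) (PO AA i) \<and> total_map K (Sg AA i j)"
    and target: "i \<in> Idx AA \<Longrightarrow> j \<in> Idx AA \<Longrightarrow>
      Tg AA i j \<in> Hom K (PA AA i j) (PO AA j) \<and> total_map K (Tg AA i j)"
    and source_pullbacks: "i \<in> Idx AA \<Longrightarrow> j \<in> Idx AA \<Longrightarrow>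
      total_map K g \<Longrightarrow> Cod K g = PO AA i \<Longrightarrow> \<exists>P p q. is_pullback K (Sg AA i j) g P p q"
    and composable: "i \<in> Idx AA \<Longrightarrow> j \<in> Idx AA \<Longrightarrow> k \<in> Idx AA \<Longrightarrow>
      is_pullback K (Sg AA j k) (Tg AA i j) (PB AA i j k) (Pr1 AA i j k) (Pr2 AA i j k)"
    and unit: "i \<in> Idx AA \<Longrightarrow> Unt AA i \<in> Hom K (PO AA i) (PA AA i i) \<and>
      Sg AA i i \<cdot> Unt AA i = Ide K (PO AA i) \<and> Tg AA i i \<cdot> Unt AA i = Ide K (PO AA i)"
    and mult: "i \<in> Idx AA \<Longrightarrow> j \<in> Idx AA \<Longrightarrow> k \<in> Idx AA \<Longrightarrow>
      Mu AA i j k \<in> Hom K (PB AA i j k) (PA AA i k) \<and>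
      Sg AA i k \<cdot> Mu AA i j k = Sg AA i j \<cdot> Pr2 AA i j k \<and>
      Tg AA i k \<cdot> Mu AA i j k = Tg AA j k \<cdot> Pr1 AA i j k"
    and unit_left: "i \<in> Idx AA \<Longrightarrow> j \<in> Idx AA \<Longrightarrow>
      Mu AA i j j \<cdot> pairing K AA i j j (Unt AA j \<cdot> Tg AA i j) (Ide K (PA AA i j)) =
      Ide K (PA AA i j)"
    and unit_right: "i \<in> Idx AA \<Longrightarrow> j \<in> Idx AA \<Longrightarrow>
      Mu AA i i j \<cdot> pairing K AA i i j (Ide K (PA AA i j)) (Unt AA i \<cdot> Sg AA i j) =
      Ide K (PA AA i j)"
    and mult_assoc: "i \<in> Idx AA \<Longrightarrow> j \<in> Idx AA \<Longrightarrow> k \<in> Idx AA \<Longrightarrow> l \<in> Idx AA \<Longrightarrow> T \<in> Ob K \<Longrightarrow>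
      h \<in> Hom K T (PA AA k l) \<Longrightarrow> g \<in> Hom K T (PA AA j k) \<Longrightarrow> f \<in> Hom K T (PA AA i j) \<Longrightarrow>
      Sg AA k l \<cdot> h = Tg AA j k \<cdot> g \<Longrightarrow> Sg AA j k \<cdot> g = Tg AA i j \<cdot> f \<Longrightarrow>
      Mu AA i j l \<cdot> pairing K AA i j l (Mu AA j k l \<cdot> pairing K AA j k l h g) f =
      Mu AA i k l \<cdot> pairing K AA i k l h (Mu AA i j k \<cdot> pairing K AA i j k g f)"

text \<open>The map \<open>\<tau>\<^sub>i\<^sub>j\<^sup>*(t) : A\<^sub>i\<^sub>j \<rightarrow> A\<^sub>j\<^sub>k \<times> A\<^sub>i\<^sub>j\<close> (fibre product over \<open>A\<^sub>j\<close>) for \<open>t : A\<^sub>j \<rightarrow> A\<^sub>j\<^sub>k\<close>.\<close>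

definition tau_star ::
  "('c, 'k) rcat \<Rightarrow> ('i, 'c, 'k) pcat \<Rightarrow> 'i \<Rightarrow> 'i \<Rightarrow> 'i \<Rightarrow> 'k \<Rightarrow> 'k" where
  "tau_star K AA i j k t =
     pairing K AA i j k (t \<cdot>\<^bsub>K\<^esub> Tg AA i j) (Rst K (t \<cdot>\<^bsub>K\<^esub> Tg AA i j))"


section \<open>The functors \<open>\<Phi>\<close> and \<open>\<Psi>\<close>\<close>

text \<open>A map \<open>i \<rightarrow> j\<close> of \<open>\<Phi>\<close> is a partial section of \<open>\<sigma>\<^sub>i\<^sub>j\<close>, tagged with \<open>i\<close> and \<open>j\<close>.\<close>

definition Phi :: "('c, 'k) rcat \<Rightarrow> ('i, 'c, 'k) pcat \<Rightarrow> ('i, 'i \<times> 'i \<times> 'k) rcat" where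
  "Phi K AA = \<lparr>
     Ob = Idx AA,
     Ar = {(i, j, s). i \<in> Idx AA \<and> j \<in> Idx AA \<and> partial_section K (Sg AA i j) s},
     Dom = (\<lambda>(i, j, s). i),
     Cod = (\<lambda>(i, j, s). j),
     Ide = (\<lambda>i. (i, i, Unt AA i)),
     Cmp = (\<lambda>(j, k, t) (i, j', s). (i, k, Mu AA i j k \<cdot>\<^bsub>K\<^esub> tau_star K AA i j k t \<cdot>\<^bsub>K\<^esub> s)),
     Rst = (\<lambda>(i, j, s). (i, i, Unt AA i \<cdot>\<^bsub>K\<^esub> Rst K s))\<rparr>"

text \<open>The value \<open>\<lbrakk>f =\<^sub>P g\<rbrakk>\<close>.\<close>

definition eq_extent ::
  "('o, 'm) rcat \<Rightarrow> ('c, 'k) rcat \<Rightarrow> ('o, 'm, 'c, 'k) fctr \<Rightarrow> 'm \<Rightarrow> 'm \<Rightarrow> 'k" where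
  "eq_extent A K P f g = join_of K (FO P (Dom A f)) (FO P (Dom A f))
     (FM P ` {e \<in> ridem A (Dom A f). rle A e (Rst A f \<cdot>\<^bsub>A\<^esub> Rst A g) \<and> f \<cdot>\<^bsub>A\<^esub> e = g \<cdot>\<^bsub>A\<^esub> e})"

text \<open>\<open>\<Psi> P\<close> is only determined up to isomorphism, by a choice of glueings and pullbacks.  The
  predicate says that \<open>AA\<close> is a choice of \<open>\<Psi> P\<close> and that \<open>s f\<close> is the partial section of
  \<open>\<sigma>\<^sub>i\<^sub>j\<close> associated with \<open>f : i \<rightarrow> j\<close>.\<close>

definition is_Psi ::
  "('o, 'm) rcat \<Rightarrow> ('c, 'k) rcat \<Rightarrow> ('o, 'm, 'c, 'k) fctr \<Rightarrow>
   ('o, 'c, 'k) pcat \<Rightarrow> ('m \<Rightarrow> 'k) \<Rightarrow> bool" where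
  "is_Psi A K P AA s \<longleftrightarrow>
     partite_internal_category K AA \<and>
     Idx AA = Ob A \<and> (\<forall>i\<in>Ob A. PO AA i = FO P i) \<and>
     (\<forall>i\<in>Ob A. \<forall>j\<in>Ob A.
        glueing K (FO P i) (Hom A i j) (eq_extent A K P) (PA AA i j) (Sg AA i j) s) \<and>
     (\<forall>i\<in>Ob A. \<forall>j\<in>Ob A. \<forall>f\<in>Hom A i j. Tg AA i j \<cdot>\<^bsub>K\<^esub> s f = FM P f) \<and>
     (\<forall>i\<in>Ob A. Unt AA i = s (Ide A i)) \<and>
     (\<forall>i\<in>Ob A. \<forall>j\<in>Ob A. \<forall>k\<in>Ob A. \<forall>f\<in>Hom A i j. \<forall>g\<in>Hom A j k.
        Mu AA i j k \<cdot>\<^bsub>K\<^esub> tau_star K AA i j k (s g) \<cdot>\<^bsub>K\<^esub> s f = s (g \<cdot>\<^bsub>A\<^esub> f))"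

definition unit_functor ::
  "('o, 'm) rcat \<Rightarrow> ('m \<Rightarrow> 'k) \<Rightarrow> ('o, 'm, 'o, 'o \<times> 'o \<times> 'k) fctr" where
  "unit_functor A s = \<lparr>FO = (\<lambda>i\<in>Ob A. i), FM = (\<lambda>f\<in>Ar A. (Dom A f, Cod A f, s f))\<rparr>"


section \<open>Locales (in the sense of point-free topology) and partial maps\<close>

locale pointfree_space = complete_lattice +
  assumes meet_distrib: "a \<in> carrier L \<Longrightarrow> S \<subseteq> carrier L \<Longrightarrow>
    a \<sqinter> \<Squnion>S = \<Squnion>((\<lambda>b. a \<sqinter> b) ` S)"

text \<open>\<open>pull f\<close> is the inverse image map \<open>f\<^sup>*\<close>.\<close>

record 'u locp_map =
  src :: "'u gorder"
  tgt :: "'u gorder"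
  pull :: "'u \<Rightarrow> 'u"

text \<open>The category \<open>Loc\<^sub>p\<close> of those locales whose elements lie in the type \<open>'u\<close>, which plays the
  part of a universe.\<close>

definition Locp :: "('u gorder, 'u locp_map) rcat" where
  "Locp = \<lparr>
     Ob = {L. pointfree_space L},
     Ar = {f. pointfree_space (src f) \<and> pointfree_space (tgt f) \<and>
              pull f \<in> carrier (tgt f) \<rightarrow>\<^sub>E carrier (src f) \<and>
              (\<forall>a\<in>carrier (tgt f). \<forall>b\<in>carrier (tgt f).
                 pull f (a \<sqinter>\<^bsub>tgt f\<^esub> b) = pull f a \<sqinter>\<^bsub>src f\<^esub> pull f b) \<and>
              (\<forall>S. S \<subseteq> carrier (tgt f) \<longrightarrow>
                 pull f (\<Squnion>\<^bsub>tgt f\<^esub>S) = \<Squnion>\<^bsub>src f\<^esub>(pull f ` S))},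
     Dom = src,
     Cod = tgt,
     Ide = (\<lambda>L. \<lparr>src = L, tgt = L, pull = (\<lambda>a\<in>carrier L. a)\<rparr>),
     Cmp = (\<lambda>g f. \<lparr>src = src f, tgt = tgt g, pull = compose (carrier (tgt g)) (pull f) (pull g)\<rparr>),
     Rst = (\<lambda>f. \<lparr>src = src f, tgt = src f,
                 pull = (\<lambda>a\<in>carrier (src f). pull f \<top>\<^bsub>tgt f\<^esub> \<sqinter>\<^bsub>src f\<^esub> a)\<rparr>)\<rparr>"


section \<open>The functor \<open>\<O>\<^sub>C\<close>\<close>

definition closed_ideal ::
  "('o, 'm) rcat \<Rightarrow> ('m \<Rightarrow> 'm set set) \<Rightarrow> 'o \<Rightarrow> 'm set \<Rightarrow> bool" where
  "closed_ideal A C i D \<longleftrightarrow> D \<subseteq> ridem A i \<and>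
     (\<forall>e\<in>D. \<forall>d\<in>ridem A i. rle A d e \<longrightarrow> d \<in> D) \<and>
     (\<forall>e\<in>ridem A i. \<forall>X\<in>C e. X \<subseteq> D \<longrightarrow> e \<in> D)"

definition ideal_gen ::
  "('o, 'm) rcat \<Rightarrow> ('m \<Rightarrow> 'm set set) \<Rightarrow> 'o \<Rightarrow> 'm \<Rightarrow> 'm set" where
  "ideal_gen A C i e = \<Inter>{D. closed_ideal A C i D \<and> e \<in> D}"

text \<open>The \<open>C\<close>-closed ideals are sets of arrows; an injection \<open>emb\<close> places them in the universe
  \<open>'u\<close>.  The order is inclusion.\<close>

definition OC_obj ::
  "('m set \<Rightarrow> 'u) \<Rightarrow> ('o, 'm) rcat \<Rightarrow> ('m \<Rightarrow> 'm set set) \<Rightarrow> 'o \<Rightarrow> 'u gorder" where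
  "OC_obj emb A C i = \<lparr>carrier = emb ` {D. closed_ideal A C i D}, eq = (=),
     le = (\<lambda>x y. \<exists>D E. x = emb D \<and> y = emb E \<and> D \<subseteq> E)\<rparr>"

definition OC ::
  "('m set \<Rightarrow> 'u) \<Rightarrow> ('o, 'm) rcat \<Rightarrow> ('m \<Rightarrow> 'm set set) \<Rightarrow>
   ('o, 'm, 'u gorder, 'u locp_map) fctr" where
  "OC emb A C = \<lparr>
     FO = (\<lambda>i\<in>Ob A. OC_obj emb A C i),
     FM = (\<lambda>f\<in>Ar A. THE h.
        h \<in> Hom Locp (OC_obj emb A C (Dom A f)) (OC_obj emb A C (Cod A f)) \<and>
        (\<forall>e\<in>ridem A (Cod A f). pull h (emb (ideal_gen A C (Cod A f) e)) =
           emb (ideal_gen A C (Dom A f) (Rst A (e \<cdot>\<^bsub>A\<^esub> f)))))\<rparr>"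

end

theory Submission
  imports Defs
begin

text \<open>
  A partial section \<open>t\<close> of \<open>\<sigma>\<^sub>i\<^sub>j\<close> is the join of the maps \<open>s\<^sub>f \<cdot> q\<^sub>f \<cdot> t\<close>, where \<open>q\<^sub>f\<close> is the partial
  inverse of \<open>s\<^sub>f\<close>. Each \<open>q\<^sub>f \<cdot> t\<close> is a restriction idempotent of \<open>\<O>\<^sub>C(i)\<close>, hence a join of elements
  \<open>\<O>\<^sub>C(e)\<close>, and \<open>s\<^sub>f \<cdot> \<O>\<^sub>C(e) = s\<^sub>f\<^sub>e\<close>. So every map of \<open>\<Phi>\<Psi>(\<O>\<^sub>C)\<close> is the join of the \<open>s\<^sub>g\<close> below it, which
  forces the extension of a cover-to-join map \<open>F\<close> to be \<open>t \<mapsto> \<Or>{F g | s\<^sub>g \<le> t}\<close>. Conversely, if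
  \<open>s\<^sub>k \<le> \<Or>\<^sub>x s\<^sub>x\<close> then, applying \<open>q\<^sub>k\<close>, the idempotent \<open>Rst k\<close> lies in the \<open>C\<close>-closed ideal generated by
  the \<open>e\<close> with \<open>k e = x e\<close> for some \<open>x\<close>; as \<open>{e | F(k e) \<le> u}\<close> is a \<open>C\<close>-closed ideal for every \<open>u\<close>,
  it follows that \<open>F k \<le> \<Or>\<^sub>x F x\<close>. This one implication makes the formula well defined, functorial
  and join-preserving.
\<close>

section \<open>Restriction categories and joins\<close>

text \<open>\<open>is_Psi\<close> leaves the choice of glueings and pullbacks open, so nothing can
  be computed inside a concrete model of \<Psi>. All information is drawn from the equations of a
  glueing: each \<open>q f\<close> is a restriction of \<sigma>, is partially inverse to
  \<open>s f\<close>, and \<open>q g \<cdot> s f\<close> is the extent of \<open>f = g\<close>.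

  A coverage is asked neither to contain maximal sieves nor to be transitive, so the members of a
  generated closed ideal have no explicit description. Every statement about such an ideal is proved
  by exhibiting another closed ideal that contains the generators. The comparison property is
  therefore phrased, in \<open>dense_conservative\<close>, with an arbitrary closed ideal of arrows
  of \<open>A\<close> and without mention of locales: the target category, the functor and the bound
  \<open>u\<close> are all encoded in the choice of that ideal.

  Joins in \<open>Phi\<close> have to be related to joins in \<open>Locp\<close>. The device
  throughout is that a map below another one is determined by its restriction, so joins can be
  recognised on restriction idempotents.\<close>

context restriction_category
begin

lemma ide_simps [simp]:
  assumes "a \<in> Ob A"
  shows "Ide A a \<in> Ar A" "Dom A (Ide A a) = a" "Cod A (Ide A a) = a"
  using ide_hom[OF assms] by (auto simp: Hom_def)

lemma cmp_simps [simp]: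
  assumes "f \<in> Ar A" "g \<in> Ar A" "Dom A g = Cod A f"
  shows "g \<cdot> f \<in> Ar A" "Dom A (g \<cdot> f) = Dom A f" "Cod A (g \<cdot> f) = Cod A g"
  using cmp_hom[of f "Dom A f" "Cod A f" g "Cod A g"] assms by (auto simp: Hom_def)

lemma rst_simps [simp]:
  assumes "f \<in> Ar A"
  shows "Rst A f \<in> Ar A" "Dom A (Rst A f) = Dom A f" "Cod A (Rst A f) = Dom A f"
  using rst_hom[of f "Dom A f" "Cod A f"] assms by (auto simp: Hom_def)

lemma assoc [simp]:
  assumes "f \<in> Ar A" "g \<in> Ar A" "h \<in> Ar A" "Dom A g = Cod A f" "Dom A h = Cod A g"
  shows "(h \<cdot> g) \<cdot> f = h \<cdot> g \<cdot> f"
  using assms cmp_assoc[of f "Dom A f" "Cod A f" g "Cod A g" h "Cod A h"] by (auto simp: Hom_def)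

lemma cmp_ide_right [simp]: "f \<in> Ar A \<Longrightarrow> Dom A f = a \<Longrightarrow> f \<cdot> Ide A a = f"
  using cmp_ide[of f a "Cod A f"] by (auto simp: Hom_def)

lemma cmp_ide_left [simp]: "f \<in> Ar A \<Longrightarrow> Cod A f = b \<Longrightarrow> Ide A b \<cdot> f = f"
  using ide_cmp[of f "Dom A f" b] by (auto simp: Hom_def)

lemma cmp_rst_self [simp]: "f \<in> Ar A \<Longrightarrow> f \<cdot> Rst A f = f"
  using cmp_rst[of f "Dom A f" "Cod A f"] by (auto simp: Hom_def)

lemma cmp_rst_self_assoc [simp]:
  assumes "f \<in> Ar A" "x \<in> Ar A" "Cod A x = Dom A f"
  shows "f \<cdot> Rst A f \<cdot> x = f \<cdot> x"
proof -
  have "f \<cdot> Rst A f \<cdot> x = (f \<cdot> Rst A f) \<cdot> x"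
    by (rule assoc[symmetric]) (use assms in simp_all)
  then show ?thesis using assms(1) by (simp only: cmp_rst_self)
qed

lemma rst_swap:
  "f \<in> Ar A \<Longrightarrow> g \<in> Ar A \<Longrightarrow> Dom A f = Dom A g \<Longrightarrow> Rst A f \<cdot> Rst A g = Rst A g \<cdot> Rst A f"
  using rst_commute[of f "Dom A f" "Cod A f" g "Cod A g"] by (auto simp: Hom_def)

lemma rst_of_cmp_rst [simp]:
  "f \<in> Ar A \<Longrightarrow> g \<in> Ar A \<Longrightarrow> Dom A f = Dom A g \<Longrightarrow> Rst A (g \<cdot> Rst A f) = Rst A g \<cdot> Rst A f"
  using rst_cmp_rst[of f "Dom A f" "Cod A f" g "Cod A g"] by (auto simp: Hom_def)

lemma rst_past:
  "f \<in> Ar A \<Longrightarrow> g \<in> Ar A \<Longrightarrow> Dom A g = Cod A f \<Longrightarrow> Rst A g \<cdot> f = f \<cdot> Rst A (g \<cdot> f)"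
  using rst_cmp[of f "Dom A f" "Cod A f" g "Cod A g"] by (auto simp: Hom_def)

lemma rst_ide [simp]: "a \<in> Ob A \<Longrightarrow> Rst A (Ide A a) = Ide A a"
  using cmp_rst_self[of "Ide A a"] cmp_ide_left[of "Rst A (Ide A a)" a] by simp

lemma rst_rst [simp]: "f \<in> Ar A \<Longrightarrow> Rst A (Rst A f) = Rst A f"
  using rst_of_cmp_rst[of f "Ide A (Dom A f)"] dom_obj[of f] by simp

lemma rst_idem [simp]: "f \<in> Ar A \<Longrightarrow> Rst A f \<cdot> Rst A f = Rst A f"
  using rst_of_cmp_rst[of f f] by simp

lemma rst_cmp_below [simp]:
  assumes "f \<in> Ar A" "g \<in> Ar A" "Dom A g = Cod A f"
  shows "Rst A (g \<cdot> f) \<cdot> Rst A f = Rst A (g \<cdot> f)" "Rst A f \<cdot> Rst A (g \<cdot> f) = Rst A (g \<cdot> f)"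
proof -
  show "Rst A (g \<cdot> f) \<cdot> Rst A f = Rst A (g \<cdot> f)"
    using rst_of_cmp_rst[of f "g \<cdot> f"] assms by simp
  then show "Rst A f \<cdot> Rst A (g \<cdot> f) = Rst A (g \<cdot> f)"
    using rst_swap[of f "g \<cdot> f"] assms by simp
qed

lemma rst_rst_cmp [simp]:
  "f \<in> Ar A \<Longrightarrow> g \<in> Ar A \<Longrightarrow> Dom A g = Cod A f \<Longrightarrow> Rst A (Rst A g \<cdot> f) = Rst A (g \<cdot> f)"
  using rst_past[of f g] by simp

lemma rst_total_cmp:
  assumes "f \<in> Ar A" "total_map A g" "Dom A g = Cod A f"
  shows "Rst A (g \<cdot> f) = Rst A f"
proof -
  have "Rst A (g \<cdot> f) = Rst A (Rst A g \<cdot> f)"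
    by (rule rst_rst_cmp[symmetric]) (use assms in \<open>simp_all add: total_map_def\<close>)
  also have "Rst A g \<cdot> f = f"
    using assms by (simp add: total_map_def)
  finally show ?thesis .
qed

lemma rle_refl: "f \<in> Ar A \<Longrightarrow> rle A f f"
  by (simp add: rle_def)

lemma rleD:
  assumes "rle A f g"
  shows "f \<in> Ar A" "g \<in> Ar A" "Dom A f = Dom A g" "Cod A f = Cod A g" "g \<cdot> Rst A f = f"
  using assms by (auto simp: rle_def)

lemma rleI:
  "f \<in> Ar A \<Longrightarrow> g \<in> Ar A \<Longrightarrow> Dom A f = Dom A g \<Longrightarrow> Cod A f = Cod A g \<Longrightarrow> g \<cdot> Rst A f = f \<Longrightarrow>
    rle A f g"
  by (auto simp: rle_def)

lemma rle_rst_cmp: "rle A f g \<Longrightarrow> Rst A g \<cdot> Rst A f = Rst A f"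
  using rst_of_cmp_rst[of f g] rleD[of f g] by simp

lemma rle_rst_cmp': "rle A f g \<Longrightarrow> Rst A f \<cdot> Rst A g = Rst A f"
  using rle_rst_cmp[of f g] rst_swap[of f g] rleD[of f g] by simp

lemma rle_rst: "rle A f g \<Longrightarrow> rle A (Rst A f) (Rst A g)"
  by (rule rleI) (use rleD[of f g] rle_rst_cmp[of f g] in simp_all)

lemma rle_trans:
  assumes "rle A f g" "rle A g h" shows "rle A f h"
proof (rule rleI)
  note D = rleD[OF assms(1)] rleD[OF assms(2)]
  have "h \<cdot> Rst A f = h \<cdot> Rst A g \<cdot> Rst A f"
    using rle_rst_cmp[OF assms(1)] by simp
  also have "\<dots> = (h \<cdot> Rst A g) \<cdot> Rst A f"
    using D(1-4,6-9) by simp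
  finally show "h \<cdot> Rst A f = f" by (simp only: D)
qed (use rleD[OF assms(1)] rleD[OF assms(2)] in simp_all)

lemma rle_eqI:
  assumes "rle A f g" "Rst A f = Rst A g" shows "f = g"
  using rleD[OF assms(1)] assms(2) by simp

lemma rle_antisym:
  assumes "rle A f g" "rle A g f" shows "f = g"
proof (rule rle_eqI[OF assms(1)])
  show "Rst A f = Rst A g"
    using rle_rst_cmp[OF assms(1)] rle_rst_cmp'[OF assms(2)] by simp
qed

lemma rle_cmp_rst:
  "f \<in> Ar A \<Longrightarrow> g \<in> Ar A \<Longrightarrow> Dom A f = Dom A g \<Longrightarrow> rle A (g \<cdot> Rst A f) g"
proof (rule rleI)
  assume a: "f \<in> Ar A" "g \<in> Ar A" "Dom A f = Dom A g"
  show "g \<cdot> Rst A (g \<cdot> Rst A f) = g \<cdot> Rst A f"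
    using a by simp
qed simp_all

lemma rle_cmp_left:
  assumes "rle A f g" "h \<in> Ar A" "Dom A h = Cod A f" shows "rle A (h \<cdot> f) (h \<cdot> g)"
proof -
  note D = rleD[OF assms(1)]
  have "rle A ((h \<cdot> g) \<cdot> Rst A f) (h \<cdot> g)"
    by (rule rle_cmp_rst) (use D(1-4) assms in simp_all)
  then show ?thesis using D assms by simp
qed

text \<open>The axiom \<open>rst_past\<close> moves the restriction of \<open>f\<close> across
  \<open>h\<close>, which exhibits \<open>f \<cdot> h\<close> as a restriction of
  \<open>g \<cdot> h\<close>.\<close>

lemma rle_cmp_right:
  assumes "rle A f g" "h \<in> Ar A" "Cod A h = Dom A f" shows "rle A (f \<cdot> h) (g \<cdot> h)"
proof -
  note D = rleD[OF assms(1)]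
  have "f \<cdot> h = (g \<cdot> Rst A f) \<cdot> h"
    by (simp only: D)
  also have "\<dots> = g \<cdot> Rst A f \<cdot> h"
    using D(1-4) assms(2,3) by simp
  also have "\<dots> = (g \<cdot> h) \<cdot> Rst A (f \<cdot> h)"
    using D(1-4) assms(2,3) by (simp add: rst_past[of h f])
  finally have e: "f \<cdot> h = (g \<cdot> h) \<cdot> Rst A (f \<cdot> h)" .
  have "rle A ((g \<cdot> h) \<cdot> Rst A (f \<cdot> h)) (g \<cdot> h)"
    by (rule rle_cmp_rst) (use D(1-4) assms in simp_all)
  then show ?thesis using e by simp
qed

lemma rle_compatible:
  assumes "rle A f h" "rle A g h" shows "compatible A f g"
proof -
  note D = rleD[OF assms(1)] and E = rleD[OF assms(2)]
  have "f \<cdot> Rst A g = (h \<cdot> Rst A f) \<cdot> Rst A g" using D by simp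
  also have "\<dots> = h \<cdot> Rst A f \<cdot> Rst A g" using D(1-4) E(1-4) by simp
  also have "\<dots> = h \<cdot> Rst A g \<cdot> Rst A f" using D(1-4) E(1-4) by (simp add: rst_swap)
  also have "\<dots> = (h \<cdot> Rst A g) \<cdot> Rst A f" using D(1-4) E(1-4) by simp
  also have "\<dots> = g \<cdot> Rst A f" using E by simp
  finally show ?thesis using D(1-4) E(1-4) by (simp add: compatible_def)
qed

text \<open>An asymmetric form of compatibility, for situations in which only inequalities are
  available. For the converse, \<open>f \<cdot> Rst g\<close> equals
  \<open>g \<cdot> Rst f \<cdot> Rst g\<close>, and \<open>g\<close> absorbs
  \<open>Rst g\<close>.\<close>

lemma compatible_iff_rle:
  assumes "f \<in> Ar A" "g \<in> Ar A" "Dom A f = Dom A g" "Cod A f = Cod A g"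
  shows "compatible A f g \<longleftrightarrow> rle A (f \<cdot> Rst A g) g"
proof
  assume "compatible A f g"
  then show "rle A (f \<cdot> Rst A g) g"
    using rle_cmp_rst[of f g] assms by (simp add: compatible_def)
next
  assume "rle A (f \<cdot> Rst A g) g"
  from rleD(5)[OF this] have "f \<cdot> Rst A g = g \<cdot> Rst A f \<cdot> Rst A g"
    using assms by simp
  also have "\<dots> = g \<cdot> Rst A g \<cdot> Rst A f"
    using assms by (simp add: rst_swap)
  also have "\<dots> = g \<cdot> Rst A f"
    using assms by simp
  finally show "compatible A f g" using assms by (simp add: compatible_def)
qed

lemma ridemD:
  assumes "e \<in> ridem A a"
  shows "e \<in> Ar A" "Dom A e = a" "Cod A e = a" "Rst A e = e"
  using assms by (auto simp: ridem_def Hom_def)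

lemma ridemI: "e \<in> Ar A \<Longrightarrow> Dom A e = a \<Longrightarrow> Rst A e = e \<Longrightarrow> e \<in> ridem A a"
  using rst_simps(3)[of e] by (simp add: ridem_def Hom_def)

lemma rst_ridem: "f \<in> Ar A \<Longrightarrow> Dom A f = a \<Longrightarrow> Rst A f \<in> ridem A a"
  by (rule ridemI) simp_all

lemma ridem_swap: "d \<in> ridem A a \<Longrightarrow> e \<in> ridem A a \<Longrightarrow> d \<cdot> e = e \<cdot> d"
  using rst_swap[of d e] ridemD[of d a] ridemD[of e a] by simp

lemma ridem_cmp: 
  assumes "d \<in> ridem A a" "e \<in> ridem A a" shows "d \<cdot> e \<in> ridem A a"
  by (rule ridemI) (use ridemD[OF assms(1)] ridemD[OF assms(2)] rst_of_cmp_rst[of e d] in simp_all)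

lemma ridem_cmp_self: "e \<in> ridem A a \<Longrightarrow> e \<cdot> e = e"
  using rst_idem[of e] ridemD[of e a] by simp

lemma ridem_rle_iff:
  assumes "d \<in> ridem A a" "e \<in> ridem A a" shows "rle A d e \<longleftrightarrow> e \<cdot> d = d"
  using ridemD[OF assms(1)] ridemD[OF assms(2)] by (auto simp: rle_def)

lemma ridem_cmp_rle:
  assumes "d \<in> ridem A a" "e \<in> ridem A a" shows "rle A (d \<cdot> e) d" "rle A (d \<cdot> e) e"
  using rle_cmp_rst[of d e] rle_cmp_rst[of e d] ridem_swap[OF assms]
    ridemD[OF assms(1)] ridemD[OF assms(2)] by simp_all

lemma rle_ridem:
  assumes "e \<in> ridem A a" "rle A d e" shows "d \<in> ridem A a"
proof (rule ridemI)
  note E = ridemD[OF assms(1)] and D = rleD[OF assms(2)]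
  have "e \<cdot> Rst A d = Rst A d" using rle_rst_cmp[OF assms(2)] by (simp only: E)
  then show "Rst A d = d" by (simp only: D)
qed (use ridemD(1-3)[OF assms(1)] rleD(1-4)[OF assms(2)] in simp_all)

section \<open>Joins of parallel maps\<close>

lemma is_joinD:
  assumes "is_join A a b S g"
  shows "S \<subseteq> Hom A a b" "g \<in> Ar A" "Dom A g = a" "Cod A g = b" "f \<in> S \<Longrightarrow> rle A f g"
    "h \<in> Ar A \<Longrightarrow> Dom A h = a \<Longrightarrow> Cod A h = b \<Longrightarrow> (\<And>f. f \<in> S \<Longrightarrow> rle A f h) \<Longrightarrow> rle A g h"
  using assms by (auto simp: is_join_def Hom_def)

lemma is_joinI:
  assumes "g \<in> Ar A" "Dom A g = a" "Cod A g = b" "\<And>f. f \<in> S \<Longrightarrow> rle A f g"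
    "\<And>h. h \<in> Ar A \<Longrightarrow> Dom A h = a \<Longrightarrow> Cod A h = b \<Longrightarrow> (\<And>f. f \<in> S \<Longrightarrow> rle A f h) \<Longrightarrow> rle A g h"
  shows "is_join A a b S g"
  using assms rleD(1,3,4) unfolding is_join_def Hom_def by blast

lemma is_join_unique:
  assumes "is_join A a b S g" "is_join A a b S h" shows "g = h"
proof -
  note G = is_joinD[OF assms(1)] and H = is_joinD[OF assms(2)]
  have "rle A g h" by (rule G(6)[OF H(2-5)])
  moreover have "rle A h g" by (rule H(6)[OF G(2-5)])
  ultimately show ?thesis by (rule rle_antisym)
qed

lemma join_of_eq: "is_join A a b S g \<Longrightarrow> join_of A a b S = g"
  unfolding join_of_def using is_join_unique by blast

lemma is_join_compatible_family: "is_join A a b S g \<Longrightarrow> compatible_family A a b S"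
  using rle_compatible unfolding compatible_family_def is_join_def by blast

lemma bounded_compatible_family:
  "h \<in> Hom A a b \<Longrightarrow> (\<And>f. f \<in> S \<Longrightarrow> rle A f h) \<Longrightarrow> compatible_family A a b S"
  unfolding compatible_family_def Hom_def
  by (auto intro: rle_compatible rleD(1) dest: rleD(3,4))

text \<open>Both families have the same upper bounds. The outer join is not assumed to exist on
  either side, hence the equivalence.\<close>

lemma is_join_UN:
  assumes m: "\<And>t. t \<in> S \<Longrightarrow> is_join A a b (G t) (m t)"
  shows "is_join A a b (\<Union>t\<in>S. G t) g \<longleftrightarrow> is_join A a b (m ` S) g"
proof
  assume g: "is_join A a b (\<Union>t\<in>S. G t) g"
  note D = is_joinD[OF g]
  show "is_join A a b (m ` S) g"
  proof (rule is_joinI[OF D(2-4)])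
    show "rle A x g" if "x \<in> m ` S" for x
      using that is_joinD(6)[OF m D(2-4)] D(5) by blast
    fix u assume "u \<in> Ar A" "Dom A u = a" "Cod A u = b" and u: "\<And>f. f \<in> m ` S \<Longrightarrow> rle A f u"
    then show "rle A g u"
      by (intro D(6)) (use rle_trans is_joinD(5)[OF m] in blast)+
  qed
next
  assume g: "is_join A a b (m ` S) g"
  note D = is_joinD[OF g]
  show "is_join A a b (\<Union>t\<in>S. G t) g"
  proof (rule is_joinI[OF D(2-4)])
    show "rle A x g" if "x \<in> (\<Union>t\<in>S. G t)" for x
      using that rle_trans[OF is_joinD(5)[OF m] D(5)] by blast
    fix u assume "u \<in> Ar A" "Dom A u = a" "Cod A u = b"
      and u: "\<And>f. f \<in> (\<Union>t\<in>S. G t) \<Longrightarrow> rle A f u"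
    then show "rle A g u"
      by (intro D(6)) (use is_joinD(6)[OF m] in blast)+
  qed
qed

lemma is_join_singleton: "f \<in> Hom A a b \<Longrightarrow> is_join A a b {f} f"
  by (rule is_joinI) (auto simp: Hom_def rle_refl)

end

section \<open>Joins against restriction and composition\<close>

context join_restriction_category
begin

lemma ex_join: "a \<in> Ob A \<Longrightarrow> b \<in> Ob A \<Longrightarrow> compatible_family A a b S \<Longrightarrow> \<exists>g. is_join A a b S g"
  using joins by blast

lemma is_join_precomp:
  assumes "is_join A a b S g" "h \<in> Ar A" "Dom A h = c" "Cod A h = a"
  shows "is_join A c b ((\<lambda>f. f \<cdot> h) ` S) (g \<cdot> h)"
proof -
  have "a \<in> Ob A" "b \<in> Ob A" "c \<in> Ob A"
    using is_joinD[OF assms(1)] dom_obj cod_obj assms by auto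
  then obtain g' where "is_join A a b S g'"
      "\<And>c h. c \<in> Ob A \<Longrightarrow> h \<in> Hom A c a \<Longrightarrow> is_join A c b ((\<lambda>f. f \<cdot> h) ` S) (g' \<cdot> h)"
    using joins[of a b S] is_join_compatible_family[OF assms(1)] by blast
  then show ?thesis
    using is_join_unique[OF assms(1)] assms \<open>c \<in> Ob A\<close> by (auto simp: Hom_def)
qed

text \<open>Let \<open>e\<close> be the join of the restrictions. It lies below
  \<open>Rst g\<close>, while \<open>g \<cdot> e\<close> still bounds \<open>S\<close>, so
  \<open>g\<close> lies below \<open>g \<cdot> e\<close>; comparing restrictions gives
  \<open>e = Rst g\<close>.\<close>

lemma is_join_rst:
  assumes j: "is_join A a b S g"
  shows "is_join A a a (Rst A ` S) (Rst A g)"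
proof -
  note D = is_joinD[OF j]
  have ob: "a \<in> Ob A" using D dom_obj by auto
  have le: "rle A x (Rst A g)" if "x \<in> Rst A ` S" for x
    using that D(5) rle_rst by auto
  have "compatible_family A a a (Rst A ` S)"
    by (rule bounded_compatible_family[of "Rst A g"]) (use D(2-4) le in \<open>auto simp: Hom_def\<close>)
  then obtain e where e: "is_join A a a (Rst A ` S) e"
    using ex_join ob by blast
  note E = is_joinD[OF e]
  have eg: "rle A e (Rst A g)"
    by (rule E(6)) (use D(2-4) le in simp_all)
  then have ri: "e \<in> ridem A a"
    using rle_ridem rst_ridem D(2,3) by blast
  note R = ridemD[OF ri]
  have "rle A g (g \<cdot> e)"
  proof (rule D(6))
    fix f assume f: "f \<in> S"
    note F = rleD[OF D(5)[OF f]]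
    show "rle A f (g \<cdot> e)"
    proof (rule rleI)
      have "e \<cdot> Rst A f = Rst A f" using rleD[OF E(5)[of "Rst A f"]] f F(1) by simp
      then show "(g \<cdot> e) \<cdot> Rst A f = f" using D(2-4) F R by simp
    qed (use D(2-4) F(1-4) R(1-3) in simp_all)
  qed (use D(2-4) R in simp_all)
  then have "Rst A (g \<cdot> e) \<cdot> Rst A g = Rst A g"
    by (rule rle_rst_cmp)
  moreover have "Rst A (g \<cdot> e) = Rst A g \<cdot> e"
    using rst_of_cmp_rst[of e g] R D(2-4) by simp
  moreover have "Rst A g \<cdot> e = e"
    using rleD(5)[OF eg] R by simp
  ultimately have "e \<cdot> Rst A g = Rst A g" by simp
  moreover have "e \<cdot> Rst A g = Rst A g \<cdot> e"
    by (rule ridem_swap[OF ri rst_ridem]) (use D in auto)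
  ultimately have "e = Rst A g" using \<open>Rst A g \<cdot> e = e\<close> by simp
  then show ?thesis using e by simp
qed

text \<open>Comparable maps with equal restrictions are equal. Since the join of \<open>S\<close>
  lies below the bound \<open>g\<close>, only restrictions remain to be compared.\<close>

lemma is_join_of_rst:
  assumes g: "g \<in> Ar A" "Dom A g = a" "Cod A g = b"
    and le: "\<And>f. f \<in> S \<Longrightarrow> rle A f g" and j: "is_join A a a (Rst A ` S) (Rst A g)"
  shows "is_join A a b S g"
proof -
  have "compatible_family A a b S"
    by (rule bounded_compatible_family[of g]) (use g le in \<open>auto simp: Hom_def\<close>)
  then obtain h where h: "is_join A a b S h"
    using ex_join dom_obj cod_obj g by blast
  have "rle A h g" by (rule is_joinD(6)[OF h]) (use g le in simp_all)
  moreover have "Rst A h = Rst A g" using is_join_unique[OF is_join_rst[OF h] j] .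
  ultimately have "h = g" by (rule rle_eqI)
  then show ?thesis using h by simp
qed

text \<open>The axioms give preservation of joins by precomposition only. On restrictions,
  \<open>Rst (h \<cdot> f) = Rst f \<cdot> Rst (h \<cdot> g)\<close> for \<open>f\<close> in
  \<open>S\<close>, so the claim becomes precomposition of the join of the \<open>Rst f\<close> with
  \<open>Rst (h \<cdot> g)\<close>.\<close>

lemma is_join_postcomp:
  assumes j: "is_join A a b S g" and h: "h \<in> Ar A" "Dom A h = b" "Cod A h = c"
  shows "is_join A a c ((\<lambda>f. h \<cdot> f) ` S) (h \<cdot> g)"
proof (rule is_join_of_rst)
  note D = is_joinD[OF j]
  show "rle A x (h \<cdot> g)" if "x \<in> (\<lambda>f. h \<cdot> f) ` S" for x
    using that rle_cmp_left[OF D(5)] rleD(4)[OF D(5)] h D(4) by auto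
  have "is_join A a a ((\<lambda>f. f \<cdot> Rst A (h \<cdot> g)) ` (Rst A ` S)) (Rst A g \<cdot> Rst A (h \<cdot> g))"
    by (rule is_join_precomp[OF is_join_rst[OF j]]) (use D(2-4) h in simp_all)
  moreover have "Rst A f \<cdot> Rst A (h \<cdot> g) = Rst A (h \<cdot> f)" if "f \<in> S" for f
  proof -
    note F = rleD[OF D(5)[OF that]]
    have "h \<cdot> f = h \<cdot> g \<cdot> Rst A f" using F by simp
    also have "\<dots> = (h \<cdot> g) \<cdot> Rst A f" using F(1-4) h D(2-4) by simp
    finally have "Rst A (h \<cdot> f) = Rst A (h \<cdot> g) \<cdot> Rst A f" 
      using F(1-4) h D(2-4) rst_of_cmp_rst[of f "h \<cdot> g"] by simp
    then show ?thesis using F(1-4) h D(2-4) rst_swap[of f "h \<cdot> g"] by simp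
  qed
  ultimately show "is_join A a a (Rst A ` ((\<lambda>f. h \<cdot> f) ` S)) (Rst A (h \<cdot> g))"
    using D(2-4) h by (simp add: image_image cong: image_cong)
qed (use is_joinD[OF j] h in simp_all)

lemma is_join_cmp:
  assumes S: "is_join A a b S f" and T: "is_join A b c T g"
  shows "is_join A a c ((\<lambda>(y, x). y \<cdot> x) ` (T \<times> S)) (g \<cdot> f)"
proof -
  note D = is_joinD[OF S] and E = is_joinD[OF T]
  have x: "x \<in> Ar A" "Dom A x = a" "Cod A x = b" if "x \<in> S" for x
    using rleD[OF D(5)[OF that]] D(2-4) by auto
  have "is_join A a c ((\<lambda>y. y \<cdot> x) ` T) (g \<cdot> x)" if "x \<in> S" for x
    by (rule is_join_precomp[OF T]) (use x[OF that] in simp_all)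
  moreover have "is_join A a c ((\<lambda>x. g \<cdot> x) ` S) (g \<cdot> f)"
    by (rule is_join_postcomp[OF S]) (use E in simp_all)
  ultimately have "is_join A a c (\<Union>x\<in>S. (\<lambda>y. y \<cdot> x) ` T) (g \<cdot> f)"
    by (subst is_join_UN) auto
  moreover have "(\<Union>x\<in>S. (\<lambda>y. y \<cdot> x) ` T) = (\<lambda>(y, x). y \<cdot> x) ` (T \<times> S)" by auto
  ultimately show ?thesis by simp
qed

end

section \<open>The category \<open>\<Phi>\<close> of partial sections\<close>

locale partite_category_in = restriction_category K + partite_internal_category K AA
  for K :: "('c, 'k) rcat" (structure) and AA :: "('i, 'c, 'k) pcat"
begin

lemma po_ob [simp]: "i \<in> Idx AA \<Longrightarrow> PO AA i \<in> Ob K"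
  by (rule po_obj)

lemma pa_ob [simp]: "i \<in> Idx AA \<Longrightarrow> j \<in> Idx AA \<Longrightarrow> PA AA i j \<in> Ob K"
  by (rule pa_obj)

lemma Sg_simps [simp]:
  assumes "i \<in> Idx AA" "j \<in> Idx AA"
  shows "Sg AA i j \<in> Ar K" "Dom K (Sg AA i j) = PA AA i j" "Cod K (Sg AA i j) = PO AA i"
    "Rst K (Sg AA i j) = Ide K (PA AA i j)"
  using source[OF assms] by (auto simp: Hom_def total_map_def)

lemma Tg_simps [simp]:
  assumes "i \<in> Idx AA" "j \<in> Idx AA"
  shows "Tg AA i j \<in> Ar K" "Dom K (Tg AA i j) = PA AA i j" "Cod K (Tg AA i j) = PO AA j"
    "Rst K (Tg AA i j) = Ide K (PA AA i j)"
  using target[OF assms] by (auto simp: Hom_def total_map_def)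

lemma rst_Sg_cmp [simp]:
  "i \<in> Idx AA \<Longrightarrow> j \<in> Idx AA \<Longrightarrow> f \<in> Ar K \<Longrightarrow> Cod K f = PA AA i j \<Longrightarrow>
    Rst K (Sg AA i j \<cdot> f) = Rst K f"
  by (rule rst_total_cmp) (simp_all add: total_map_def)

lemma rst_Tg_cmp [simp]:
  "i \<in> Idx AA \<Longrightarrow> j \<in> Idx AA \<Longrightarrow> f \<in> Ar K \<Longrightarrow> Cod K f = PA AA i j \<Longrightarrow>
    Rst K (Tg AA i j \<cdot> f) = Rst K f"
  by (rule rst_total_cmp) (simp_all add: total_map_def)

lemma Unt_simps [simp]:
  assumes "i \<in> Idx AA"
  shows "Unt AA i \<in> Ar K" "Dom K (Unt AA i) = PO AA i" "Cod K (Unt AA i) = PA AA i i"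
    "Sg AA i i \<cdot> Unt AA i = Ide K (PO AA i)" "Tg AA i i \<cdot> Unt AA i = Ide K (PO AA i)"
    "Rst K (Unt AA i) = Ide K (PO AA i)"
proof -
  show *: "Unt AA i \<in> Ar K" "Dom K (Unt AA i) = PO AA i" "Cod K (Unt AA i) = PA AA i i"
    "Sg AA i i \<cdot> Unt AA i = Ide K (PO AA i)" "Tg AA i i \<cdot> Unt AA i = Ide K (PO AA i)"
    using unit[OF assms] by (auto simp: Hom_def)
  show "Rst K (Unt AA i) = Ide K (PO AA i)"
    using rst_Sg_cmp[of i i "Unt AA i"] * assms by simp
qed

lemma Unt_cmp_simps [simp]:
  assumes "i \<in> Idx AA" "f \<in> Ar K" "Cod K f = PO AA i"
  shows "Sg AA i i \<cdot> Unt AA i \<cdot> f = f" "Tg AA i i \<cdot> Unt AA i \<cdot> f = f"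
    "Rst K (Unt AA i \<cdot> f) = Rst K f"
proof -
  show "Sg AA i i \<cdot> Unt AA i \<cdot> f = f"
    using assoc[of f "Unt AA i" "Sg AA i i"] assms by simp
  show "Tg AA i i \<cdot> Unt AA i \<cdot> f = f"
    using assoc[of f "Unt AA i" "Tg AA i i"] assms by simp
  show "Rst K (Unt AA i \<cdot> f) = Rst K f"
    by (rule rst_total_cmp) (use assms in \<open>simp_all add: total_map_def\<close>)
qed

section \<open>Maps into the chosen pullbacks\<close>

context
  fixes i j k
  assumes ijk [simp]: "i \<in> Idx AA" "j \<in> Idx AA" "k \<in> Idx AA"
begin

lemma Pr_simps [simp]:
  "PB AA i j k \<in> Ob K"
  "Pr1 AA i j k \<in> Ar K" "Dom K (Pr1 AA i j k) = PB AA i j k" "Cod K (Pr1 AA i j k) = PA AA j k"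
  "Pr2 AA i j k \<in> Ar K" "Dom K (Pr2 AA i j k) = PB AA i j k" "Cod K (Pr2 AA i j k) = PA AA i j"
  "Sg AA j k \<cdot> Pr1 AA i j k = Tg AA i j \<cdot> Pr2 AA i j k"
  using composable[OF ijk] by (auto simp: is_pullback_def Hom_def)

lemma pairing_unique:
  assumes "a \<in> Ar K" "Cod K a = PA AA j k" "b \<in> Ar K" "Cod K b = PA AA i j" "Dom K a = Dom K b"
    "Sg AA j k \<cdot> a = Tg AA i j \<cdot> b"
  shows "\<exists>!u. u \<in> Hom K (Dom K a) (PB AA i j k) \<and> Pr1 AA i j k \<cdot> u = a \<and> Pr2 AA i j k \<cdot> u = b"
proof -
  have "\<forall>T\<in>Ob K. \<forall>a\<in>Hom K T (PA AA j k). \<forall>b\<in>Hom K T (PA AA i j).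
      Sg AA j k \<cdot> a = Tg AA i j \<cdot> b \<longrightarrow>
      (\<exists>!u. u \<in> Hom K T (PB AA i j k) \<and> Pr1 AA i j k \<cdot> u = a \<and> Pr2 AA i j k \<cdot> u = b)"
    using composable[OF ijk] by (simp add: is_pullback_def)
  then show ?thesis using assms dom_obj[of a] by (auto simp: Hom_def)
qed

lemma pairing_simps [simp]:
  assumes "a \<in> Ar K" "Cod K a = PA AA j k" "b \<in> Ar K" "Cod K b = PA AA i j" "Dom K a = Dom K b"
    "Sg AA j k \<cdot> a = Tg AA i j \<cdot> b"
  shows "pairing K AA i j k a b \<in> Ar K" "Dom K (pairing K AA i j k a b) = Dom K b"
    "Cod K (pairing K AA i j k a b) = PB AA i j k"
    "Pr1 AA i j k \<cdot> pairing K AA i j k a b = a"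
    "Pr2 AA i j k \<cdot> pairing K AA i j k a b = b"
  using theI'[OF pairing_unique[OF assms]] assms(5) by (auto simp: pairing_def Hom_def)

lemma pairing_eqI:
  assumes "u \<in> Ar K" "Cod K u = PB AA i j k" "Pr1 AA i j k \<cdot> u = a" "Pr2 AA i j k \<cdot> u = b"
  shows "pairing K AA i j k a b = u"
proof -
  have d: "Dom K a = Dom K u" "Dom K b = Dom K u" "a \<in> Ar K" "b \<in> Ar K" "Cod K a = PA AA j k"
      "Cod K b = PA AA i j"
    using assms cmp_simps[of u "Pr1 AA i j k"] cmp_simps[of u "Pr2 AA i j k"] by auto
  have "Sg AA j k \<cdot> a = (Sg AA j k \<cdot> Pr1 AA i j k) \<cdot> u"
    unfolding assms(3)[symmetric] by (rule assoc[symmetric]) (use assms(1,2) in simp_all)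
  also have "\<dots> = Tg AA i j \<cdot> Pr2 AA i j k \<cdot> u"
    using assms(1,2) by simp
  finally have "Sg AA j k \<cdot> a = Tg AA i j \<cdot> b" using assms(4) by simp
  from pairing_unique[OF d(3,5,4,6) _ this] d have
    "\<exists>!u. u \<in> Hom K (Dom K a) (PB AA i j k) \<and> Pr1 AA i j k \<cdot> u = a \<and> Pr2 AA i j k \<cdot> u = b"
    by simp
  moreover have "u \<in> Hom K (Dom K a) (PB AA i j k) \<and> Pr1 AA i j k \<cdot> u = a \<and> Pr2 AA i j k \<cdot> u = b"
    using assms d by (simp add: Hom_def)
  ultimately show ?thesis unfolding pairing_def by (rule the1_equality)
qed

lemma pairing_cmp:
  assumes "a \<in> Ar K" "Cod K a = PA AA j k" "b \<in> Ar K" "Cod K b = PA AA i j" "Dom K a = Dom K b"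
    "Sg AA j k \<cdot> a = Tg AA i j \<cdot> b" "x \<in> Ar K" "Cod K x = Dom K b"
  shows "pairing K AA i j k a b \<cdot> x = pairing K AA i j k (a \<cdot> x) (b \<cdot> x)"
proof (rule pairing_eqI[symmetric])
  note P = pairing_simps[OF assms(1-6)]
  show "Pr1 AA i j k \<cdot> pairing K AA i j k a b \<cdot> x = a \<cdot> x"
    using assoc[of x "pairing K AA i j k a b" "Pr1 AA i j k"] P(1-3) assms(7,8)
    by (simp add: P(4))
  show "Pr2 AA i j k \<cdot> pairing K AA i j k a b \<cdot> x = b \<cdot> x"
    using assoc[of x "pairing K AA i j k a b" "Pr2 AA i j k"] P(1-3) assms(7,8)
    by (simp add: P(5))
qed (use pairing_simps(1-3)[OF assms(1-6)] assms(7,8) in simp_all)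

text \<open>Test maps of \<open>is_pullback\<close> may be partial, so totality of a projection
  needs an argument. As \<open>Sg\<close> and \<open>Tg\<close> are total, both projections have the
  same restriction; that restriction and the identity then solve the same pairing problem.\<close>

lemma Pr2_total: "Rst K (Pr2 AA i j k) = Ide K (PB AA i j k)"
proof -
  have "Rst K (Pr1 AA i j k) = Rst K (Sg AA j k \<cdot> Pr1 AA i j k)"
    by (rule rst_Sg_cmp[symmetric]) simp_all
  also have "\<dots> = Rst K (Pr2 AA i j k)" by simp
  finally have "Pr1 AA i j k \<cdot> Rst K (Pr2 AA i j k) = Pr1 AA i j k"
    using cmp_rst_self[of "Pr1 AA i j k"] by simp
  then have "pairing K AA i j k (Pr1 AA i j k) (Pr2 AA i j k) = Rst K (Pr2 AA i j k)"
    by (intro pairing_eqI) simp_all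
  moreover have "pairing K AA i j k (Pr1 AA i j k) (Pr2 AA i j k) = Ide K (PB AA i j k)"
    by (intro pairing_eqI) simp_all
  ultimately show ?thesis by simp
qed

lemma Mu_simps [simp]:
  "Mu AA i j k \<in> Ar K" "Dom K (Mu AA i j k) = PB AA i j k" "Cod K (Mu AA i j k) = PA AA i k"
  "Sg AA i k \<cdot> Mu AA i j k = Sg AA i j \<cdot> Pr2 AA i j k"
  "Tg AA i k \<cdot> Mu AA i j k = Tg AA j k \<cdot> Pr1 AA i j k"
  "Rst K (Mu AA i j k) = Ide K (PB AA i j k)"
proof -
  show *: "Mu AA i j k \<in> Ar K" "Dom K (Mu AA i j k) = PB AA i j k" "Cod K (Mu AA i j k) = PA AA i k"
    "Sg AA i k \<cdot> Mu AA i j k = Sg AA i j \<cdot> Pr2 AA i j k"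
    "Tg AA i k \<cdot> Mu AA i j k = Tg AA j k \<cdot> Pr1 AA i j k"
    using mult[OF ijk] by (auto simp: Hom_def)
  show "Rst K (Mu AA i j k) = Ide K (PB AA i j k)"
    using rst_Sg_cmp[of i k "Mu AA i j k"] * by (simp add: Pr2_total)
qed

lemma Mu_cmp_simps [simp]:
  assumes [simp]: "u \<in> Ar K" "Cod K u = PB AA i j k"
  shows "Sg AA i k \<cdot> Mu AA i j k \<cdot> u = Sg AA i j \<cdot> Pr2 AA i j k \<cdot> u"
    "Tg AA i k \<cdot> Mu AA i j k \<cdot> u = Tg AA j k \<cdot> Pr1 AA i j k \<cdot> u"
    "Rst K (Mu AA i j k \<cdot> u) = Rst K u" 
proof -
  show "Sg AA i k \<cdot> Mu AA i j k \<cdot> u = Sg AA i j \<cdot> Pr2 AA i j k \<cdot> u"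
    using assoc[of u "Mu AA i j k" "Sg AA i k"] by simp
  show "Tg AA i k \<cdot> Mu AA i j k \<cdot> u = Tg AA j k \<cdot> Pr1 AA i j k \<cdot> u"
    using assoc[of u "Mu AA i j k" "Tg AA i k"] by simp
  show "Rst K (Mu AA i j k \<cdot> u) = Rst K u"
    by (rule rst_total_cmp) (simp_all add: total_map_def)
qed

end

section \<open>Partial sections and their composition\<close>

definition sec :: "'i \<Rightarrow> 'i \<Rightarrow> 'k \<Rightarrow> bool" where
  "sec i j s \<longleftrightarrow> i \<in> Idx AA \<and> j \<in> Idx AA \<and> partial_section K (Sg AA i j) s"

lemma secD:
  assumes "sec i j s"
  shows "i \<in> Idx AA" "j \<in> Idx AA" "s \<in> Ar K" "Dom K s = PO AA i" "Cod K s = PA AA i j"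
    "Sg AA i j \<cdot> s = Rst K s"
  using assms by (auto simp: sec_def partial_section_def Hom_def)

lemma secI:
  "i \<in> Idx AA \<Longrightarrow> j \<in> Idx AA \<Longrightarrow> s \<in> Ar K \<Longrightarrow> Dom K s = PO AA i \<Longrightarrow> Cod K s = PA AA i j \<Longrightarrow>
    Sg AA i j \<cdot> s = Rst K s \<Longrightarrow> sec i j s"
  by (auto simp: sec_def partial_section_def Hom_def)

definition scmp :: "'i \<Rightarrow> 'i \<Rightarrow> 'i \<Rightarrow> 'k \<Rightarrow> 'k \<Rightarrow> 'k" where
  "scmp i j k t s = Mu AA i j k \<cdot> tau_star K AA i j k t \<cdot> s"

lemma sec_cmp_left:
  assumes "sec j k t" "x \<in> Ar K" "Cod K x = PO AA j"
  shows "Sg AA j k \<cdot> t \<cdot> x = Rst K t \<cdot> x"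
  using assoc[of x t "Sg AA j k"] secD[OF assms(1)] assms(2,3) by simp

text \<open>The matching condition behind the pairing that defines composition:
  \<open>t \<cdot> Tg \<cdot> x\<close> is undefined where \<open>t\<close> is, so the other
  component \<open>x\<close> must be cut down to the same domain before the two agree in
  \<open>A_j\<close>.\<close>

lemma sec_match:
  assumes t: "sec j k t" and i: "i \<in> Idx AA" and x: "x \<in> Ar K" "Cod K x = PA AA i j"
  shows "Sg AA j k \<cdot> t \<cdot> Tg AA i j \<cdot> x = Tg AA i j \<cdot> x \<cdot> Rst K (t \<cdot> Tg AA i j \<cdot> x)"
proof -
  note T = secD[OF t]
  have "Sg AA j k \<cdot> t \<cdot> Tg AA i j \<cdot> x = Rst K t \<cdot> Tg AA i j \<cdot> x"
    by (rule sec_cmp_left[OF t]) (use T(1-5) i x in simp_all)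
  also have "\<dots> = (Tg AA i j \<cdot> x) \<cdot> Rst K (t \<cdot> Tg AA i j \<cdot> x)"
    by (rule rst_past) (use T(1-5) i x in simp_all)
  finally show ?thesis using T(1-5) i x by simp
qed

context
  fixes i j k t
  assumes t: "sec j k t" and i [simp]: "i \<in> Idx AA"
begin

lemma tau_star_simps [simp]:
  "tau_star K AA i j k t \<in> Ar K" "Dom K (tau_star K AA i j k t) = PA AA i j"
  "Cod K (tau_star K AA i j k t) = PB AA i j k"
proof -
  note T [simp] = secD(1-5)[OF t]
  have "Sg AA j k \<cdot> t \<cdot> Tg AA i j = Tg AA i j \<cdot> Rst K (t \<cdot> Tg AA i j)"
    using sec_match[OF t i, of "Ide K (PA AA i j)"] by simp
  then show "tau_star K AA i j k t \<in> Ar K" "Dom K (tau_star K AA i j k t) = PA AA i j"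
      "Cod K (tau_star K AA i j k t) = PB AA i j k"
    unfolding tau_star_def by simp_all
qed

lemma tau_star_cmp:
  assumes [simp]: "x \<in> Ar K" "Cod K x = PA AA i j"
  shows "tau_star K AA i j k t \<cdot> x =
    pairing K AA i j k (t \<cdot> Tg AA i j \<cdot> x) (x \<cdot> Rst K (t \<cdot> Tg AA i j \<cdot> x))"
proof -
  note T [simp] = secD(1-5)[OF t]
  have e: "Sg AA j k \<cdot> t \<cdot> Tg AA i j = Tg AA i j \<cdot> Rst K (t \<cdot> Tg AA i j)"
    using sec_match[OF t i, of "Ide K (PA AA i j)"] by simp
  have "tau_star K AA i j k t \<cdot> x =
      pairing K AA i j k ((t \<cdot> Tg AA i j) \<cdot> x) (Rst K (t \<cdot> Tg AA i j) \<cdot> x)"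
    unfolding tau_star_def by (rule pairing_cmp) (simp_all add: e)
  also have "Rst K (t \<cdot> Tg AA i j) \<cdot> x = x \<cdot> Rst K ((t \<cdot> Tg AA i j) \<cdot> x)"
    by (rule rst_past) simp_all
  finally show ?thesis by simp
qed

text \<open>The map \<open>x\<close> need not be a section, so that composites can also be evaluated
  on restricted sections and on maps such as \<open>t \<cdot> Tg \<cdot> s\<close> in the proof of
  associativity.\<close>

lemma scmp_eq:
  assumes s: "x \<in> Ar K" "Cod K x = PA AA i j"
  shows "scmp i j k t x =
    Mu AA i j k \<cdot> pairing K AA i j k (t \<cdot> Tg AA i j \<cdot> x) (x \<cdot> Rst K (t \<cdot> Tg AA i j \<cdot> x))"
  using s unfolding scmp_def by (simp add: tau_star_cmp)

lemma scmp_assoc_right: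
  assumes "s \<in> Ar K" "Cod K s = PA AA i j" "x \<in> Ar K" "Cod K x = Dom K s"
  shows "scmp i j k t (s \<cdot> x) = scmp i j k t s \<cdot> x"
  unfolding scmp_def using assms secD(1-5)[OF t] by simp

lemma scmp_simps [simp]:
  assumes [simp]: "x \<in> Ar K" "Cod K x = PA AA i j"
  shows "scmp i j k t x \<in> Ar K" "Dom K (scmp i j k t x) = Dom K x"
    "Cod K (scmp i j k t x) = PA AA i k"
    "Sg AA i k \<cdot> scmp i j k t x = Sg AA i j \<cdot> x \<cdot> Rst K (t \<cdot> Tg AA i j \<cdot> x)"
    "Tg AA i k \<cdot> scmp i j k t x = Tg AA j k \<cdot> t \<cdot> Tg AA i j \<cdot> x"
    "Rst K (scmp i j k t x) = Rst K (t \<cdot> Tg AA i j \<cdot> x)"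
proof -
  note T [simp] = secD(1-5)[OF t]
  note m = sec_match[OF t i assms]
  define p where
    "p = pairing K AA i j k (t \<cdot> Tg AA i j \<cdot> x) (x \<cdot> Rst K (t \<cdot> Tg AA i j \<cdot> x))"
  have p [simp]: "p \<in> Ar K" "Dom K p = Dom K x" "Cod K p = PB AA i j k"
    "Pr1 AA i j k \<cdot> p = t \<cdot> Tg AA i j \<cdot> x"
    "Pr2 AA i j k \<cdot> p = x \<cdot> Rst K (t \<cdot> Tg AA i j \<cdot> x)"
    unfolding p_def using m by simp_all
  have e: "scmp i j k t x = Mu AA i j k \<cdot> p"
    unfolding p_def by (rule scmp_eq) simp_all
  show *: "scmp i j k t x \<in> Ar K" "Dom K (scmp i j k t x) = Dom K x"
    "Cod K (scmp i j k t x) = PA AA i k"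
    "Sg AA i k \<cdot> scmp i j k t x = Sg AA i j \<cdot> x \<cdot> Rst K (t \<cdot> Tg AA i j \<cdot> x)"
    "Tg AA i k \<cdot> scmp i j k t x = Tg AA j k \<cdot> t \<cdot> Tg AA i j \<cdot> x"
    unfolding e by simp_all
  have "Rst K (scmp i j k t x) = Rst K (Tg AA i k \<cdot> scmp i j k t x)"
    using * by (intro rst_Tg_cmp[symmetric]) simp_all
  also have "\<dots> = Rst K (t \<cdot> Tg AA i j \<cdot> x)"
    using *(5) by simp
  finally show "Rst K (scmp i j k t x) = Rst K (t \<cdot> Tg AA i j \<cdot> x)" .
qed

end

lemma scmp_sec:
  assumes t: "sec j k t" and s: "sec i j s"
  shows "sec i k (scmp i j k t s)"
proof (rule secI)
  note T [simp] = secD(1-5)[OF t] and S [simp] = secD(1-5)[OF s]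
  have "Sg AA i k \<cdot> scmp i j k t s = Sg AA i j \<cdot> s \<cdot> Rst K (t \<cdot> Tg AA i j \<cdot> s)"
    using t by simp
  also have "\<dots> = (Sg AA i j \<cdot> s) \<cdot> Rst K (t \<cdot> Tg AA i j \<cdot> s)"
    by simp
  also have "\<dots> = Rst K s \<cdot> Rst K (t \<cdot> Tg AA i j \<cdot> s)"
    by (simp only: secD(6)[OF s])
  also have "\<dots> = Rst K (t \<cdot> Tg AA i j \<cdot> s)"
    using rst_cmp_below(2)[of s "t \<cdot> Tg AA i j"] by simp
  finally show "Sg AA i k \<cdot> scmp i j k t s = Rst K (scmp i j k t s)"
    using t by simp
qed (use secD(1-5)[OF t] secD(1-5)[OF s] t in simp_all)

text \<open>\<open>mult_assoc\<close> needs three generalised elements over a common object that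
  match exactly, whereas sections compose only where they are defined. All are therefore restricted
  to \<open>w\<close>, the domain of definition of the triple composite; \<open>h\<close>,
  \<open>g\<close>, \<open>f\<close> are the resulting components, and the two bracketings unfold to
  the two sides of \<open>mult_assoc\<close>.\<close>

lemma scmp_assoc:
  assumes u: "sec k l u" and t: "sec j k t" and s: "sec i j s"
  shows "scmp i j l (scmp j k l u t) s = scmp i k l u (scmp i j k t s)"
proof -
  note U [simp] = secD(1-5)[OF u] and T [simp] = secD(1-5)[OF t] and S [simp] = secD(1-5)[OF s]
  define h where "h = u \<cdot> Tg AA j k \<cdot> t \<cdot> Tg AA i j \<cdot> s"
  define w where "w = Rst K h"
  define g where "g = (t \<cdot> Tg AA i j \<cdot> s) \<cdot> w"
  define f where "f = s \<cdot> w"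
  have h [simp]: "h \<in> Ar K" "Dom K h = PO AA i" "Cod K h = PA AA k l"
    by (simp_all add: h_def)
  have w [simp]: "w \<in> Ar K" "Dom K w = PO AA i" "Cod K w = PO AA i" "Rst K w = w"
    by (simp_all add: w_def)
  have g [simp]: "g \<in> Ar K" "Dom K g = PO AA i" "Cod K g = PA AA j k"
    by (simp_all add: g_def)
  have f [simp]: "f \<in> Ar K" "Dom K f = PO AA i" "Cod K f = PA AA i j"
    by (simp_all add: f_def)
  have rw: "Rst K (t \<cdot> Tg AA i j \<cdot> s) \<cdot> w = w"
    using rst_cmp_below(2)[of "t \<cdot> Tg AA i j \<cdot> s" "u \<cdot> Tg AA j k"] by (simp add: w_def h_def)
  have rg: "Rst K g = w"
    using rst_of_cmp_rst[of w "t \<cdot> Tg AA i j \<cdot> s"] rw unfolding g_def by simp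
  have uw: "u \<cdot> Tg AA j k \<cdot> g = h"
  proof -
    have "u \<cdot> Tg AA j k \<cdot> g = h \<cdot> w" by (simp add: g_def h_def)
    then show ?thesis by (simp add: w_def)
  qed
  have tw: "t \<cdot> Tg AA i j \<cdot> f = g"
    by (simp add: f_def g_def)
  have m1: "Sg AA k l \<cdot> h = Tg AA j k \<cdot> g"
    using sec_match[OF u, of j "t \<cdot> Tg AA i j \<cdot> s"] by (simp add: h_def g_def w_def)
  have m2: "Sg AA j k \<cdot> g = Tg AA i j \<cdot> f"
    using sec_match[OF t, of i f] rg cmp_rst_self[of g] 
    by (simp add: tw) (simp add: f_def w_def)
  have inner: "scmp i j k t s \<cdot> w = Mu AA i j k \<cdot> pairing K AA i j k g f"
  proof -
    have "scmp i j k t s \<cdot> w = scmp i j k t f"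
      unfolding f_def by (rule scmp_assoc_right[symmetric]) (use t in simp_all)
    also have "\<dots> = Mu AA i j k \<cdot> pairing K AA i j k g (f \<cdot> Rst K g)"
      using scmp_eq[OF t, of i f] by (simp add: tw)
    also have "f \<cdot> Rst K g = f"
      unfolding rg f_def using rst_idem[of h] by (simp add: w_def)
    finally show ?thesis .
  qed
  have "scmp i k l u (scmp i j k t s) = Mu AA i k l \<cdot> pairing K AA i k l h (scmp i j k t s \<cdot> w)"
    using scmp_eq[OF u, of i "scmp i j k t s"] t by (simp add: h_def w_def)
  also have "\<dots> = Mu AA i k l \<cdot> pairing K AA i k l h (Mu AA i j k \<cdot> pairing K AA i j k g f)"
    by (simp only: inner)
  also have "\<dots> = Mu AA i j l \<cdot> pairing K AA i j l (Mu AA j k l \<cdot> pairing K AA j k l h g) f"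
    by (rule mult_assoc[symmetric, of _ _ _ _ "PO AA i"]) (simp_all add: Hom_def m1 m2)
  also have "Mu AA j k l \<cdot> pairing K AA j k l h g = scmp j k l u t \<cdot> Tg AA i j \<cdot> s"
  proof -
    have "scmp j k l u t \<cdot> Tg AA i j \<cdot> s = scmp j k l u (t \<cdot> Tg AA i j \<cdot> s)"
      by (rule scmp_assoc_right[symmetric]) (use u in simp_all)
    also have "\<dots> = Mu AA j k l \<cdot> pairing K AA j k l h g"
      using scmp_eq[OF u, of j "t \<cdot> Tg AA i j \<cdot> s"] by (simp add: h_def g_def w_def)
    finally show ?thesis by simp
  qed
  also have "Mu AA i j l \<cdot> pairing K AA i j l (scmp j k l u t \<cdot> Tg AA i j \<cdot> s) f =
      scmp i j l (scmp j k l u t) s"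
  proof -
    have ut: "sec j l (scmp j k l u t)" by (rule scmp_sec[OF u t])
    have "Rst K (scmp j k l u t \<cdot> Tg AA i j \<cdot> s) = Rst K (Rst K (scmp j k l u t) \<cdot> Tg AA i j \<cdot> s)"
      by (rule rst_rst_cmp[symmetric]) (use u in simp_all)
    also have "\<dots> = Rst K (Rst K (u \<cdot> Tg AA j k \<cdot> t) \<cdot> Tg AA i j \<cdot> s)"
      using u by simp
    also have "\<dots> = Rst K ((u \<cdot> Tg AA j k \<cdot> t) \<cdot> Tg AA i j \<cdot> s)"
      by (rule rst_rst_cmp) simp_all
    also have "\<dots> = w" by (simp add: w_def h_def)
    finally show ?thesis
      using scmp_eq[OF ut, of i s] by (simp add: f_def)
  qed
  finally show ?thesis by simp
qed

text \<open>\<open>Unt \<cdot> Tg\<close> is total, so the restriction inside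
  \<open>tau_star\<close> is the identity and its pairing is the one of
  \<open>unit_left\<close>.\<close>

lemma scmp_Unt_left:
  assumes s: "sec i j s" shows "scmp i j j (Unt AA j) s = s"
proof -
  note S [simp] = secD(1-5)[OF s]
  have U: "sec j j (Unt AA j)" by (rule secI) simp_all
  have "Rst K (Unt AA j \<cdot> Tg AA i j) = Ide K (PA AA i j)" by simp
  then have "tau_star K AA i j j (Unt AA j) =
      pairing K AA i j j (Unt AA j \<cdot> Tg AA i j) (Ide K (PA AA i j))"
    by (simp only: tau_star_def)
  moreover have "scmp i j j (Unt AA j) s = (Mu AA i j j \<cdot> tau_star K AA i j j (Unt AA j)) \<cdot> s"
    unfolding scmp_def using U by simp
  ultimately show ?thesis by (simp add: unit_left)
qed

text \<open>Precomposing the pairing of \<open>unit_right\<close> with \<open>s\<close> gives the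
  components \<open>s\<close> and \<open>Unt \<cdot> Sg \<cdot> s = Unt \<cdot> Rst s\<close>, which
  are those of the composite.\<close>

lemma scmp_Unt_right:
  assumes s: "sec i j s" shows "scmp i i j s (Unt AA i) = s"
proof -
  note S [simp] = secD(1-5)[OF s] and s6 = secD(6)[OF s]
  have "scmp i i j s (Unt AA i) = Mu AA i i j \<cdot> pairing K AA i i j s (Unt AA i \<cdot> Rst K s)"
    using scmp_eq[OF s, of i "Unt AA i"] by simp
  also have "pairing K AA i i j s (Unt AA i \<cdot> Rst K s) =
      pairing K AA i i j (Ide K (PA AA i j)) (Unt AA i \<cdot> Sg AA i j) \<cdot> s"
    by (subst pairing_cmp) (simp_all add: s6)
  also have "Mu AA i i j \<cdot> \<dots> =
      (Mu AA i i j \<cdot> pairing K AA i i j (Ide K (PA AA i j)) (Unt AA i \<cdot> Sg AA i j)) \<cdot> s"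
    by (rule assoc[symmetric]) simp_all
  finally show ?thesis by (simp add: unit_right)
qed

lemma sec_Unt_cmp:
  assumes "i \<in> Idx AA" "e \<in> Ar K" "Dom K e = PO AA i"
  shows "sec i i (Unt AA i \<cdot> Rst K e)"
  by (rule secI) (use assms in simp_all)

text \<open>Composing in \<open>Phi\<close> with a map through the unit is precomposition in
  \<open>K\<close>. Restrictions in \<open>Phi\<close> have this form, so order and compatibility of
  sections can be read off in \<open>K\<close>.\<close>

lemma scmp_Unt_cmp:
  assumes s: "sec i j s" and e: "e \<in> Ar K" "Cod K e = PO AA i"
  shows "scmp i i j s (Unt AA i \<cdot> e) = s \<cdot> e"
proof -
  note S [simp] = secD(1-5)[OF s]
  have "scmp i i j s (Unt AA i \<cdot> e) = scmp i i j s (Unt AA i) \<cdot> e"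
    by (rule scmp_assoc_right) (use s e in simp_all)
  then show ?thesis using scmp_Unt_right[OF s] by simp
qed

text \<open>The fourth restriction axiom for \<open>Phi\<close>. In \<open>K\<close>,
  \<open>Rst t\<close> slides past \<open>Tg \<cdot> s\<close>; what remains is the left unit law
  applied to a restriction of \<open>s\<close>.\<close>

lemma scmp_Unt_rst_left:
  assumes t: "sec j k t" and s: "sec i j s"
  shows "scmp i j j (Unt AA j \<cdot> Rst K t) s = s \<cdot> Rst K (scmp i j k t s)"
proof -
  note T [simp] = secD(1-5)[OF t] and S [simp] = secD(1-5)[OF s]
  have tt: "sec j j (Unt AA j \<cdot> Rst K t)" by (rule sec_Unt_cmp) simp_all
  have U: "sec j j (Unt AA j)" by (rule secI) simp_all
  define w where "w = Rst K (t \<cdot> Tg AA i j \<cdot> s)"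
  have [simp]: "w \<in> Ar K" "Dom K w = PO AA i" "Cod K w = PO AA i" by (simp_all add: w_def)
  have p: "Rst K t \<cdot> Tg AA i j \<cdot> s = (Tg AA i j \<cdot> s) \<cdot> w"
    unfolding w_def by (rule rst_past) simp_all
  have "Rst K (Unt AA j \<cdot> Rst K t \<cdot> Tg AA i j \<cdot> s) = w"
    by (simp add: w_def)
  then have "scmp i j j (Unt AA j \<cdot> Rst K t) s =
      Mu AA i j j \<cdot> pairing K AA i j j (Unt AA j \<cdot> Tg AA i j \<cdot> s \<cdot> w) (s \<cdot> w)"
    using scmp_eq[OF tt, of i s] p by simp
  also have "\<dots> = scmp i j j (Unt AA j) (s \<cdot> w)"
    using scmp_eq[OF U, of i "s \<cdot> w"] cmp_rst_self[of "s \<cdot> w"] by simp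
  also have "\<dots> = scmp i j j (Unt AA j) s \<cdot> w"
    by (rule scmp_assoc_right[OF U]) simp_all
  also have "\<dots> = s \<cdot> w" by (simp add: scmp_Unt_left[OF s])
  finally show ?thesis using t by (simp add: w_def)
qed

section \<open>The restriction structure of \<open>Phi\<close>\<close>

lemma Phi_simps:
  "Ob (Phi K AA) = Idx AA"
  "x \<in> Ar (Phi K AA) \<longleftrightarrow> sec (fst x) (fst (snd x)) (snd (snd x))"
  "Dom (Phi K AA) x = fst x" "Cod (Phi K AA) x = fst (snd x)"
  "Ide (Phi K AA) i = (i, i, Unt AA i)"
  "y \<cdot>\<^bsub>Phi K AA\<^esub> x = (fst x, fst (snd y),
     scmp (fst x) (fst y) (fst (snd y)) (snd (snd y)) (snd (snd x)))"
  "Rst (Phi K AA) x = (fst x, fst x, Unt AA (fst x) \<cdot> Rst K (snd (snd x)))"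
  by (auto simp: Phi_def sec_def scmp_def split: prod.splits)

lemma Phi_Hom: "Hom (Phi K AA) i j = {(i, j, s) |s. sec i j s}"
  by (auto simp: Hom_def Phi_simps)

lemma restriction_category_Phi: "restriction_category (Phi K AA)"
proof
  fix f assume "f \<in> Ar (Phi K AA)"
  then show "Dom (Phi K AA) f \<in> Ob (Phi K AA)" "Cod (Phi K AA) f \<in> Ob (Phi K AA)"
    by (auto simp: Phi_simps dest: secD)
next
  fix a assume "a \<in> Ob (Phi K AA)"
  then show "Ide (Phi K AA) a \<in> Hom (Phi K AA) a a"
    by (auto simp: Phi_simps Phi_Hom intro!: secI)
next
  fix f a b g c assume "f \<in> Hom (Phi K AA) a b" "g \<in> Hom (Phi K AA) b c"
  then show "g \<cdot>\<^bsub>Phi K AA\<^esub> f \<in> Hom (Phi K AA) a c"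
    by (auto simp: Phi_simps Phi_Hom scmp_sec)
next
  fix f a b assume "f \<in> Hom (Phi K AA) a b"
  then show "f \<cdot>\<^bsub>Phi K AA\<^esub> Ide (Phi K AA) a = f"
    by (auto simp: Phi_simps Phi_Hom scmp_Unt_right)
next
  fix f a b assume "f \<in> Hom (Phi K AA) a b"
  then show "Ide (Phi K AA) b \<cdot>\<^bsub>Phi K AA\<^esub> f = f"
    by (auto simp: Phi_simps Phi_Hom scmp_Unt_left)
next
  fix f a b g c h d
  assume "f \<in> Hom (Phi K AA) a b" "g \<in> Hom (Phi K AA) b c" "h \<in> Hom (Phi K AA) c d"
  then show "(h \<cdot>\<^bsub>Phi K AA\<^esub> g) \<cdot>\<^bsub>Phi K AA\<^esub> f = h \<cdot>\<^bsub>Phi K AA\<^esub> g \<cdot>\<^bsub>Phi K AA\<^esub> f"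
    by (auto simp: Phi_simps Phi_Hom scmp_assoc)
next
  fix f a b assume "f \<in> Hom (Phi K AA) a b"
  then show "Rst (Phi K AA) f \<in> Hom (Phi K AA) a a"
    by (auto simp: Phi_simps Phi_Hom intro!: sec_Unt_cmp dest: secD)
next
  fix f a b assume "f \<in> Hom (Phi K AA) a b"
  then show "f \<cdot>\<^bsub>Phi K AA\<^esub> Rst (Phi K AA) f = f"
    by (auto simp: Phi_simps Phi_Hom scmp_Unt_cmp secD(3,4))
next
  fix f a b g c assume "f \<in> Hom (Phi K AA) a b" "g \<in> Hom (Phi K AA) a c"
  then show "Rst (Phi K AA) f \<cdot>\<^bsub>Phi K AA\<^esub> Rst (Phi K AA) g =
      Rst (Phi K AA) g \<cdot>\<^bsub>Phi K AA\<^esub> Rst (Phi K AA) f"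
    by (auto simp: Phi_simps Phi_Hom scmp_Unt_cmp sec_Unt_cmp secD rst_swap)
next
  fix f a b g c assume "f \<in> Hom (Phi K AA) a b" "g \<in> Hom (Phi K AA) a c"
  then show "Rst (Phi K AA) (g \<cdot>\<^bsub>Phi K AA\<^esub> Rst (Phi K AA) f) =
      Rst (Phi K AA) g \<cdot>\<^bsub>Phi K AA\<^esub> Rst (Phi K AA) f"
    by (auto simp: Phi_simps Phi_Hom scmp_Unt_cmp sec_Unt_cmp secD)
next
  fix f a b g c assume "f \<in> Hom (Phi K AA) a b" "g \<in> Hom (Phi K AA) b c"
  then show "Rst (Phi K AA) g \<cdot>\<^bsub>Phi K AA\<^esub> f =
      f \<cdot>\<^bsub>Phi K AA\<^esub> Rst (Phi K AA) (g \<cdot>\<^bsub>Phi K AA\<^esub> f)"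
    by (auto simp: Phi_simps Phi_Hom scmp_Unt_rst_left scmp_Unt_cmp secD)
qed

lemma Phi_rle_iff:
  assumes s: "sec i j s" and t: "sec i j t"
  shows "rle (Phi K AA) (i, j, s) (i, j, t) \<longleftrightarrow> rle K s t"
  using s t secD[OF s] secD[OF t] by (auto simp: rle_def Phi_simps scmp_Unt_cmp)

end

section \<open>Joins of partial sections\<close>

locale join_partite_category_in = partite_category_in + join_restriction_category K
begin

text \<open>Postcomposition with \<open>Sg\<close> preserves the join, and
  \<open>Sg \<cdot> s = Rst s\<close> on the members, so \<open>Sg \<cdot> g\<close> and
  \<open>Rst g\<close> are joins of the same family.\<close>

lemma sec_is_join:
  assumes ij: "i \<in> Idx AA" "j \<in> Idx AA" and S: "\<And>s. s \<in> S \<Longrightarrow> sec i j s"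
    and g: "is_join K (PO AA i) (PA AA i j) S g"
  shows "sec i j g"
proof (rule secI)
  note G = is_joinD[OF g]
  have "is_join K (PO AA i) (PO AA i) ((\<lambda>f. Sg AA i j \<cdot> f) ` S) (Sg AA i j \<cdot> g)"
    by (rule is_join_postcomp[OF g]) (use ij in simp_all)
  moreover have "(\<lambda>f. Sg AA i j \<cdot> f) ` S = Rst K ` S"
    using S secD(6) by (auto intro!: image_cong)
  ultimately show "Sg AA i j \<cdot> g = Rst K g"
    using is_join_unique is_join_rst[OF g] by simp
qed (use ij is_joinD[OF g] in simp_all)

text \<open>Upper bounds in \<open>Phi\<close> are only those upper bounds in \<open>K\<close> that
  are sections. The forward direction therefore rests on the join taken in \<open>K\<close> being
  itself a section.\<close>

lemma Phi_is_join_iff: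
  assumes ij: "i \<in> Idx AA" "j \<in> Idx AA" and S: "\<And>s. s \<in> S \<Longrightarrow> sec i j s" and g: "sec i j g"
  shows "is_join (Phi K AA) i j ((\<lambda>s. (i, j, s)) ` S) (i, j, g) \<longleftrightarrow>
    is_join K (PO AA i) (PA AA i j) S g"
proof
  interpret Phi: restriction_category "Phi K AA" by (rule restriction_category_Phi)
  note G = secD[OF g]
  assume J: "is_join (Phi K AA) i j ((\<lambda>s. (i, j, s)) ` S) (i, j, g)"
  have le: "rle K s g" if "s \<in> S" for s
    using Phi.is_joinD(5)[OF J, of "(i, j, s)"] that S g Phi_rle_iff by simp
  have "compatible_family K (PO AA i) (PA AA i j) S"
    by (rule bounded_compatible_family[of g]) (use G(1-5) le in \<open>simp_all add: Hom_def\<close>)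
  then obtain h where h: "is_join K (PO AA i) (PA AA i j) S h"
    using ex_join ij by force
  note sh = sec_is_join[OF ij S h]
  have "rle (Phi K AA) (i, j, g) (i, j, h)"
  proof (rule Phi.is_joinD(6)[OF J])
    fix f assume "f \<in> (\<lambda>s. (i, j, s)) ` S"
    then show "rle (Phi K AA) f (i, j, h)"
      using is_joinD(5)[OF h] S sh by (auto simp: Phi_rle_iff)
  qed (use sh in \<open>simp_all add: Phi_simps\<close>)
  then have "rle K g h" using g sh Phi_rle_iff by simp
  moreover have "rle K h g"
    by (rule is_joinD(6)[OF h]) (use G(1-5) le in simp_all)
  ultimately show "is_join K (PO AA i) (PA AA i j) S g"
    using h rle_antisym by blast
next
  interpret Phi: restriction_category "Phi K AA" by (rule restriction_category_Phi)
  assume J: "is_join K (PO AA i) (PA AA i j) S g"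
  show "is_join (Phi K AA) i j ((\<lambda>s. (i, j, s)) ` S) (i, j, g)"
  proof (rule Phi.is_joinI)
    fix f assume "f \<in> (\<lambda>s. (i, j, s)) ` S"
    then show "rle (Phi K AA) f (i, j, g)"
      using is_joinD(5)[OF J] S g by (auto simp: Phi_rle_iff)
  next
    fix h assume h: "h \<in> Ar (Phi K AA)" "Dom (Phi K AA) h = i" "Cod (Phi K AA) h = j"
      and le: "\<And>f. f \<in> (\<lambda>s. (i, j, s)) ` S \<Longrightarrow> rle (Phi K AA) f h"
    obtain h' where h': "h = (i, j, h')" using h by (cases h) (auto simp: Phi_simps)
    have sh: "sec i j h'" using h h' by (simp add: Phi_simps)
    have "rle K g h'"
    proof (rule is_joinD(6)[OF J])
      fix f assume f: "f \<in> S"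
      then have "rle (Phi K AA) (i, j, f) (i, j, h')" using le h' by blast
      then show "rle K f h'" using Phi_rle_iff[OF S[OF f] sh] by simp
    qed (use secD[OF sh] in simp_all)
    then show "rle (Phi K AA) (i, j, g) h" using h' g sh Phi_rle_iff by simp
  qed (use g in \<open>simp_all add: Phi_simps\<close>)
qed

text \<open>As a function of \<open>t\<close> the composite is not a mere precomposition in
  \<open>K\<close>. Its restriction, however, is that of \<open>t \<cdot> Tg \<cdot> s\<close>, so
  the join is detected on restrictions.\<close>

lemma scmp_is_join:
  assumes s: "sec c i s" and ij: "i \<in> Idx AA" "j \<in> Idx AA" and S: "\<And>t. t \<in> S \<Longrightarrow> sec i j t"
    and g: "is_join K (PO AA i) (PA AA i j) S g"
  shows "is_join K (PO AA c) (PA AA c j) ((\<lambda>t. scmp c i j t s) ` S) (scmp c i j g s)"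
proof (rule is_join_of_rst)
  interpret Phi: restriction_category "Phi K AA" by (rule restriction_category_Phi)
  note sg = sec_is_join[OF ij S g] and G = is_joinD[OF g]
  note Ss = secD(1-5)[OF s]
  show "rle K f (scmp c i j g s)" if f: "f \<in> (\<lambda>t. scmp c i j t s) ` S" for f
  proof -
    obtain t where t: "t \<in> S" "f = scmp c i j t s" using f by auto
    have "rle (Phi K AA) (i, j, t) (i, j, g)"
      using t S sg Phi_rle_iff G(5) by simp
    then have "rle (Phi K AA) ((i, j, t) \<cdot>\<^bsub>Phi K AA\<^esub> (c, i, s)) ((i, j, g) \<cdot>\<^bsub>Phi K AA\<^esub> (c, i, s))"
      by (rule Phi.rle_cmp_right) (use s in \<open>simp_all add: Phi_simps\<close>)
    then show ?thesis
      using Phi_rle_iff[OF scmp_sec[OF S[OF t(1)] s] scmp_sec[OF sg s]] t by (simp add: Phi_simps)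
  qed
  have "is_join K (PO AA c) (PA AA i j) ((\<lambda>f. f \<cdot> Tg AA c i \<cdot> s) ` S) (g \<cdot> Tg AA c i \<cdot> s)"
    by (rule is_join_precomp[OF g]) (use Ss in simp_all)
  then have "is_join K (PO AA c) (PO AA c) (Rst K ` (\<lambda>f. f \<cdot> Tg AA c i \<cdot> s) ` S)
      (Rst K (g \<cdot> Tg AA c i \<cdot> s))"
    by (rule is_join_rst)
  moreover have "Rst K ` (\<lambda>f. f \<cdot> Tg AA c i \<cdot> s) ` S = Rst K ` (\<lambda>t. scmp c i j t s) ` S"
    unfolding image_image using scmp_simps(6)[OF S _ Ss(3,5)] Ss(1) by (auto intro!: image_cong)
  ultimately show "is_join K (PO AA c) (PO AA c) (Rst K ` (\<lambda>t. scmp c i j t s) ` S)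
      (Rst K (scmp c i j g s))"
    using scmp_simps(6)[OF sg _ Ss(3,5)] Ss(1) by simp
qed (use scmp_sec[OF sec_is_join[OF ij S g] s] secD in auto)

lemma join_restriction_category_Phi: "join_restriction_category (Phi K AA)"
proof -
  interpret Phi: restriction_category "Phi K AA" by (rule restriction_category_Phi)
  show ?thesis
  proof
    fix i j T assume "i \<in> Ob (Phi K AA)" "j \<in> Ob (Phi K AA)"
      and T: "compatible_family (Phi K AA) i j T"
    then have ij: "i \<in> Idx AA" "j \<in> Idx AA" by (auto simp: Phi_simps)
    define S where "S = (snd \<circ> snd) ` T"
    have T': "T \<subseteq> {(i, j, s) |s. sec i j s}"
      using T by (simp add: compatible_family_def Phi_Hom)
    have TS: "T = (\<lambda>s. (i, j, s)) ` S"
      using T' by (force simp: S_def image_image)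
    have S: "sec i j s" if "s \<in> S" for s using that T' by (auto simp: S_def)
    have "compatible_family K (PO AA i) (PA AA i j) S"
      unfolding compatible_family_def
    proof (intro conjI ballI subsetI)
      fix s assume "s \<in> S"
      then show "s \<in> Hom K (PO AA i) (PA AA i j)" using secD[OF S] by (simp add: Hom_def)
    next
      fix s t assume st: "s \<in> S" "t \<in> S"
      then have "compatible (Phi K AA) (i, j, s) (i, j, t)"
        using T TS by (simp add: compatible_family_def)
      then show "compatible K s t"
        using S[OF st(1)] S[OF st(2)] secD[OF S[OF st(1)]] secD[OF S[OF st(2)]]
        by (simp add: compatible_def Phi_simps scmp_Unt_cmp)
    qed
    then obtain g where g: "is_join K (PO AA i) (PA AA i j) S g"
      using ex_join ij by force
    note sg = sec_is_join[OF ij S g]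
    have "is_join (Phi K AA) i j T (i, j, g)"
      unfolding TS using Phi_is_join_iff[OF ij S sg] g by blast
    moreover have "is_join (Phi K AA) c j ((\<lambda>f. f \<cdot>\<^bsub>Phi K AA\<^esub> h) ` T) ((i, j, g) \<cdot>\<^bsub>Phi K AA\<^esub> h)"
      if c: "c \<in> Ob (Phi K AA)" "h \<in> Hom (Phi K AA) c i" for c h
    proof -
      obtain s where s: "h = (c, i, s)" "sec c i s" using c by (auto simp: Phi_Hom)
      have cI: "c \<in> Idx AA" using c by (simp add: Phi_simps)
      have "is_join (Phi K AA) c j ((\<lambda>t. (c, j, t)) ` (\<lambda>t. scmp c i j t s) ` S)
          (c, j, scmp c i j g s)"
      proof (rule iffD2[OF Phi_is_join_iff[OF cI ij(2)]])
        show "is_join K (PO AA c) (PA AA c j) ((\<lambda>t. scmp c i j t s) ` S) (scmp c i j g s)"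
          by (rule scmp_is_join[OF s(2) ij S g])
        show "sec c j (scmp c i j g s)" by (rule scmp_sec[OF sg s(2)])
        show "sec c j t" if "t \<in> (\<lambda>t. scmp c i j t s) ` S" for t
          using that scmp_sec[OF S s(2)] by auto
      qed
      then show ?thesis by (simp add: TS image_image Phi_simps s)
    qed
    ultimately show "\<exists>g. is_join (Phi K AA) i j T g \<and> (\<forall>c\<in>Ob (Phi K AA). \<forall>h\<in>Hom (Phi K AA) c i.
        is_join (Phi K AA) c j ((\<lambda>f. f \<cdot>\<^bsub>Phi K AA\<^esub> h) ` T) (g \<cdot>\<^bsub>Phi K AA\<^esub> h))"
      by blast
  qed
qed

end

section \<open>Partial maps of locales\<close>

context pointfree_space
begin

lemma meet_below: "x \<in> carrier L \<Longrightarrow> y \<in> carrier L \<Longrightarrow> x \<sqsubseteq> y \<Longrightarrow> x \<sqinter> y = x"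
  by (meson le_antisym le_refl meet_closed meet_le meet_left)

lemma below_meet: "x \<in> carrier L \<Longrightarrow> y \<in> carrier L \<Longrightarrow> x \<sqinter> y = x \<Longrightarrow> x \<sqsubseteq> y"
  using meet_right[of x y] by simp

lemma meet_assoc:
  "x \<in> carrier L \<Longrightarrow> y \<in> carrier L \<Longrightarrow> z \<in> carrier L \<Longrightarrow> (x \<sqinter> y) \<sqinter> z = x \<sqinter> (y \<sqinter> z)"
  using weak_meet_assoc by (simp add: eq_is_equal)

lemma meet_left_comm:
  "x \<in> carrier L \<Longrightarrow> y \<in> carrier L \<Longrightarrow> z \<in> carrier L \<Longrightarrow> x \<sqinter> (y \<sqinter> z) = y \<sqinter> (x \<sqinter> z)"
  using meet_assoc[of x y z] meet_assoc[of y x z] meet_comm[of L x y] by simp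

lemma meet_idem: "x \<in> carrier L \<Longrightarrow> x \<sqinter> x = x"
  by (rule meet_below) simp_all

lemma meet_idem_left: "x \<in> carrier L \<Longrightarrow> y \<in> carrier L \<Longrightarrow> x \<sqinter> (x \<sqinter> y) = x \<sqinter> y"
  using meet_assoc[of x x y] meet_idem by simp

lemma meet_top: "x \<in> carrier L \<Longrightarrow> x \<sqinter> \<top> = x"
  by (rule meet_below) (simp_all add: top_higher)

lemma top_meet_eq: "x \<in> carrier L \<Longrightarrow> \<top> \<sqinter> x = x"
  using meet_top meet_comm[of L x \<top>] by simp

lemma sup_meet_sup_le:
  assumes S: "S \<subseteq> carrier L" and T: "T \<subseteq> carrier L" and z: "z \<in> carrier L"
    and le: "\<And>x y. x \<in> S \<Longrightarrow> y \<in> T \<Longrightarrow> x \<sqinter> y \<sqsubseteq> z"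
  shows "\<Squnion>S \<sqinter> \<Squnion>T \<sqsubseteq> z"
proof -
  have "\<Squnion>S \<sqinter> y \<sqsubseteq> z" if y: "y \<in> T" for y
  proof -
    have yc: "y \<in> carrier L" using y T by blast
    have "\<Squnion>S \<sqinter> y = y \<sqinter> \<Squnion>S" by (rule meet_comm)
    also have "\<dots> = \<Squnion>((\<lambda>x. y \<sqinter> x) ` S)" by (rule meet_distrib[OF yc S])
    also have "\<dots> \<sqsubseteq> z"
      by (rule sup_least) (use le y S yc z in \<open>auto simp: Upper_def meet_comm[of L y]\<close>)
    finally show ?thesis .
  qed
  then show ?thesis
    unfolding meet_distrib[OF sup_closed[OF S] T]
    by (intro sup_least) (use S T z in \<open>auto simp: Upper_def\<close>)
qed

end

text \<open>The partial identity of \<open>L\<close> defined on the open \<open>u\<close>. All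
  restriction idempotents of \<open>Locp\<close> turn out to be of this form.\<close>

definition open_part :: "'u gorder \<Rightarrow> 'u \<Rightarrow> 'u locp_map" where
  "open_part L u = \<lparr>src = L, tgt = L, pull = (\<lambda>a\<in>carrier L. u \<sqinter>\<^bsub>L\<^esub> a)\<rparr>"

text \<open>The top element need not be preserved: its image is the domain of definition of the
  partial map. Extensionality outside the carrier makes equality of maps equality in HOL.\<close>

definition frame_hom :: "'u gorder \<Rightarrow> 'u gorder \<Rightarrow> ('u \<Rightarrow> 'u) \<Rightarrow> bool" where
  "frame_hom M L h \<longleftrightarrow> h \<in> carrier M \<rightarrow>\<^sub>E carrier L \<and>
     (\<forall>a\<in>carrier M. \<forall>b\<in>carrier M. h (a \<sqinter>\<^bsub>M\<^esub> b) = h a \<sqinter>\<^bsub>L\<^esub> h b) \<and>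
     (\<forall>S. S \<subseteq> carrier M \<longrightarrow> h (\<Squnion>\<^bsub>M\<^esub>S) = \<Squnion>\<^bsub>L\<^esub>(h ` S))"

lemma Locp_simps:
  "Ob Locp = {L. pointfree_space L}"
  "f \<in> Ar Locp \<longleftrightarrow> pointfree_space (src f) \<and> pointfree_space (tgt f) \<and>
    frame_hom (tgt f) (src f) (pull f)"
  "Dom Locp = src" "Cod Locp = tgt"
  "Ide Locp L = \<lparr>src = L, tgt = L, pull = (\<lambda>a\<in>carrier L. a)\<rparr>"
  "g \<cdot>\<^bsub>Locp\<^esub> f = \<lparr>src = src f, tgt = tgt g, pull = compose (carrier (tgt g)) (pull f) (pull g)\<rparr>"
  "Rst Locp f = open_part (src f) (pull f \<top>\<^bsub>tgt f\<^esub>)"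
  by (simp_all add: Locp_def frame_hom_def open_part_def)

lemma open_part_simps [simp]:
  "src (open_part L u) = L" "tgt (open_part L u) = L"
  "a \<in> carrier L \<Longrightarrow> pull (open_part L u) a = u \<sqinter>\<^bsub>L\<^esub> a"
  by (simp_all add: open_part_def)

lemma frame_hom_closed: "frame_hom M L h \<Longrightarrow> a \<in> carrier M \<Longrightarrow> h a \<in> carrier L"
  by (auto simp: frame_hom_def)

lemma frame_hom_meet:
  "frame_hom M L h \<Longrightarrow> a \<in> carrier M \<Longrightarrow> b \<in> carrier M \<Longrightarrow> h (a \<sqinter>\<^bsub>M\<^esub> b) = h a \<sqinter>\<^bsub>L\<^esub> h b"
  by (simp add: frame_hom_def)

lemma frame_hom_sup: "frame_hom M L h \<Longrightarrow> S \<subseteq> carrier M \<Longrightarrow> h (\<Squnion>\<^bsub>M\<^esub>S) = \<Squnion>\<^bsub>L\<^esub>(h ` S)"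
  by (simp add: frame_hom_def)

lemma frame_hom_below_top:
  assumes "pointfree_space M" "frame_hom M L h" "a \<in> carrier M"
  shows "h \<top>\<^bsub>M\<^esub> \<sqinter>\<^bsub>L\<^esub> h a = h a"
proof -
  interpret M: pointfree_space M by fact
  show ?thesis using frame_hom_meet[OF assms(2) M.top_closed assms(3)] M.top_meet_eq[OF assms(3)] by simp
qed

lemma frame_hom_compose:
  assumes f: "frame_hom M L f" and g: "frame_hom N M g"
    and M: "pointfree_space M" and N: "pointfree_space N"
  shows "frame_hom N L (compose (carrier N) f g)"
proof -
  interpret M: pointfree_space M by fact
  interpret N: pointfree_space N by fact
  note c = frame_hom_closed[OF f] frame_hom_closed[OF g]
  show ?thesis
    unfolding frame_hom_def
  proof (intro conjI ballI allI impI)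
    show "compose (carrier N) f g \<in> carrier N \<rightarrow>\<^sub>E carrier L"
      using c by (auto simp: compose_def)
  next
    fix a b assume "a \<in> carrier N" "b \<in> carrier N"
    then show "compose (carrier N) f g (a \<sqinter>\<^bsub>N\<^esub> b) =
        compose (carrier N) f g a \<sqinter>\<^bsub>L\<^esub> compose (carrier N) f g b"
      using c frame_hom_meet[OF f] frame_hom_meet[OF g] by (simp add: compose_def)
  next
    fix S assume S: "S \<subseteq> carrier N"
    then have "g ` S \<subseteq> carrier M" using c by auto
    then have "f (g (\<Squnion>\<^bsub>N\<^esub>S)) = \<Squnion>\<^bsub>L\<^esub>(f ` g ` S)"
      using frame_hom_sup[OF f] frame_hom_sup[OF g S] by simp
    moreover have "compose (carrier N) f g ` S = f ` g ` S"
      using S by (auto simp: compose_def image_image intro!: image_cong)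
    ultimately show "compose (carrier N) f g (\<Squnion>\<^bsub>N\<^esub>S) = \<Squnion>\<^bsub>L\<^esub>(compose (carrier N) f g ` S)"
      using S by (simp add: compose_def)
  qed
qed

lemma frame_hom_open_part:
  assumes "pointfree_space L" "u \<in> carrier L"
  shows "frame_hom L L (pull (open_part L u))"
proof -
  interpret L: pointfree_space L by fact
  note u = assms(2)
  show ?thesis
    unfolding frame_hom_def
  proof (intro conjI ballI allI impI)
    show "pull (open_part L u) \<in> carrier L \<rightarrow>\<^sub>E carrier L"
      using u by (auto simp: open_part_def)
  next
    fix a b assume "a \<in> carrier L" "b \<in> carrier L"
    then show "pull (open_part L u) (a \<sqinter>\<^bsub>L\<^esub> b) =
        pull (open_part L u) a \<sqinter>\<^bsub>L\<^esub> pull (open_part L u) b"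
      using u by (simp add: L.meet_assoc L.meet_left_comm[of a u b] L.meet_idem_left)
  next
    fix S assume S: "S \<subseteq> carrier L"
    have "pull (open_part L u) ` S = (\<lambda>b. u \<sqinter>\<^bsub>L\<^esub> b) ` S"
      using S by (auto intro!: image_cong)
    then show "pull (open_part L u) (\<Squnion>\<^bsub>L\<^esub>S) = \<Squnion>\<^bsub>L\<^esub>(pull (open_part L u) ` S)"
      using S L.meet_distrib[OF u S] by simp
  qed
qed

lemma open_part_Ar:
  "pointfree_space L \<Longrightarrow> u \<in> carrier L \<Longrightarrow> open_part L u \<in> Ar Locp"
  by (simp add: Locp_simps frame_hom_open_part)

lemma locp_eqI:
  fixes f g :: "'u locp_map"
  assumes "f \<in> Ar Locp" "g \<in> Ar Locp" "src f = src g" "tgt f = tgt g"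
    "\<And>a. a \<in> carrier (tgt f) \<Longrightarrow> pull f a = pull g a"
  shows "f = g"
proof -
  have "pull f = pull g"
    by (rule extensionalityI[of _ "carrier (tgt f)"])
      (use assms in \<open>auto simp: Locp_simps frame_hom_def PiE_iff\<close>)
  then show ?thesis using assms by simp
qed

lemma Locp_cmp_Ar:
  assumes "f \<in> Ar Locp" "g \<in> Ar Locp" "src g = tgt f"
  shows "g \<cdot>\<^bsub>Locp\<^esub> f \<in> Ar Locp"
  using assms by (auto simp: Locp_simps intro!: frame_hom_compose)

lemma pull_cmp [simp]: "a \<in> carrier (tgt g) \<Longrightarrow> pull (g \<cdot>\<^bsub>Locp\<^esub> f) a = pull f (pull g a)"
  by (simp add: Locp_simps compose_def)

lemma src_tgt_cmp [simp]: "src (g \<cdot>\<^bsub>Locp\<^esub> f) = src f" "tgt (g \<cdot>\<^bsub>Locp\<^esub> f) = tgt g"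
  by (simp_all add: Locp_simps)

lemma pull_closed [simp]:
  "f \<in> Ar Locp \<Longrightarrow> a \<in> carrier (tgt f) \<Longrightarrow> src f = L \<Longrightarrow> pull f a \<in> carrier L"
  by (auto simp: Locp_simps frame_hom_closed)

lemma pull_meet:
  "f \<in> Ar Locp \<Longrightarrow> a \<in> carrier (tgt f) \<Longrightarrow> b \<in> carrier (tgt f) \<Longrightarrow>
    pull f (a \<sqinter>\<^bsub>tgt f\<^esub> b) = pull f a \<sqinter>\<^bsub>src f\<^esub> pull f b"
  by (auto simp: Locp_simps frame_hom_meet)

lemma pull_top_closed [simp]:
  assumes f: "f \<in> Ar Locp" "src f = L" "tgt f = M"
  shows "pull f \<top>\<^bsub>M\<^esub> \<in> carrier L"
proof -
  from f interpret pointfree_space M by (auto simp: Locp_simps)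
  show ?thesis using f by simp
qed

lemma pull_below_top:
  "f \<in> Ar Locp \<Longrightarrow> a \<in> carrier (tgt f) \<Longrightarrow>
    pull f \<top>\<^bsub>tgt f\<^esub> \<sqinter>\<^bsub>src f\<^esub> pull f a = pull f a"
  by (auto simp: Locp_simps frame_hom_below_top)

lemma Rst_Locp: "Rst Locp f = open_part (src f) (pull f \<top>\<^bsub>tgt f\<^esub>)"
  by (simp add: Locp_simps)

lemma Locp_Hom: "f \<in> Hom Locp L M \<longleftrightarrow> f \<in> Ar Locp \<and> src f = L \<and> tgt f = M"
  by (simp add: Hom_def Locp_simps(3,4))

lemma Ar_pointfree: "f \<in> Ar Locp \<Longrightarrow> pointfree_space (src f)" "f \<in> Ar Locp \<Longrightarrow> pointfree_space (tgt f)"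
  by (simp_all add: Locp_simps)

lemma Rst_Locp_Ar: "f \<in> Ar Locp \<Longrightarrow> Rst Locp f \<in> Ar Locp"
  unfolding Rst_Locp by (rule open_part_Ar) (simp_all add: Ar_pointfree)

lemma open_part_cmp:
  assumes "pointfree_space L" "u \<in> carrier L" "v \<in> carrier L"
  shows "open_part L u \<cdot>\<^bsub>Locp\<^esub> open_part L v = open_part L (u \<sqinter>\<^bsub>L\<^esub> v)"
proof (rule locp_eqI)
  interpret pointfree_space L by fact
  show "open_part L u \<cdot>\<^bsub>Locp\<^esub> open_part L v \<in> Ar Locp"
    by (rule Locp_cmp_Ar) (use assms in \<open>simp_all add: open_part_Ar\<close>)
  show "open_part L (u \<sqinter>\<^bsub>L\<^esub> v) \<in> Ar Locp"
    using assms by (simp add: open_part_Ar)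
  show "pull (open_part L u \<cdot>\<^bsub>Locp\<^esub> open_part L v) a = pull (open_part L (u \<sqinter>\<^bsub>L\<^esub> v)) a"
    if "a \<in> carrier (tgt (open_part L u \<cdot>\<^bsub>Locp\<^esub> open_part L v))" for a
    using that assms by (simp add: meet_assoc meet_left_comm[of v u])
qed simp_all

lemma restriction_category_Locp: "restriction_category (Locp :: ('u gorder, 'u locp_map) rcat)"
proof
  fix f :: "'u locp_map" assume "f \<in> Ar Locp"
  then show "Dom Locp f \<in> Ob Locp" "Cod Locp f \<in> Ob Locp" by (simp_all add: Locp_simps)
next
  fix L :: "'u gorder" assume "L \<in> Ob Locp"
  then interpret pointfree_space L by (simp add: Locp_simps)
  have "(\<lambda>a\<in>carrier L. a) ` S = S" if "S \<subseteq> carrier L" for S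
    using that by force
  then show "Ide Locp L \<in> Hom Locp L L"
    using pointfree_space_axioms by (auto simp: Hom_def Locp_simps frame_hom_def)
next
  fix f g :: "'u locp_map" and a b c
  assume "f \<in> Hom Locp a b" "g \<in> Hom Locp b c"
  then show "g \<cdot>\<^bsub>Locp\<^esub> f \<in> Hom Locp a c"
    using Locp_cmp_Ar by (auto simp: Locp_Hom)
next
  fix f :: "'u locp_map" and a b assume f: "f \<in> Hom Locp a b"
  have "compose (carrier b) (\<lambda>x\<in>carrier a. x) (pull f) = pull f"
    by (rule extensionalityI[of _ "carrier b"])
      (use f in \<open>auto simp: compose_def Locp_Hom Locp_simps frame_hom_def PiE_iff\<close>)
  then show "f \<cdot>\<^bsub>Locp\<^esub> Ide Locp a = f"
    using f by (auto simp: Locp_simps(5,6) Locp_Hom)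
next
  fix f :: "'u locp_map" and a b assume f: "f \<in> Hom Locp a b"
  have "compose (carrier b) (pull f) (\<lambda>x\<in>carrier b. x) = pull f"
    by (rule extensionalityI[of _ "carrier b"])
      (use f in \<open>auto simp: compose_def Locp_Hom Locp_simps frame_hom_def PiE_iff\<close>)
  then show "Ide Locp b \<cdot>\<^bsub>Locp\<^esub> f = f"
    using f by (auto simp: Locp_simps(5,6) Locp_Hom)
next
  fix f g h :: "'u locp_map" and a b c d
  assume "f \<in> Hom Locp a b" "g \<in> Hom Locp b c" "h \<in> Hom Locp c d"
  then show "(h \<cdot>\<^bsub>Locp\<^esub> g) \<cdot>\<^bsub>Locp\<^esub> f = h \<cdot>\<^bsub>Locp\<^esub> g \<cdot>\<^bsub>Locp\<^esub> f"
    by (intro locp_eqI) (auto simp: Locp_Hom Locp_cmp_Ar)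
next
  fix f :: "'u locp_map" and a b assume f: "f \<in> Hom Locp a b"
  then show "Rst Locp f \<in> Hom Locp a a"
    using Rst_Locp_Ar[of f] by (simp add: Locp_Hom Rst_Locp)
  show "f \<cdot>\<^bsub>Locp\<^esub> Rst Locp f = f"
  proof (rule locp_eqI)
    show "f \<cdot>\<^bsub>Locp\<^esub> Rst Locp f \<in> Ar Locp"
      by (rule Locp_cmp_Ar) (use f in \<open>simp_all add: Locp_Hom Rst_Locp_Ar\<close>, simp add: Rst_Locp)
  qed (use f in \<open>simp_all add: Locp_Hom Rst_Locp, auto simp: pull_below_top\<close>)
next
  fix f g :: "'u locp_map" and a b c
  assume fg: "f \<in> Hom Locp a b" "g \<in> Hom Locp a c"
  then interpret pointfree_space a by (auto simp: Locp_simps Locp_Hom)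
  define u where "u = pull f \<top>\<^bsub>b\<^esub>"
  define v where "v = pull g \<top>\<^bsub>c\<^esub>"
  have uv: "u \<in> carrier a" "v \<in> carrier a"
    using pull_top_closed[of f] pull_top_closed[of g] fg by (auto simp: u_def v_def Locp_Hom)
  have R: "Rst Locp f = open_part a u" "Rst Locp g = open_part a v"
    using fg by (auto simp: u_def v_def Locp_Hom Rst_Locp)
  have ar: "open_part a u \<in> Ar Locp" "open_part a v \<in> Ar Locp"
    using uv by (auto intro: open_part_Ar pointfree_space_axioms)
  note eq = open_part_cmp[OF pointfree_space_axioms]
  show "Rst Locp f \<cdot>\<^bsub>Locp\<^esub> Rst Locp g = Rst Locp g \<cdot>\<^bsub>Locp\<^esub> Rst Locp f"
    unfolding R using eq uv meet_comm[of a u v] by simp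
  have "Rst Locp (g \<cdot>\<^bsub>Locp\<^esub> open_part a u) = open_part a (u \<sqinter>\<^bsub>a\<^esub> v)"
  proof -
    interpret c: pointfree_space c using fg by (auto simp: Locp_simps Locp_Hom)
    show ?thesis using fg uv by (simp add: Rst_Locp v_def[symmetric] Locp_Hom)
  qed
  then show "Rst Locp (g \<cdot>\<^bsub>Locp\<^esub> Rst Locp f) = Rst Locp g \<cdot>\<^bsub>Locp\<^esub> Rst Locp f"
    unfolding R using eq uv meet_comm[of a u v] by simp
next
  fix f g :: "'u locp_map" and a b c
  assume fg: "f \<in> Hom Locp a b" "g \<in> Hom Locp b c"
  interpret b: pointfree_space b using fg by (auto simp: Locp_simps Locp_Hom)
  interpret c: pointfree_space c using fg by (auto simp: Locp_simps Locp_Hom)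
  have gf: "g \<cdot>\<^bsub>Locp\<^esub> f \<in> Ar Locp" using fg Locp_cmp_Ar by (auto simp: Locp_Hom)
  show "Rst Locp g \<cdot>\<^bsub>Locp\<^esub> f = f \<cdot>\<^bsub>Locp\<^esub> Rst Locp (g \<cdot>\<^bsub>Locp\<^esub> f)"
  proof (rule locp_eqI)
    show "Rst Locp g \<cdot>\<^bsub>Locp\<^esub> f \<in> Ar Locp"
      by (rule Locp_cmp_Ar) (use fg in \<open>simp_all add: Locp_Hom Rst_Locp_Ar\<close>, simp add: Rst_Locp)
    show "f \<cdot>\<^bsub>Locp\<^esub> Rst Locp (g \<cdot>\<^bsub>Locp\<^esub> f) \<in> Ar Locp"
      by (rule Locp_cmp_Ar) (use fg gf in \<open>simp_all add: Locp_Hom Rst_Locp_Ar\<close>, simp add: Rst_Locp)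
    fix x assume "x \<in> carrier (tgt (Rst Locp g \<cdot>\<^bsub>Locp\<^esub> f))"
    then have x: "x \<in> carrier b" using fg by (simp add: Rst_Locp Locp_Hom)
    define v where "v = pull g \<top>\<^bsub>c\<^esub>"
    have v: "v \<in> carrier b"
      using fg pull_top_closed[of g] by (auto simp: v_def Locp_Hom)
    have "pull f (v \<sqinter>\<^bsub>b\<^esub> x) = pull f v \<sqinter>\<^bsub>a\<^esub> pull f x"
      using pull_meet[of f v x] fg v x by (auto simp: Locp_Hom)
    moreover have "pull f x \<in> carrier a" using pull_closed[of f x] fg x by (simp add: Locp_Hom)
    ultimately show "pull (Rst Locp g \<cdot>\<^bsub>Locp\<^esub> f) x = pull (f \<cdot>\<^bsub>Locp\<^esub> Rst Locp (g \<cdot>\<^bsub>Locp\<^esub> f)) x"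
      using fg x by (simp add: Rst_Locp Locp_Hom v_def)
  qed (use fg in \<open>simp_all add: Locp_Hom Rst_Locp\<close>)
qed

interpretation Locp: restriction_category Locp
  by (rule restriction_category_Locp)

lemma pull_cmp_Rst:
  assumes "f \<in> Ar Locp" "g \<in> Ar Locp" "src f = src g" "b \<in> carrier (tgt g)"
  shows "pull (g \<cdot>\<^bsub>Locp\<^esub> Rst Locp f) b = pull f \<top>\<^bsub>tgt f\<^esub> \<sqinter>\<^bsub>src f\<^esub> pull g b"
  using assms pull_closed[of g b] by (simp add: Rst_Locp)

lemma Locp_rle_iff:
  assumes "f \<in> Ar Locp" "g \<in> Ar Locp" "src f = src g" "tgt f = tgt g"
  shows "rle Locp f g \<longleftrightarrow>
    (\<forall>b\<in>carrier (tgt g). pull f b = pull f \<top>\<^bsub>tgt f\<^esub> \<sqinter>\<^bsub>src f\<^esub> pull g b)"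
proof -
  note p = pull_cmp_Rst[OF assms(1-3)]
  have c: "g \<cdot>\<^bsub>Locp\<^esub> Rst Locp f \<in> Ar Locp"
    by (rule Locp_cmp_Ar) (use assms in \<open>simp_all add: Rst_Locp_Ar\<close>, simp add: Rst_Locp)
  show ?thesis
  proof
    assume "rle Locp f g"
    then have "g \<cdot>\<^bsub>Locp\<^esub> Rst Locp f = f" by (rule Locp.rleD)
    then show "\<forall>b\<in>carrier (tgt g). pull f b = pull f \<top>\<^bsub>tgt f\<^esub> \<sqinter>\<^bsub>src f\<^esub> pull g b"
      using p by metis
  next
    assume *: "\<forall>b\<in>carrier (tgt g). pull f b = pull f \<top>\<^bsub>tgt f\<^esub> \<sqinter>\<^bsub>src f\<^esub> pull g b"
    have "g \<cdot>\<^bsub>Locp\<^esub> Rst Locp f = f"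
    proof (rule locp_eqI[OF c assms(1)])
      fix a assume "a \<in> carrier (tgt (g \<cdot>\<^bsub>Locp\<^esub> Rst Locp f))"
      then have "a \<in> carrier (tgt g)" by simp
      then show "pull (g \<cdot>\<^bsub>Locp\<^esub> Rst Locp f) a = pull f a"
        using p * by metis
    qed (use assms in \<open>simp_all add: Rst_Locp\<close>)
    then show "rle Locp f g"
      by (intro Locp.rleI) (use assms in \<open>simp_all add: Locp_simps(3,4)\<close>)
  qed
qed

lemma Locp_compatibleD:
  assumes "compatible Locp f g" "b \<in> carrier (tgt f)"
  shows "pull g \<top>\<^bsub>tgt f\<^esub> \<sqinter>\<^bsub>src f\<^esub> pull f b = pull f \<top>\<^bsub>tgt f\<^esub> \<sqinter>\<^bsub>src f\<^esub> pull g b"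
proof -
  have c: "f \<in> Ar Locp" "g \<in> Ar Locp" "src f = src g" "tgt f = tgt g"
      "f \<cdot>\<^bsub>Locp\<^esub> Rst Locp g = g \<cdot>\<^bsub>Locp\<^esub> Rst Locp f"
    using assms(1) by (auto simp: compatible_def Locp_simps(3,4))
  show ?thesis
    using pull_cmp_Rst[of f g b] pull_cmp_Rst[of g f b] c assms(2) by auto
qed

section \<open>Joins of partial maps of locales\<close>

definition join_map :: "'u gorder \<Rightarrow> 'u gorder \<Rightarrow> 'u locp_map set \<Rightarrow> 'u locp_map" where
  "join_map L M S =
    \<lparr>src = L, tgt = M, pull = (\<lambda>b\<in>carrier M. \<Squnion>\<^bsub>L\<^esub>((\<lambda>f. pull f b) ` S))\<rparr>"

text \<open>Joins are computed pointwise on inverse images. Suprema commute with suprema, while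
  preservation of binary meets needs compatibility; that the result bounds the family and is least
  uses distributivity in \<open>L\<close>.\<close>

lemma join_map_is_join:
  assumes L: "pointfree_space L" and M: "pointfree_space M" and S: "compatible_family Locp L M S"
  shows "is_join Locp L M S (join_map L M S)"
proof -
  interpret L: pointfree_space L by fact
  interpret M: pointfree_space M by fact
  have SH: "f \<in> Ar Locp" "src f = L" "tgt f = M" if "f \<in> S" for f
    using S that unfolding compatible_family_def Locp_Hom subset_iff by blast+
  have SC: "pull g \<top>\<^bsub>M\<^esub> \<sqinter>\<^bsub>L\<^esub> pull f b = pull f \<top>\<^bsub>M\<^esub> \<sqinter>\<^bsub>L\<^esub> pull g b"
    if "f \<in> S" "g \<in> S" "b \<in> carrier M" for f g b
    using S Locp_compatibleD[of f g b] SH that by (auto simp: compatible_family_def)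
  have cl: "pull f b \<in> carrier L" if "f \<in> S" "b \<in> carrier M" for f b
    using that SH[of f] pull_closed[of f b] by simp
  have cl': "(\<lambda>f. pull f b) ` S \<subseteq> carrier L" if "b \<in> carrier M" for b
    using that cl by auto
  have bt: "pull f \<top>\<^bsub>M\<^esub> \<sqinter>\<^bsub>L\<^esub> pull f b = pull f b" if "f \<in> S" "b \<in> carrier M" for f b
    using that SH[of f] pull_below_top[of f b] by simp
  have mt: "pull f (a \<sqinter>\<^bsub>M\<^esub> b) = pull f a \<sqinter>\<^bsub>L\<^esub> pull f b"
    if "f \<in> S" "a \<in> carrier M" "b \<in> carrier M" for f a b
    using that SH[of f] pull_meet[of f a b] by simp
  define h where "h = (\<lambda>b\<in>carrier M. \<Squnion>\<^bsub>L\<^esub>((\<lambda>f. pull f b) ` S))"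
  have hb: "h b = \<Squnion>\<^bsub>L\<^esub>((\<lambda>f. pull f b) ` S)" if "b \<in> carrier M" for b
    using that by (simp add: h_def)
  have hc: "h b \<in> carrier L" if "b \<in> carrier M" for b
    using that cl' by (simp add: hb)
  have up: "pull f b \<sqsubseteq>\<^bsub>L\<^esub> h b" if "f \<in> S" "b \<in> carrier M" for f b
    unfolding hb[OF that(2)] by (rule L.sup_upper) (use that cl' in auto)
  have lst: "h b \<sqsubseteq>\<^bsub>L\<^esub> z" if "b \<in> carrier M" "z \<in> carrier L" "\<And>f. f \<in> S \<Longrightarrow> pull f b \<sqsubseteq>\<^bsub>L\<^esub> z"
    for b z
    unfolding hb[OF that(1)] by (rule L.sup_least) (use that cl' in \<open>auto simp: Upper_def\<close>)
  \<comment> \<open>Compatibility enters here. Expanding the meet of two pointwise suprema produces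
    mixed terms in \<open>f\<close> and \<open>g\<close>; each is bounded by a term in
    \<open>f\<close> alone, since \<open>f\<close> and \<open>g\<close> agree where both are
    defined.\<close>
  have cross: "pull f a \<sqinter>\<^bsub>L\<^esub> pull g b \<sqsubseteq>\<^bsub>L\<^esub> pull f (a \<sqinter>\<^bsub>M\<^esub> b)"
    if "f \<in> S" "g \<in> S" "a \<in> carrier M" "b \<in> carrier M" for f g a b
  proof -
    note c [simp] = cl[OF that(1,3)] cl[OF that(2,4)] cl[OF that(1,4)]
      cl[OF that(1) M.top_closed] cl[OF that(2) M.top_closed]
    have "pull f a \<sqinter>\<^bsub>L\<^esub> pull g b = (pull f \<top>\<^bsub>M\<^esub> \<sqinter>\<^bsub>L\<^esub> pull f a) \<sqinter>\<^bsub>L\<^esub> pull g b"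
      using bt[OF that(1,3)] by simp
    also have "\<dots> = pull f a \<sqinter>\<^bsub>L\<^esub> (pull f \<top>\<^bsub>M\<^esub> \<sqinter>\<^bsub>L\<^esub> pull g b)"
      by (simp add: L.meet_assoc L.meet_left_comm[of "pull f \<top>\<^bsub>M\<^esub>"])
    also have "pull f \<top>\<^bsub>M\<^esub> \<sqinter>\<^bsub>L\<^esub> pull g b = pull g \<top>\<^bsub>M\<^esub> \<sqinter>\<^bsub>L\<^esub> pull f b"
      using SC[OF that(1,2,4)] by simp
    also have "pull f a \<sqinter>\<^bsub>L\<^esub> (pull g \<top>\<^bsub>M\<^esub> \<sqinter>\<^bsub>L\<^esub> pull f b) =
        pull g \<top>\<^bsub>M\<^esub> \<sqinter>\<^bsub>L\<^esub> (pull f a \<sqinter>\<^bsub>L\<^esub> pull f b)"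
      by (simp add: L.meet_left_comm)
    also have "\<dots> \<sqsubseteq>\<^bsub>L\<^esub> pull f a \<sqinter>\<^bsub>L\<^esub> pull f b"
      by (rule L.meet_right) simp_all
    finally show ?thesis using mt[OF that(1,3,4)] by simp
  qed
  have fh: "frame_hom M L h"
    unfolding frame_hom_def
  proof (intro conjI ballI allI impI)
    show "h \<in> carrier M \<rightarrow>\<^sub>E carrier L" using hc by (auto simp: h_def)
  next
    fix a b assume ab: "a \<in> carrier M" "b \<in> carrier M"
    then have abM: "a \<sqinter>\<^bsub>M\<^esub> b \<in> carrier M" by simp
    show "h (a \<sqinter>\<^bsub>M\<^esub> b) = h a \<sqinter>\<^bsub>L\<^esub> h b"
    proof (rule L.le_antisym)
      show "h (a \<sqinter>\<^bsub>M\<^esub> b) \<sqsubseteq>\<^bsub>L\<^esub> h a \<sqinter>\<^bsub>L\<^esub> h b"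
      proof (rule lst[OF abM])
        fix f assume f: "f \<in> S"
        have "pull f a \<sqinter>\<^bsub>L\<^esub> pull f b \<sqsubseteq>\<^bsub>L\<^esub> pull f a" "pull f a \<sqinter>\<^bsub>L\<^esub> pull f b \<sqsubseteq>\<^bsub>L\<^esub> pull f b"
          using cl f ab by (auto intro: L.meet_left L.meet_right)
        then have "pull f a \<sqinter>\<^bsub>L\<^esub> pull f b \<sqsubseteq>\<^bsub>L\<^esub> h a" "pull f a \<sqinter>\<^bsub>L\<^esub> pull f b \<sqsubseteq>\<^bsub>L\<^esub> h b"
          using L.le_trans[OF _ up[OF f ab(1)]] L.le_trans[OF _ up[OF f ab(2)]] cl[OF f] hc ab by auto
        then show "pull f (a \<sqinter>\<^bsub>M\<^esub> b) \<sqsubseteq>\<^bsub>L\<^esub> h a \<sqinter>\<^bsub>L\<^esub> h b"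
          unfolding mt[OF f ab] by (rule L.meet_le) (use cl[OF f] hc ab in simp_all)
      qed (use hc ab in simp)
      have "pull f a \<sqinter>\<^bsub>L\<^esub> pull g b \<sqsubseteq>\<^bsub>L\<^esub> h (a \<sqinter>\<^bsub>M\<^esub> b)" if "f \<in> S" "g \<in> S" for f g
        by (rule L.le_trans[OF cross[OF that ab] up[OF that(1) abM]]) 
          (use cl that ab hc abM in simp_all)
      then have "\<Squnion>\<^bsub>L\<^esub>((\<lambda>f. pull f a) ` S) \<sqinter>\<^bsub>L\<^esub> \<Squnion>\<^bsub>L\<^esub>((\<lambda>f. pull f b) ` S) \<sqsubseteq>\<^bsub>L\<^esub> h (a \<sqinter>\<^bsub>M\<^esub> b)"
        by (intro L.sup_meet_sup_le) (use cl' ab hc abM in auto)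
      then show "h a \<sqinter>\<^bsub>L\<^esub> h b \<sqsubseteq>\<^bsub>L\<^esub> h (a \<sqinter>\<^bsub>M\<^esub> b)" by (simp add: hb ab)
    qed (use hc ab in simp_all)
  next
    fix T assume T: "T \<subseteq> carrier M"
    have hT: "h ` T \<subseteq> carrier L" using T hc by auto
    have sT: "pull f (\<Squnion>\<^bsub>M\<^esub>T) = \<Squnion>\<^bsub>L\<^esub>(pull f ` T)" if "f \<in> S" for f
      using SH[OF that] frame_hom_sup[of M L "pull f" T] T by (simp add: Locp_simps)
    have fT: "pull f ` T \<subseteq> carrier L" if "f \<in> S" for f using cl[OF that] T by auto
    show "h (\<Squnion>\<^bsub>M\<^esub>T) = \<Squnion>\<^bsub>L\<^esub>(h ` T)"
    proof (rule L.le_antisym)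
      show "h (\<Squnion>\<^bsub>M\<^esub>T) \<sqsubseteq>\<^bsub>L\<^esub> \<Squnion>\<^bsub>L\<^esub>(h ` T)"
      proof (rule lst)
        fix f assume f: "f \<in> S"
        show "pull f (\<Squnion>\<^bsub>M\<^esub>T) \<sqsubseteq>\<^bsub>L\<^esub> \<Squnion>\<^bsub>L\<^esub>(h ` T)"
          unfolding sT[OF f]
        proof (rule L.sup_least)
            fix y assume "y \<in> pull f ` T"
            then obtain t where t: "t \<in> T" "y = pull f t" by auto
            have tM: "t \<in> carrier M" using t T by auto
            have "pull f t \<sqsubseteq>\<^bsub>L\<^esub> h t" by (rule up[OF f tM])
            moreover have "h t \<sqsubseteq>\<^bsub>L\<^esub> \<Squnion>\<^bsub>L\<^esub>(h ` T)" by (rule L.sup_upper) (use hT t in auto)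
            ultimately show "y \<sqsubseteq>\<^bsub>L\<^esub> \<Squnion>\<^bsub>L\<^esub>(h ` T)"
              using t L.le_trans[of "pull f t" "h t"] cl[OF f tM] hc[OF tM] hT by simp
        qed (use hT fT[OF f] in simp_all)
      qed (use T hT in simp_all)
      show "\<Squnion>\<^bsub>L\<^esub>(h ` T) \<sqsubseteq>\<^bsub>L\<^esub> h (\<Squnion>\<^bsub>M\<^esub>T)"
      proof (rule L.sup_least)
          fix y assume "y \<in> h ` T"
          then obtain t where t: "t \<in> T" "y = h t" by auto
          have tM: "t \<in> carrier M" using t T by auto
          show "y \<sqsubseteq>\<^bsub>L\<^esub> h (\<Squnion>\<^bsub>M\<^esub>T)"
            unfolding t(2)
          proof (rule lst[OF tM])
            fix f assume f: "f \<in> S"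
            have "pull f t \<sqsubseteq>\<^bsub>L\<^esub> \<Squnion>\<^bsub>L\<^esub>(pull f ` T)" by (rule L.sup_upper) (use t fT[OF f] in auto)
            then have "pull f t \<sqsubseteq>\<^bsub>L\<^esub> pull f (\<Squnion>\<^bsub>M\<^esub>T)" by (simp add: sT[OF f])
            from L.le_trans[OF this up[OF f]] show "pull f t \<sqsubseteq>\<^bsub>L\<^esub> h (\<Squnion>\<^bsub>M\<^esub>T)"
              using cl[OF f] tM hc T by simp
          qed (use hc T in simp)
      qed (use hc T hT in simp_all)
    qed (use hc T hT in simp_all)
  qed
  have J: "src (join_map L M S) = L" "tgt (join_map L M S) = M" "pull (join_map L M S) = h"
    by (simp_all add: join_map_def h_def)
  have JA: "join_map L M S \<in> Ar Locp"
    using J fh L M by (simp add: Locp_simps)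
  show ?thesis
  proof (rule Locp.is_joinI)
    show "rle Locp f (join_map L M S)" if f: "f \<in> S" for f
    proof (rule iffD2[OF Locp_rle_iff], goal_cases)
      case 5
      have "pull f b = pull f \<top>\<^bsub>M\<^esub> \<sqinter>\<^bsub>L\<^esub> h b" if b: "b \<in> carrier M" for b
      proof (rule L.le_antisym)
        have "pull f b \<sqsubseteq>\<^bsub>L\<^esub> pull f \<top>\<^bsub>M\<^esub>"
          using bt[OF f b] L.meet_left[of "pull f \<top>\<^bsub>M\<^esub>" "pull f b"] cl[OF f] b by simp
        then show "pull f b \<sqsubseteq>\<^bsub>L\<^esub> pull f \<top>\<^bsub>M\<^esub> \<sqinter>\<^bsub>L\<^esub> h b"
          by (rule L.meet_le[OF _ up[OF f b]]) (use cl[OF f] b hc in simp_all)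
        have e: "pull f \<top>\<^bsub>M\<^esub> \<sqinter>\<^bsub>L\<^esub> h b = \<Squnion>\<^bsub>L\<^esub>((\<lambda>x. pull f \<top>\<^bsub>M\<^esub> \<sqinter>\<^bsub>L\<^esub> x) ` (\<lambda>f. pull f b) ` S)"
          unfolding hb[OF b] by (rule L.meet_distrib) (use cl f b in auto)
        show "pull f \<top>\<^bsub>M\<^esub> \<sqinter>\<^bsub>L\<^esub> h b \<sqsubseteq>\<^bsub>L\<^esub> pull f b"
          unfolding e
        proof (rule L.sup_least)
          have "pull f \<top>\<^bsub>M\<^esub> \<sqinter>\<^bsub>L\<^esub> pull g b \<sqsubseteq>\<^bsub>L\<^esub> pull f b" if g: "g \<in> S" for g
            using SC[OF f g b] L.meet_right[of "pull g \<top>\<^bsub>M\<^esub>" "pull f b"] cl[OF f] cl[OF g] b by simp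
          then show "x \<sqsubseteq>\<^bsub>L\<^esub> pull f b"
            if "x \<in> (\<lambda>x. pull f \<top>\<^bsub>M\<^esub> \<sqinter>\<^bsub>L\<^esub> x) ` (\<lambda>f. pull f b) ` S" for x
            using that by auto
        qed (use cl b f in auto)
      qed (use cl[OF f] b hc in simp_all)
      then show ?case unfolding J SH(2,3)[OF f] by blast
    qed (use SH[OF f] JA J in simp_all)
  next
    fix k assume k: "k \<in> Ar Locp" "Dom Locp k = L" "Cod Locp k = M"
      and le: "\<And>f. f \<in> S \<Longrightarrow> rle Locp f k"
    have k': "src k = L" "tgt k = M" using k by (simp_all add: Locp_simps(3,4))
    have kc: "pull k b \<in> carrier L" if "b \<in> carrier M" for b
      using pull_closed[OF k(1)] k' that by simp
    have kf: "pull f b = pull f \<top>\<^bsub>M\<^esub> \<sqinter>\<^bsub>L\<^esub> pull k b" if "f \<in> S" "b \<in> carrier M" for f b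
    proof -
      have "\<forall>b\<in>carrier (tgt k). pull f b = pull f \<top>\<^bsub>tgt f\<^esub> \<sqinter>\<^bsub>src f\<^esub> pull k b"
        by (rule iffD1[OF Locp_rle_iff le[OF that(1)]]) (use SH[OF that(1)] k(1) k' in simp_all)
      then show ?thesis unfolding k' SH(2,3)[OF that(1)] using that(2) by blast
    qed
    have "h b = h \<top>\<^bsub>M\<^esub> \<sqinter>\<^bsub>L\<^esub> pull k b" if b: "b \<in> carrier M" for b
    proof -
      have "h \<top>\<^bsub>M\<^esub> \<sqinter>\<^bsub>L\<^esub> pull k b = pull k b \<sqinter>\<^bsub>L\<^esub> h \<top>\<^bsub>M\<^esub>" by (rule meet_comm)
      also have "\<dots> = \<Squnion>\<^bsub>L\<^esub>((\<lambda>x. pull k b \<sqinter>\<^bsub>L\<^esub> x) ` (\<lambda>f. pull f \<top>\<^bsub>M\<^esub>) ` S)"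
        unfolding hb[OF M.top_closed] by (rule L.meet_distrib) (use kc b cl in auto)
      also have "(\<lambda>x. pull k b \<sqinter>\<^bsub>L\<^esub> x) ` (\<lambda>f. pull f \<top>\<^bsub>M\<^esub>) ` S = (\<lambda>f. pull f b) ` S"
        unfolding image_image using kf[OF _ b] meet_comm[of L "pull k b"] by (auto intro!: image_cong)
      finally show ?thesis by (simp add: hb[OF b])
    qed
    then have *: "\<forall>b\<in>carrier (tgt k). pull (join_map L M S) b =
        pull (join_map L M S) \<top>\<^bsub>tgt (join_map L M S)\<^esub> \<sqinter>\<^bsub>src (join_map L M S)\<^esub> pull k b"
      unfolding J k' by blast
    show "rle Locp (join_map L M S) k"
      by (rule iffD2[OF Locp_rle_iff]) (rule JA k(1) * | simp only: J k')+
  qed (use JA J in \<open>simp_all add: Locp_simps(3,4)\<close>)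
qed

text \<open>The inverse image map of \<open>h\<close> preserves suprema, so precomposition with
  \<open>h\<close> commutes with the pointwise formula for joins.\<close>

lemma join_restriction_category_Locp: "join_restriction_category (Locp :: ('u gorder, 'u locp_map) rcat)"
proof
  fix L M :: "'u gorder" and S
  assume LM: "L \<in> Ob Locp" "M \<in> Ob Locp" and S: "compatible_family Locp L M S"
  have pf: "pointfree_space L" "pointfree_space M" using LM by (simp_all add: Locp_simps)
  have SH: "f \<in> Ar Locp" "src f = L" "tgt f = M" if "f \<in> S" for f
    using S that unfolding compatible_family_def Locp_Hom subset_iff by blast+
  note J = join_map_is_join[OF pf S]
  have "is_join Locp c M ((\<lambda>f. f \<cdot>\<^bsub>Locp\<^esub> h) ` S) (join_map L M S \<cdot>\<^bsub>Locp\<^esub> h)"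
    if h: "h \<in> Hom Locp c L" and c: "c \<in> Ob Locp" for c and h :: "'u locp_map"
  proof -
    have h': "h \<in> Ar Locp" "src h = c" "tgt h = L" using h by (simp_all add: Locp_Hom)
    have pc: "pointfree_space c" using c by (simp add: Locp_simps)
    have JA: "join_map L M S \<in> Ar Locp" using Locp.is_joinD(2)[OF J] .
    have "compatible_family Locp c M ((\<lambda>f. f \<cdot>\<^bsub>Locp\<^esub> h) ` S)"
    proof (rule Locp.bounded_compatible_family)
      show "join_map L M S \<cdot>\<^bsub>Locp\<^esub> h \<in> Hom Locp c M"
        using Locp_cmp_Ar[OF h'(1) JA] h' by (simp add: Locp_Hom join_map_def)
      show "rle Locp x (join_map L M S \<cdot>\<^bsub>Locp\<^esub> h)" if "x \<in> (\<lambda>f. f \<cdot>\<^bsub>Locp\<^esub> h) ` S" for x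
        using that Locp.rle_cmp_right[OF Locp.is_joinD(5)[OF J]] h' SH by (auto simp: Locp_simps(3,4))
    qed
    note K = join_map_is_join[OF pc pf(2) this]
    have "join_map L M S \<cdot>\<^bsub>Locp\<^esub> h = join_map c M ((\<lambda>f. f \<cdot>\<^bsub>Locp\<^esub> h) ` S)"
    proof (rule locp_eqI)
      fix b assume "b \<in> carrier (tgt (join_map L M S \<cdot>\<^bsub>Locp\<^esub> h))"
      then have b: "b \<in> carrier M" by (simp add: join_map_def)
      have "(\<lambda>f. pull f b) ` S \<subseteq> carrier L"
        using SH b by auto
      then have "pull h (\<Squnion>\<^bsub>L\<^esub>((\<lambda>f. pull f b) ` S)) = \<Squnion>\<^bsub>c\<^esub>(pull h ` (\<lambda>f. pull f b) ` S)"
        using h' frame_hom_sup[of L c "pull h"] by (simp add: Locp_simps)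
      also have "pull h ` (\<lambda>f. pull f b) ` S = (\<lambda>f. pull f b) ` (\<lambda>f. f \<cdot>\<^bsub>Locp\<^esub> h) ` S"
        unfolding image_image using SH b by (auto intro!: image_cong)
      finally show "pull (join_map L M S \<cdot>\<^bsub>Locp\<^esub> h) b = pull (join_map c M ((\<lambda>f. f \<cdot>\<^bsub>Locp\<^esub> h) ` S)) b"
        using b by (simp add: join_map_def)
    qed (use h' JA Locp.is_joinD(2)[OF K] in \<open>simp_all add: Locp_cmp_Ar\<close>, simp_all add: join_map_def Locp_cmp_Ar)
    then show ?thesis using K by simp
  qed
  then show "\<exists>g. is_join Locp L M S g \<and> (\<forall>c\<in>Ob Locp. \<forall>h\<in>Hom Locp c L.
      is_join Locp c M ((\<lambda>f. f \<cdot>\<^bsub>Locp\<^esub> h) ` S) (g \<cdot>\<^bsub>Locp\<^esub> h))"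
    using J by blast
qed

interpretation Locp: join_restriction_category Locp
  by (rule join_restriction_category_Locp)

section \<open>Restriction idempotents of a locale as its elements\<close>

lemma open_part_ridem:
  "pointfree_space L \<Longrightarrow> u \<in> carrier L \<Longrightarrow> open_part L u \<in> ridem Locp L"
proof (rule Locp.ridemI)
  assume a: "pointfree_space L" "u \<in> carrier L"
  interpret pointfree_space L by (rule a)
  show "Rst Locp (open_part L u) = open_part L u" using a(2) by (simp add: Rst_Locp meet_top)
qed (simp_all add: open_part_Ar Locp_simps(3))

lemma ridem_open_part:
  assumes "e \<in> ridem Locp L"
  obtains u where "pointfree_space L" "u \<in> carrier L" "e = open_part L u"
proof -
  note e = Locp.ridemD[OF assms]
  have "pointfree_space L" using e Ar_pointfree[of e] by (simp add: Locp_simps(3))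
  moreover have "pull e \<top>\<^bsub>tgt e\<^esub> \<in> carrier L" using pull_top_closed[OF e(1)] e by (simp add: Locp_simps(3))
  moreover have "e = open_part L (pull e \<top>\<^bsub>tgt e\<^esub>)" using e Rst_Locp[of e] by (simp add: Locp_simps(3))
  ultimately show thesis by (rule that)
qed

lemma open_part_inject:
  assumes "pointfree_space L" "u \<in> carrier L" "v \<in> carrier L" "open_part L u = open_part L v"
  shows "u = v"
proof -
  interpret pointfree_space L by fact
  show ?thesis
    using arg_cong[OF assms(4), of "\<lambda>f. pull f \<top>\<^bsub>L\<^esub>"] assms(2,3) by (simp add: meet_top)
qed

lemma open_part_rle_iff:
  assumes "pointfree_space L" "u \<in> carrier L" "v \<in> carrier L"
  shows "rle Locp (open_part L u) (open_part L v) \<longleftrightarrow> u \<sqsubseteq>\<^bsub>L\<^esub> v"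
proof -
  interpret pointfree_space L by fact
  have "rle Locp (open_part L u) (open_part L v) \<longleftrightarrow> open_part L (v \<sqinter>\<^bsub>L\<^esub> u) = open_part L u"
    using assms by (simp add: Locp.ridem_rle_iff[OF open_part_ridem open_part_ridem] open_part_cmp)
  also have "\<dots> \<longleftrightarrow> u \<sqinter>\<^bsub>L\<^esub> v = u"
    using open_part_inject[OF assms(1), of "v \<sqinter>\<^bsub>L\<^esub> u" u] assms meet_comm[of L u v] by auto
  finally show ?thesis using meet_below below_meet assms by blast
qed

lemma open_part_sup:
  assumes "pointfree_space L" "U \<subseteq> carrier L"
  shows "is_join Locp L L (open_part L ` U) (open_part L (\<Squnion>\<^bsub>L\<^esub>U))"
proof -
  interpret pointfree_space L by fact
  have c: "compatible_family Locp L L (open_part L ` U)"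
  proof (rule Locp.bounded_compatible_family[of "open_part L (\<Squnion>\<^bsub>L\<^esub>U)"])
    show "open_part L (\<Squnion>\<^bsub>L\<^esub>U) \<in> Hom Locp L L" using assms by (simp add: Locp_Hom open_part_Ar)
    show "rle Locp f (open_part L (\<Squnion>\<^bsub>L\<^esub>U))" if "f \<in> open_part L ` U" for f
      using that assms sup_upper[of U] by (auto simp: open_part_rle_iff subset_iff)
  qed
  have "join_map L L (open_part L ` U) = open_part L (\<Squnion>\<^bsub>L\<^esub>U)"
  proof (rule locp_eqI)
    show "join_map L L (open_part L ` U) \<in> Ar Locp"
      using Locp.is_joinD(2)[OF join_map_is_join[OF assms(1,1) c]] .
    fix a assume "a \<in> carrier (tgt (join_map L L (open_part L ` U)))"
    then have a: "a \<in> carrier L" by (simp add: join_map_def)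
    have "(\<lambda>f. pull f a) ` open_part L ` U = (\<lambda>u. a \<sqinter>\<^bsub>L\<^esub> u) ` U"
      unfolding image_image using a meet_comm[of L a] by simp
    then have "pull (join_map L L (open_part L ` U)) a = \<Squnion>\<^bsub>L\<^esub>((\<lambda>u. a \<sqinter>\<^bsub>L\<^esub> u) ` U)"
      using a by (simp add: join_map_def)
    also have "\<dots> = a \<sqinter>\<^bsub>L\<^esub> \<Squnion>\<^bsub>L\<^esub>U" using meet_distrib[OF a assms(2)] by simp
    finally show "pull (join_map L L (open_part L ` U)) a = pull (open_part L (\<Squnion>\<^bsub>L\<^esub>U)) a"
      using a meet_comm[of L a] by simp
  qed (use assms in \<open>simp_all add: join_map_def open_part_Ar\<close>)
  then show ?thesis using join_map_is_join[OF assms(1,1) c] by simp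
qed

section \<open>Closed ideals\<close>

text \<open>Suprema in the locale of closed ideals are hulls of unions. Since covers need not
  compose, one round of adjoining covered elements need not suffice; the intersection reduces any
  claim about the hull to finding a suitable closed ideal.\<close>

definition ideal_hull ::
  "('o, 'm) rcat \<Rightarrow> ('m \<Rightarrow> 'm set set) \<Rightarrow> 'o \<Rightarrow> 'm set \<Rightarrow> 'm set" where
  "ideal_hull A C i S = \<Inter>{D. closed_ideal A C i D \<and> S \<subseteq> D}"

lemma ideal_gen_eq: "ideal_gen A C i e = ideal_hull A C i {e}"
  by (simp add: ideal_gen_def ideal_hull_def)

context coverage
begin

lemma closed_idealD:
  assumes "closed_ideal A C i D"
  shows "D \<subseteq> ridem A i" "e \<in> D \<Longrightarrow> rle A d e \<Longrightarrow> d \<in> D"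
    "e \<in> ridem A i \<Longrightarrow> X \<in> C e \<Longrightarrow> X \<subseteq> D \<Longrightarrow> e \<in> D"
  using assms rle_ridem unfolding closed_ideal_def by blast+

lemma closed_ideal_ridem: "closed_ideal A C i (ridem A i)"
  unfolding closed_ideal_def by blast

lemma closed_ideal_Inter:
  "F \<noteq> {} \<Longrightarrow> (\<And>D. D \<in> F \<Longrightarrow> closed_ideal A C i D) \<Longrightarrow> closed_ideal A C i (\<Inter>F)"
  unfolding closed_ideal_def by blast

lemma closed_ideal_Int:
  "closed_ideal A C i D \<Longrightarrow> closed_ideal A C i E \<Longrightarrow> closed_ideal A C i (D \<inter> E)"
  using closed_ideal_Inter[of "{D, E}" i] by auto

lemma closed_ideal_hull:
  "S \<subseteq> ridem A i \<Longrightarrow> closed_ideal A C i (ideal_hull A C i S)"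
  unfolding ideal_hull_def by (rule closed_ideal_Inter) (use closed_ideal_ridem in auto)

lemma hull_superset: "S \<subseteq> ideal_hull A C i S"
  unfolding ideal_hull_def by blast

lemma hull_least: "closed_ideal A C i D \<Longrightarrow> S \<subseteq> D \<Longrightarrow> ideal_hull A C i S \<subseteq> D"
  unfolding ideal_hull_def by blast

lemma hull_mono: "S \<subseteq> T \<Longrightarrow> ideal_hull A C i S \<subseteq> ideal_hull A C i T"
  unfolding ideal_hull_def by blast

lemma hull_closed: "closed_ideal A C i D \<Longrightarrow> ideal_hull A C i D = D"
  unfolding ideal_hull_def by blast

lemma hull_UN_gen:
  assumes "S \<subseteq> ridem A i"
  shows "ideal_hull A C i (\<Union>e\<in>S. ideal_gen A C i e) = ideal_hull A C i S"
proof
  show "ideal_hull A C i (\<Union>e\<in>S. ideal_gen A C i e) \<subseteq> ideal_hull A C i S"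
    by (rule hull_least[OF closed_ideal_hull[OF assms]])
      (use hull_mono[of "{_}" S] in \<open>auto simp: ideal_gen_eq\<close>)
  show "ideal_hull A C i S \<subseteq> ideal_hull A C i (\<Union>e\<in>S. ideal_gen A C i e)"
    by (rule hull_mono) (use hull_superset[of "{_}"] in \<open>auto simp: ideal_gen_eq\<close>)
qed

text \<open>The Heyting implication from \<open>T\<close> to \<open>G\<close>. Closure under covers
  is where stability enters: a cover of \<open>e\<close>, precomposed with \<open>d\<close>,
  generates a cover of \<open>e \<cdot> d\<close>.\<close>

lemma closed_ideal_quotient:
  assumes G: "closed_ideal A C i G" and T: "T \<subseteq> ridem A i"
  shows "closed_ideal A C i {x \<in> ridem A i. \<forall>d\<in>T. x \<cdot> d \<in> G}"
  unfolding closed_ideal_def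
proof (intro conjI ballI impI)
  fix e d assume e: "e \<in> {x \<in> ridem A i. \<forall>d\<in>T. x \<cdot> d \<in> G}" and d: "d \<in> ridem A i" "rle A d e"
  have "d \<cdot> t \<in> G" if t: "t \<in> T" for t
  proof (rule closed_idealD(2)[OF G])
    show "rle A (d \<cdot> t) (e \<cdot> t)"
      by (rule rle_cmp_right[OF d(2)]) (use ridemD[of t i] ridemD[OF d(1)] t T in auto)
  qed (use e t in auto)
  then show "d \<in> {x \<in> ridem A i. \<forall>d\<in>T. x \<cdot> d \<in> G}" using d by blast
next
  fix e X
  assume e: "e \<in> ridem A i" and X: "X \<in> C e" "X \<subseteq> {x \<in> ridem A i. \<forall>d\<in>T. x \<cdot> d \<in> G}"
  have "e \<cdot> d \<in> G" if d: "d \<in> T" for d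
  proof (rule closed_idealD(3)[OF G])
    have di: "d \<in> ridem A i" using d T by blast
    show "e \<cdot> d \<in> ridem A i" by (rule ridem_cmp[OF e di])
    show "down A ((\<lambda>x. x \<cdot> d) ` X) \<in> C (e \<cdot> d)"
      by (rule cover_precomp[OF _ _ X(1)]) (use e di in \<open>auto simp: ridem_def\<close>)
    show "down A ((\<lambda>x. x \<cdot> d) ` X) \<subseteq> G"
      using closed_idealD(2)[OF G] X(2) d by (auto simp: down_def)
  qed
  then show "e \<in> {x \<in> ridem A i. \<forall>d\<in>T. x \<cdot> d \<in> G}" using e by blast
qed blast

text \<open>The condition on generators extends to the hulls one factor at a time, by
  \<open>closed_ideal_quotient\<close> for \<open>T\<close> and then for the hull of
  \<open>S\<close>; idempotents commute, so the factors can be exchanged in between.\<close>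

lemma hull_cmp:
  assumes S: "S \<subseteq> ridem A i" and T: "T \<subseteq> ridem A i" and G: "closed_ideal A C i G"
    and ST: "\<And>x y. x \<in> S \<Longrightarrow> y \<in> T \<Longrightarrow> x \<cdot> y \<in> G"
    and x: "x \<in> ideal_hull A C i S" and y: "y \<in> ideal_hull A C i T"
  shows "x \<cdot> y \<in> G"
proof -
  define S' where "S' = ideal_hull A C i S"
  have S': "closed_ideal A C i S'" unfolding S'_def by (rule closed_ideal_hull[OF S])
  have sub: "S' \<subseteq> {x \<in> ridem A i. \<forall>y\<in>T. x \<cdot> y \<in> G}"
    unfolding S'_def by (rule hull_least[OF closed_ideal_quotient[OF G T]]) (use S ST in auto)
  have "y \<cdot> x \<in> G" if "x \<in> S'" "y \<in> T" for x y
  proof -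
    have "x \<in> ridem A i" "y \<in> ridem A i" "x \<cdot> y \<in> G"
      using that sub T by blast+
    then show ?thesis by (metis ridem_swap)
  qed
  then have "ideal_hull A C i T \<subseteq> {y \<in> ridem A i. \<forall>x\<in>S'. y \<cdot> x \<in> G}"
    by (intro hull_least[OF closed_ideal_quotient[OF G closed_idealD(1)[OF S']]]) (use T in auto)
  then have "y \<cdot> x \<in> G" "y \<in> ridem A i" using x y by (auto simp: S'_def)
  moreover have "x \<in> ridem A i" using x closed_idealD(1)[OF S'] by (auto simp: S'_def)
  ultimately show ?thesis using ridem_swap by metis
qed

text \<open>A common element \<open>x\<close> equals \<open>x \<cdot> x\<close>, to which
  \<open>hull_cmp\<close> applies with one factor taken from each ideal.\<close>

lemma ideal_gen_Int:
  assumes d: "d \<in> ridem A i" and e: "e \<in> ridem A i"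
  shows "ideal_gen A C i d \<inter> ideal_gen A C i e = ideal_gen A C i (d \<cdot> e)"
proof
  have cl: "closed_ideal A C i (ideal_gen A C i x)" if "x \<in> ridem A i" for x
    unfolding ideal_gen_eq by (rule closed_ideal_hull) (use that in simp)
  have mem: "x \<in> ideal_gen A C i x" for x
    unfolding ideal_gen_eq using hull_superset by blast
  note de = ridem_cmp[OF d e]
  show "ideal_gen A C i d \<inter> ideal_gen A C i e \<subseteq> ideal_gen A C i (d \<cdot> e)"
  proof
    fix x assume x: "x \<in> ideal_gen A C i d \<inter> ideal_gen A C i e"
    have "x \<cdot> x \<in> ideal_gen A C i (d \<cdot> e)"
      by (rule hull_cmp[of "{d}" i "{e}"]) (use d e x cl[OF de] mem in \<open>auto simp: ideal_gen_eq\<close>)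
    moreover have "x \<in> ridem A i" using x closed_idealD(1)[OF cl[OF d]] by blast
    ultimately show "x \<in> ideal_gen A C i (d \<cdot> e)" by (simp add: ridem_cmp_self)
  qed
  show "ideal_gen A C i (d \<cdot> e) \<subseteq> ideal_gen A C i d \<inter> ideal_gen A C i e"
    unfolding ideal_gen_eq[of A C i "d \<cdot> e"]
    by (rule hull_least[OF closed_ideal_Int[OF cl[OF d] cl[OF e]]])
      (use closed_idealD(2)[OF cl[OF d] mem] closed_idealD(2)[OF cl[OF e] mem]
        ridem_cmp_rle[OF d e] in blast)
qed

end

section \<open>The locales of closed ideals\<close>

locale coverage_embedding = coverage A C for A :: "('o, 'm) rcat" (structure) and C +
  fixes emb :: "'m set \<Rightarrow> 'u"
  assumes inj_emb: "inj emb"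
begin

abbreviation L where "L i \<equiv> OC_obj emb A C i"

text \<open>The element \<eta>(e), placed in the universe. These elements generate
  \<open>L i\<close> under suprema.\<close>

abbreviation pt where "pt i e \<equiv> emb (ideal_gen A C i e)"

lemma emb_eq_iff [simp]: "emb D = emb E \<longleftrightarrow> D = E"
  using inj_emb by (simp add: inj_eq)

lemma OC_obj_simps:
  "carrier (L i) = emb ` {D. closed_ideal A C i D}"
  "x .=\<^bsub>L i\<^esub> y \<longleftrightarrow> x = y"
  "emb D \<sqsubseteq>\<^bsub>L i\<^esub> emb E \<longleftrightarrow> D \<subseteq> E"
  using inj_emb by (auto simp: OC_obj_def inj_eq)

lemma OC_obj_subset_carrier:
  assumes "U \<subseteq> carrier (L i)"
  obtains F where "U = emb ` F" "\<And>D. D \<in> F \<Longrightarrow> closed_ideal A C i D"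
  using assms unfolding OC_obj_simps(1) subset_image_iff by blast

lemma OC_obj_is_lub:
  assumes F: "\<And>D. D \<in> F \<Longrightarrow> closed_ideal A C i D"
  shows "least (L i) (emb (ideal_hull A C i (\<Union>F))) (Upper (L i) (emb ` F))"
proof -
  have U: "\<Union>F \<subseteq> ridem A i" using F closed_idealD(1) by blast
  show ?thesis
    unfolding least_def
  proof (intro conjI ballI)
    show "emb (ideal_hull A C i (\<Union>F)) \<in> Upper (L i) (emb ` F)"
      using closed_ideal_hull[OF U] hull_superset[of "\<Union>F" i]
      by (auto simp: Upper_def OC_obj_simps Sup_le_iff)
    fix x assume x: "x \<in> Upper (L i) (emb ` F)"
    then obtain D where D: "x = emb D" "closed_ideal A C i D"
      by (auto simp: Upper_def OC_obj_simps)
    have "E \<subseteq> D" if "E \<in> F" for E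
    proof -
      have "emb E \<sqsubseteq>\<^bsub>L i\<^esub> x"
        using x that F[OF that] by (simp add: Upper_def OC_obj_simps)
      then show ?thesis by (simp add: D OC_obj_simps)
    qed
    with D show "emb (ideal_hull A C i (\<Union>F)) \<sqsubseteq>\<^bsub>L i\<^esub> x"
      using hull_least[OF D(2), of "\<Union>F"] by (auto simp: OC_obj_simps)
  qed (auto simp: Upper_def)
qed

text \<open>Inserting \<open>ridem A i\<close>, the greatest closed ideal, gives the empty family
  its correct infimum and changes no other intersection.\<close>

lemma OC_obj_is_glb:
  assumes F: "\<And>D. D \<in> F \<Longrightarrow> closed_ideal A C i D"
  shows "greatest (L i) (emb (\<Inter>(insert (ridem A i) F))) (Lower (L i) (emb ` F))"
proof -
  have "closed_ideal A C i (\<Inter>(insert (ridem A i) F))"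
    by (rule closed_ideal_Inter) (use F closed_ideal_ridem in auto)
  note I = this
  show ?thesis
    unfolding greatest_def
  proof (intro conjI ballI)
    show "emb (\<Inter>(insert (ridem A i) F)) \<in> Lower (L i) (emb ` F)"
      using I by (auto simp: Lower_def OC_obj_simps)
    fix x assume x: "x \<in> Lower (L i) (emb ` F)"
    then obtain D where D: "x = emb D" "closed_ideal A C i D"
      by (auto simp: Lower_def OC_obj_simps)
    have "D \<subseteq> E" if "E \<in> F" for E
    proof -
      have "x \<sqsubseteq>\<^bsub>L i\<^esub> emb E"
        using x that F[OF that] by (simp add: Lower_def OC_obj_simps)
      then show ?thesis by (simp add: D OC_obj_simps)
    qed
    with D show "x \<sqsubseteq>\<^bsub>L i\<^esub> emb (\<Inter>(insert (ridem A i) F))"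
      using closed_idealD(1)[OF D(2)] by (auto simp: OC_obj_simps)
  qed (auto simp: Lower_def)
qed

lemma complete_lattice_OC_obj: "complete_lattice (L i)"
proof
  fix U assume U: "U \<subseteq> carrier (L i)"
  obtain F where "U = emb ` F" "\<And>D. D \<in> F \<Longrightarrow> closed_ideal A C i D"
    by (rule OC_obj_subset_carrier[OF U]) blast
  then show "\<exists>s. least (L i) s (Upper (L i) U)" "\<exists>s. greatest (L i) s (Lower (L i) U)"
    using OC_obj_is_lub[of F i] OC_obj_is_glb[of F i] by blast+
qed (auto simp: OC_obj_simps fun_eq_iff)

lemma OC_obj_sup:
  assumes F: "\<And>D. D \<in> F \<Longrightarrow> closed_ideal A C i D"
  shows "\<Squnion>\<^bsub>L i\<^esub>(emb ` F) = emb (ideal_hull A C i (\<Union>F))"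
proof -
  interpret complete_lattice "L i" by (rule complete_lattice_OC_obj)
  have "least (L i) (\<Squnion>\<^bsub>L i\<^esub>(emb ` F)) (Upper (L i) (emb ` F))"
    by (rule supI) (use F in \<open>auto simp: OC_obj_simps\<close>)
  from weak_least_unique[OF this OC_obj_is_lub[OF F]] show ?thesis by (simp add: eq_is_equal)
qed

lemma OC_obj_meet:
  assumes D: "closed_ideal A C i D" and E: "closed_ideal A C i E"
  shows "emb D \<sqinter>\<^bsub>L i\<^esub> emb E = emb (D \<inter> E)"
proof -
  interpret complete_lattice "L i" by (rule complete_lattice_OC_obj)
  have "greatest (L i) (emb D \<sqinter>\<^bsub>L i\<^esub> emb E) (Lower (L i) {emb D, emb E})"
    by (rule meetI) (use D E in \<open>auto simp: OC_obj_simps\<close>)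
  moreover have "greatest (L i) (emb (\<Inter>(insert (ridem A i) {D, E}))) (Lower (L i) (emb ` {D, E}))"
    by (rule OC_obj_is_glb) (use D E in auto)
  moreover have "\<Inter>(insert (ridem A i) {D, E}) = D \<inter> E"
    using closed_idealD(1)[OF D] by auto
  ultimately show ?thesis
    using weak_greatest_unique[of "emb D \<sqinter>\<^bsub>L i\<^esub> emb E"] by (simp add: eq_is_equal)
qed

text \<open>Distributivity is \<open>hull_cmp\<close> for \<open>D\<close> and the union of
  \<open>F\<close>: an element of the meet is its own square, and a product of generators lies in
  some \<open>D \<inter> E\<close>.\<close>

lemma pointfree_space_OC_obj: "pointfree_space (L i)"
proof -
  interpret complete_lattice "L i" by (rule complete_lattice_OC_obj)
  show ?thesis
  proof
    fix a S assume a: "a \<in> carrier (L i)" and S: "S \<subseteq> carrier (L i)"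
    obtain D where D: "a = emb D" "closed_ideal A C i D"
      using a by (auto simp: OC_obj_simps)
    obtain F where F: "S = emb ` F" "\<And>E. E \<in> F \<Longrightarrow> closed_ideal A C i E"
      by (rule OC_obj_subset_carrier[OF S]) blast
    note U = F(2)[THEN closed_idealD(1)] and Dr = closed_idealD(1)[OF D(2)]
    have UF: "\<Union>F \<subseteq> ridem A i" "(\<Union>E\<in>F. D \<inter> E) \<subseteq> ridem A i" using U by auto
    have "D \<inter> ideal_hull A C i (\<Union>F) = ideal_hull A C i (\<Union>E\<in>F. D \<inter> E)"
    proof
      show "D \<inter> ideal_hull A C i (\<Union>F) \<subseteq> ideal_hull A C i (\<Union>E\<in>F. D \<inter> E)"
      proof
        fix x assume x: "x \<in> D \<inter> ideal_hull A C i (\<Union>F)"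
        have "x \<cdot> x \<in> ideal_hull A C i (\<Union>E\<in>F. D \<inter> E)"
        proof (rule hull_cmp[OF Dr UF(1) closed_ideal_hull[OF UF(2)]])
          fix y z assume y: "y \<in> D" and "z \<in> \<Union>F"
          then obtain E where E: "z \<in> E" "E \<in> F" by blast
          have "rle A (y \<cdot> z) y" "rle A (y \<cdot> z) z"
            using ridem_cmp_rle[of y i z] y E Dr U by auto
          then have "y \<cdot> z \<in> D \<inter> E"
            using closed_idealD(2)[OF D(2) y] closed_idealD(2)[OF F(2)[OF E(2)] E(1)] by blast
          then show "y \<cdot> z \<in> ideal_hull A C i (\<Union>E\<in>F. D \<inter> E)"
            using hull_superset[of "\<Union>E\<in>F. D \<inter> E" i] E(2) by blast
        qed (use x hull_superset[of D i] in auto)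
        then show "x \<in> ideal_hull A C i (\<Union>E\<in>F. D \<inter> E)"
          using x Dr by (auto simp: ridem_cmp_self subset_iff)
      qed
      show "ideal_hull A C i (\<Union>E\<in>F. D \<inter> E) \<subseteq> D \<inter> ideal_hull A C i (\<Union>F)"
        by (rule hull_least[OF closed_ideal_Int[OF D(2) closed_ideal_hull[OF UF(1)]]])
          (use hull_superset[of "\<Union>F" i] in auto)
    qed
    moreover have "(\<lambda>b. a \<sqinter>\<^bsub>L i\<^esub> b) ` S = emb ` ((\<lambda>E. D \<inter> E) ` F)"
      unfolding F(1) D(1) image_image using OC_obj_meet[OF D(2) F(2)] by (auto intro!: image_cong)
    moreover have "\<Squnion>\<^bsub>L i\<^esub>(emb ` ((\<lambda>E. D \<inter> E) ` F)) = emb (ideal_hull A C i (\<Union>((\<lambda>E. D \<inter> E) ` F)))"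
      by (rule OC_obj_sup) (use closed_ideal_Int[OF D(2)] F(2) in auto)
    ultimately show "a \<sqinter>\<^bsub>L i\<^esub> \<Squnion>\<^bsub>L i\<^esub>S = \<Squnion>\<^bsub>L i\<^esub>((\<lambda>b. a \<sqinter>\<^bsub>L i\<^esub> b) ` S)"
      using OC_obj_sup[OF F(2)] OC_obj_meet[OF D(2) closed_ideal_hull[OF UF(1)]] F(1) D(1) by simp
  qed
qed

lemma closed_ideal_gen: "e \<in> ridem A i \<Longrightarrow> closed_ideal A C i (ideal_gen A C i e)"
  unfolding ideal_gen_eq by (rule closed_ideal_hull) simp

lemma pt_closed: "e \<in> ridem A i \<Longrightarrow> pt i e \<in> carrier (L i)"
  using closed_ideal_gen by (simp add: OC_obj_simps)

lemma sup_pt: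
  assumes S: "S \<subseteq> ridem A i"
  shows "\<Squnion>\<^bsub>L i\<^esub>(pt i ` S) = emb (ideal_hull A C i S)"
proof -
  have "\<Squnion>\<^bsub>L i\<^esub>(emb ` (ideal_gen A C i ` S)) = emb (ideal_hull A C i (\<Union>(ideal_gen A C i ` S)))"
    by (rule OC_obj_sup) (use closed_ideal_gen S in auto)
  then show ?thesis using hull_UN_gen[OF S] by (simp add: image_image)
qed

lemma hull_carrier: "S \<subseteq> ridem A i \<Longrightarrow> emb (ideal_hull A C i S) \<in> carrier (L i)"
  using closed_ideal_hull by (simp add: OC_obj_simps)

section \<open>\<open>OC\<close> on restriction idempotents\<close>

lemma OC_FO: "i \<in> Ob A \<Longrightarrow> FO (OC emb A C) i = L i"
  by (simp add: OC_def)

text \<open>\<open>OC\<close> is a definite description. The proposed map has the required values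
  because \<eta>(e) and \<eta>(d) meet in the element generated by \<open>e \<cdot> d\<close>, and
  it is the only solution because every closed ideal is a supremum of generators. Extents evaluate
  \<open>OC\<close> at idempotents, which is the case computed here.\<close>

lemma OC_ridem:
  assumes e: "e \<in> ridem A i"
  shows "FM (OC emb A C) e = open_part (L i) (pt i e)"
proof -
  note E = ridemD[OF e]
  let ?Q = "\<lambda>h. h \<in> Hom Locp (L i) (L i) \<and>
    (\<forall>d\<in>ridem A i. pull h (pt i d) = pt i (Rst A (d \<cdot> e)))"
  have "FM (OC emb A C) e = (THE h. ?Q h)"
    using E by (simp add: OC_def)
  also have "\<dots> = open_part (L i) (pt i e)"
  proof (rule the_equality)
    have "pull (open_part (L i) (pt i e)) (pt i d) = pt i (Rst A (d \<cdot> e))" if d: "d \<in> ridem A i" for d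
    proof -
      have "pull (open_part (L i) (pt i e)) (pt i d) = pt i (e \<cdot> d)"
        using pt_closed[OF d] OC_obj_meet[OF closed_ideal_gen[OF e] closed_ideal_gen[OF d]]
          ideal_gen_Int[OF e d] by simp
      then show ?thesis using ridem_swap[OF e d] ridemD(4)[OF ridem_cmp[OF d e]] by simp
    qed
    then show Q: "?Q (open_part (L i) (pt i e))"
      using open_part_Ar[OF pointfree_space_OC_obj pt_closed[OF e]] by (simp add: Locp_Hom)
    fix h assume h: "?Q h"
    then have hA: "h \<in> Ar Locp" "src h = L i" "tgt h = L i" by (auto simp: Locp_Hom)
    note oA = open_part_Ar[OF pointfree_space_OC_obj pt_closed[OF e]]
    have eq: "pull h (pt i d) = pull (open_part (L i) (pt i e)) (pt i d)" if "d \<in> ridem A i" for d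
      using h Q that by metis
    show "h = open_part (L i) (pt i e)"
    proof (rule locp_eqI[OF hA(1) oA])
      fix a assume "a \<in> carrier (tgt h)"
      then obtain D where D: "a = emb D" "closed_ideal A C i D"
        using hA by (auto simp: OC_obj_simps)
      note Dr = closed_idealD(1)[OF D(2)]
      have a: "a = \<Squnion>\<^bsub>L i\<^esub>(pt i ` D)" using sup_pt[OF Dr] hull_closed D by simp
      have pc: "pt i ` D \<subseteq> carrier (L i)" using pt_closed Dr by auto
      have fh: "frame_hom (L i) (L i) (pull h)" using hA by (simp add: Locp_simps)
      have fo: "frame_hom (L i) (L i) (pull (open_part (L i) (pt i e)))"
        by (rule frame_hom_open_part[OF pointfree_space_OC_obj pt_closed[OF e]])
      show "pull h a = pull (open_part (L i) (pt i e)) a"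
        unfolding a frame_hom_sup[OF fh pc] frame_hom_sup[OF fo pc] image_image
        using eq Dr by (metis (no_types, lifting) image_cong subsetD)
    qed (use hA in simp_all)
  qed
  finally show ?thesis .
qed

lemma OC_ridem_cmp:
  assumes "d \<in> ridem A i" "e \<in> ridem A i"
  shows "FM (OC emb A C) (d \<cdot> e) = FM (OC emb A C) d \<cdot>\<^bsub>Locp\<^esub> FM (OC emb A C) e"
  using assms OC_ridem ridem_cmp open_part_cmp[OF pointfree_space_OC_obj pt_closed pt_closed]
    OC_obj_meet[OF closed_ideal_gen closed_ideal_gen] ideal_gen_Int by simp

lemma OC_ridem_ridem:
  "e \<in> ridem A i \<Longrightarrow> FM (OC emb A C) e \<in> ridem Locp (L i)"
  using OC_ridem open_part_ridem[OF pointfree_space_OC_obj pt_closed] by simp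

lemma OC_ridem_join:
  assumes S: "S \<subseteq> ridem A i"
  shows "is_join Locp (L i) (L i) (FM (OC emb A C) ` S) (open_part (L i) (emb (ideal_hull A C i S)))"
proof -
  have "FM (OC emb A C) ` S = open_part (L i) ` pt i ` S"
    unfolding image_image using OC_ridem S by (auto intro!: image_cong)
  moreover have "pt i ` S \<subseteq> carrier (L i)" using pt_closed S by blast
  ultimately show ?thesis
    using open_part_sup[OF pointfree_space_OC_obj, of "pt i ` S" i] sup_pt[OF S] by simp
qed

text \<open>Translates an inequality in \<open>Locp\<close> back into membership of an arrow of
  \<open>A\<close> in a closed ideal.\<close>

lemma OC_ridem_rle_hull_iff:
  assumes S: "S \<subseteq> ridem A i" and k: "k \<in> ridem A i"
  shows "rle Locp (FM (OC emb A C) k) (open_part (L i) (emb (ideal_hull A C i S))) \<longleftrightarrow>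
    k \<in> ideal_hull A C i S"
proof -
  have "rle Locp (FM (OC emb A C) k) (open_part (L i) (emb (ideal_hull A C i S))) \<longleftrightarrow>
      ideal_gen A C i k \<subseteq> ideal_hull A C i S"
    using OC_ridem[OF k] open_part_rle_iff[OF pointfree_space_OC_obj pt_closed[OF k] hull_carrier[OF S]]
    by (simp add: OC_obj_simps)
  then show ?thesis
    using hull_superset[of "{k}" i] hull_least[OF closed_ideal_hull[OF S], of "{k}"]
    by (auto simp: ideal_gen_eq)
qed

lemma ridem_Locp_OC:
  assumes "x \<in> ridem Locp (L i)"
  obtains D where "D \<subseteq> ridem A i" "is_join Locp (L i) (L i) (FM (OC emb A C) ` D) x"
proof -
  obtain u where u: "u \<in> carrier (L i)" "x = open_part (L i) u"
    using ridem_open_part[OF assms] by metis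
  then obtain D where D: "u = emb D" "closed_ideal A C i D" by (auto simp: OC_obj_simps)
  show thesis
    by (rule that[of D]) (use OC_ridem_join[of D i] closed_idealD(1)[OF D(2)] u D hull_closed in auto)
qed

text \<open>The hull of \<open>X\<close> is closed under covers and so contains \<open>e\<close>;
  hence \<open>e\<close> and \<open>X\<close> generate the same closed ideal.\<close>

lemma OC_ridem_cover:
  assumes e: "e \<in> ridem A i" and X: "X \<in> C e"
  shows "is_join Locp (L i) (L i) (FM (OC emb A C) ` X) (FM (OC emb A C) e)"
proof -
  have s: "sieve A e X" using cover_sieve X ridemD(1)[OF e] by blast
  then have Xr: "X \<subseteq> ridem A i" using rle_ridem[OF e] by (auto simp: sieve_def)
  have "ideal_gen A C i e = ideal_hull A C i X"
  proof
    have "e \<in> ideal_hull A C i X"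
      using closed_idealD(3)[OF closed_ideal_hull[OF Xr] e X] hull_superset by blast
    then show "ideal_gen A C i e \<subseteq> ideal_hull A C i X"
      unfolding ideal_gen_eq using hull_least[OF closed_ideal_hull[OF Xr]] by blast
    show "ideal_hull A C i X \<subseteq> ideal_gen A C i e"
      by (rule hull_least[OF closed_ideal_gen[OF e]])
        (use s hull_superset[of "{e}" i] closed_idealD(2)[OF closed_ideal_gen[OF e]]
          in \<open>auto simp: sieve_def ideal_gen_eq\<close>)
  qed
  then show ?thesis using OC_ridem_join[OF Xr] OC_ridem[OF e] by simp
qed

end

section \<open>Extending cover-to-join maps\<close>

text \<open>The index set of the join \<lbrakk>f = g\<rbrakk>, kept as a set of arrows of
  \<open>A\<close> so that it can be compared with closed ideals.\<close>

definition agreement :: "('o, 'm) rcat \<Rightarrow> 'm \<Rightarrow> 'm \<Rightarrow> 'm set" where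
  "agreement A f g =
    {e \<in> ridem A (Dom A f). rle A e (Rst A f \<cdot>\<^bsub>A\<^esub> Rst A g) \<and> f \<cdot>\<^bsub>A\<^esub> e = g \<cdot>\<^bsub>A\<^esub> e}"

text \<open>Isolates what the universal property needs from \<open>Phi\<close> and its unit.
  \<open>dense\<close> determines a join-preserving functor by its values on the image of
  \<open>h\<close>; \<open>conservative\<close> lets inequalities against joins of such values be
  transported to any target. Quantifying over all closed ideals \<open>D\<close> leaves each
  application free to choose the ideal that encodes its goal.\<close>

locale dense_conservative = coverage A C + J: join_restriction_category J
  for A :: "('o, 'm) rcat" (structure) and C and J :: "('o, 'k) rcat" +
  fixes h :: "'m \<Rightarrow> 'k"
  assumes Ob_J: "Ob J = Ob A"
    and h_hom: "f \<in> Hom A a b \<Longrightarrow> h f \<in> Hom J a b"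
    and h_ide: "a \<in> Ob A \<Longrightarrow> h (Ide A a) = Ide J a"
    and h_cmp: "f \<in> Hom A a b \<Longrightarrow> g \<in> Hom A b c \<Longrightarrow> h (g \<cdot> f) = h g \<cdot>\<^bsub>J\<^esub> h f"
    and h_rst: "f \<in> Hom A a b \<Longrightarrow> h (Rst A f) = Rst J (h f)"
    and h_cover: "f \<in> Hom A a b \<Longrightarrow> X \<in> C f \<Longrightarrow> is_join J a b (h ` X) (h f)"
    and dense: "t \<in> Hom J a b \<Longrightarrow> is_join J a b (h ` {g \<in> Hom A a b. rle J (h g) t}) t"
    and conservative: "S \<subseteq> Hom A a b \<Longrightarrow> k \<in> Hom A a b \<Longrightarrow> is_join J a b (h ` S) t \<Longrightarrow>
      rle J (h k) t \<Longrightarrow> closed_ideal A C a D \<Longrightarrow> (\<And>x. x \<in> S \<Longrightarrow> agreement A x k \<subseteq> D) \<Longrightarrow>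
      Rst A k \<in> D"
begin

definition unit_fctr where "unit_fctr = \<lparr>FO = (\<lambda>i\<in>Ob A. i), FM = (\<lambda>f\<in>Ar A. h f)\<rparr>"

lemma cover_to_join_unit: "cover_to_join_map A C J unit_fctr"
proof -
  have hA: "h f \<in> Hom J (Dom A f) (Cod A f)" if "f \<in> Ar A" for f
    using h_hom[of f "Dom A f" "Cod A f"] that by (simp add: Hom_def)
  have XA: "X \<subseteq> Ar A" if "f \<in> Ar A" "X \<in> C f" for f X
    using cover_sieve[OF that] rleD(1) by (auto simp: sieve_def)
  have "restriction_functor A J unit_fctr"
    unfolding restriction_functor_def
    using hA h_ide h_cmp h_rst Ob_J dom_obj cod_obj by (auto simp: unit_fctr_def Hom_def)
  moreover have "is_join J (FO unit_fctr (Dom A f)) (FO unit_fctr (Cod A f)) (FM unit_fctr ` X) (FM unit_fctr f)"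
    if "f \<in> Ar A" "X \<in> C f" for f X
  proof -
    have "FM unit_fctr ` X = h ` X" using XA[OF that] by (auto simp: unit_fctr_def intro!: image_cong)
    then show ?thesis
      using h_cover[of f "Dom A f" "Cod A f" X] that dom_obj cod_obj
      by (simp add: unit_fctr_def Hom_def)
  qed
  ultimately show ?thesis unfolding cover_to_join_map_def by blast
qed

definition below where "below t = {g \<in> Hom A (Dom J t) (Cod J t). rle J (h g) t}"

section \<open>The extension of a cover-to-join map\<close>

context
  fixes B :: "('p, 'n) rcat" and F
  assumes B: "join_restriction_category B" and F: "cover_to_join_map A C B F"
begin

interpretation B: join_restriction_category B by (rule B)

lemma F_simps:
  "a \<in> Ob A \<Longrightarrow> FO F a \<in> Ob B"
  "a \<in> Ob A \<Longrightarrow> FM F (Ide A a) = Ide B (FO F a)"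
  using F unfolding cover_to_join_map_def restriction_functor_def by auto

lemma F_Hom:
  assumes "f \<in> Hom A a b"
  shows "FM F f \<in> Ar B" "Dom B (FM F f) = FO F a" "Cod B (FM F f) = FO F b"
    "FM F (Rst A f) = Rst B (FM F f)"
  using F assms unfolding cover_to_join_map_def restriction_functor_def Hom_def by auto

lemma F_cmp: "f \<in> Hom A a b \<Longrightarrow> g \<in> Hom A b c \<Longrightarrow> FM F (g \<cdot> f) = FM F g \<cdot>\<^bsub>B\<^esub> FM F f"
  using F unfolding cover_to_join_map_def restriction_functor_def Hom_def by auto

lemma F_rle: "f \<in> Hom A a b \<Longrightarrow> rle A g f \<Longrightarrow> rle B (FM F g) (FM F f)"
proof (rule B.rleI)
  assume f: "f \<in> Hom A a b" and gf: "rle A g f"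
  then have g: "g \<in> Hom A a b" using rleD[OF gf] by (auto simp: Hom_def)
  show "FM F f \<cdot>\<^bsub>B\<^esub> Rst B (FM F g) = FM F g"
    using F_cmp[OF rst_hom[OF g] f] F_Hom(4)[OF g] rleD(5)[OF gf] by simp
  show "FM F g \<in> Ar B" "FM F f \<in> Ar B" "Dom B (FM F g) = Dom B (FM F f)"
      "Cod B (FM F g) = Cod B (FM F f)"
    using F_Hom[OF g] F_Hom[OF f] by simp_all
qed

lemma F_cover: "f \<in> Hom A a b \<Longrightarrow> X \<in> C f \<Longrightarrow> is_join B (FO F a) (FO F b) (FM F ` X) (FM F f)"
  using F unfolding cover_to_join_map_def Hom_def by auto

text \<open>The bound \<open>u\<close> is arbitrary and the \<open>FM F x\<close> need not be known
  to have a join, so the lemma can serve to prove their compatibility. At \<open>e = Rst k\<close>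
  the condition defining \<open>D\<close> is the claim itself, because
  \<open>k \<cdot> Rst k = k\<close>.\<close>

lemma F_below_join:
  assumes S: "S \<subseteq> Hom A a b" and k: "k \<in> Hom A a b" and t: "is_join J a b (h ` S) t"
    and kt: "rle J (h k) t"
    and u: "u \<in> Ar B" "Dom B u = FO F a" "Cod B u = FO F b" "\<And>x. x \<in> S \<Longrightarrow> rle B (FM F x) u"
  shows "rle B (FM F k) u"
proof -
  have kA: "k \<in> Ar A" "Dom A k = a" "Cod A k = b" using k by (simp_all add: Hom_def)
  define D where "D = {e \<in> ridem A a. rle B (FM F (k \<cdot> e)) u}"
  have eH: "e \<in> Hom A a a" if "e \<in> ridem A a" for e using that by (simp add: ridem_def)
  have keH: "k \<cdot> e \<in> Hom A a b" if "e \<in> ridem A a" for e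
    using cmp_hom[OF eH[OF that] k] .
  have "closed_ideal A C a D"
    unfolding closed_ideal_def
  proof (intro conjI ballI impI)
    fix e d assume e: "e \<in> D" and d: "d \<in> ridem A a" "rle A d e"
    have "rle A (k \<cdot> d) (k \<cdot> e)"
      by (rule rle_cmp_left[OF d(2)]) (use kA ridemD[OF d(1)] in simp_all)
    from F_rle[OF keH this] have "rle B (FM F (k \<cdot> d)) (FM F (k \<cdot> e))" using e by (simp add: D_def)
    then show "d \<in> D" using B.rle_trans d(1) e unfolding D_def by blast
  next
    fix e X assume e: "e \<in> ridem A a" and X: "X \<in> C e" "X \<subseteq> D"
    \<comment> \<open>\<open>F\<close> turns the cover \<open>X\<close> of \<open>e\<close> into a
      join, and postcomposition with \<open>FM F k\<close> preserves it; this closes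
      \<open>D\<close> under covers.\<close>
    have "is_join B (FO F a) (FO F b) ((\<lambda>x. FM F k \<cdot>\<^bsub>B\<^esub> x) ` FM F ` X) (FM F k \<cdot>\<^bsub>B\<^esub> FM F e)"
      by (rule B.is_join_postcomp[OF F_cover[OF eH[OF e] X(1)]]) (use F_Hom[OF k] in simp_all)
    then have "rle B (FM F k \<cdot>\<^bsub>B\<^esub> FM F e) u"
    proof (rule B.is_joinD(6)[OF _ u(1-3)])
      fix y assume "y \<in> (\<lambda>x. FM F k \<cdot>\<^bsub>B\<^esub> x) ` FM F ` X"
      then obtain x where x: "x \<in> X" "y = FM F k \<cdot>\<^bsub>B\<^esub> FM F x" by blast
      then have "x \<in> ridem A a" "rle B (FM F (k \<cdot> x)) u" using X(2) by (auto simp: D_def)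
      then show "rle B y u" using F_cmp[OF eH k] x(2) by simp
    qed
    then show "e \<in> D" using e F_cmp[OF eH[OF e] k] by (simp add: D_def)
  qed (auto simp: D_def)
  \<comment> \<open>Where \<open>x\<close> and \<open>k\<close> agree, \<open>k \<cdot> e\<close> is
    a restriction of \<open>x\<close>, whose image is below \<open>u\<close>.\<close>
  moreover have "agreement A x k \<subseteq> D" if x: "x \<in> S" for x
  proof
    have xH: "x \<in> Hom A a b" using x S by blast
    then have xA: "x \<in> Ar A" "Dom A x = a" "Cod A x = b" by (simp_all add: Hom_def)
    fix e assume "e \<in> agreement A x k"
    then have e: "e \<in> ridem A a" "x \<cdot> e = k \<cdot> e" using xA by (auto simp: agreement_def)
    have "rle A (x \<cdot> e) x"
      using rle_cmp_rst[of e x] ridemD[OF e(1)] xA by simp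
    from B.rle_trans[OF F_rle[OF xH this] u(4)[OF x]] show "e \<in> D"
      using e by (simp add: D_def)
  qed
  ultimately have "Rst A k \<in> D" by (rule conservative[OF S k t kt])
  then show ?thesis using kA by (simp add: D_def)
qed

text \<open>\<open>join_of\<close> is a definite description, which denotes a join only once the
  family is shown compatible in \<open>extension_join\<close>. Objects need no change since
  \<open>Ob J = Ob A\<close>.\<close>

definition extension where
  "extension = \<lparr>FO = FO F, FM = (\<lambda>t\<in>Ar J.
    join_of B (FO F (Dom J t)) (FO F (Cod J t)) (FM F ` below t))\<rparr>"

lemma below_Hom: "t \<in> Hom J a b \<Longrightarrow> below t = {g \<in> Hom A a b. rle J (h g) t}"
  by (auto simp: below_def Hom_def)

text \<open>\<open>h f\<close> and \<open>h g\<close> share the bound \<open>t\<close> and are thus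
  compatible; in asymmetric form, \<open>h (f \<cdot> Rst g)\<close> is below \<open>h g\<close>.
  \<open>F_below_join\<close> for the one-element family \<open>{g}\<close> carries this inequality
  over to \<open>B\<close>, where it says that \<open>FM F f\<close> and \<open>FM F g\<close> are
  compatible.\<close>

lemma extension_join:
  assumes t: "t \<in> Hom J a b"
  shows "is_join B (FO F a) (FO F b) (FM F ` below t) (FM extension t)"
proof -
  have tJ: "t \<in> Ar J" "Dom J t = a" "Cod J t = b" using t by (simp_all add: Hom_def)
  have ob: "FO F a \<in> Ob B" "FO F b \<in> Ob B"
    using F_simps(1) J.dom_obj[OF tJ(1)] J.cod_obj[OF tJ(1)] tJ Ob_J by auto
  have "compatible_family B (FO F a) (FO F b) (FM F ` below t)"
    unfolding compatible_family_def
  proof (intro conjI ballI subsetI)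
    fix x assume "x \<in> FM F ` below t"
    then show "x \<in> Hom B (FO F a) (FO F b)"
      using F_Hom by (auto simp: below_Hom[OF t] Hom_def[of B])
  next
    fix x y assume "x \<in> FM F ` below t" "y \<in> FM F ` below t"
    then obtain f g where fg: "f \<in> below t" "g \<in> below t" "x = FM F f" "y = FM F g" by blast
    then have H: "f \<in> Hom A a b" "g \<in> Hom A a b" and le: "rle J (h f) t" "rle J (h g) t"
      by (simp_all add: below_Hom[OF t])
    note fH = F_Hom[OF H(1)] and gH = F_Hom[OF H(2)]
    have k: "f \<cdot> Rst A g \<in> Hom A a b" using cmp_hom[OF rst_hom[OF H(2)] H(1)] .
    note hf = h_hom[OF H(1)] and hg = h_hom[OF H(2)]
    have "rle J (h f \<cdot>\<^bsub>J\<^esub> Rst J (h g)) (h g)"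
      by (rule iffD1[OF J.compatible_iff_rle J.rle_compatible[OF le]])
        (use hf hg in \<open>simp_all add: Hom_def\<close>)
    then have "rle J (h (f \<cdot> Rst A g)) (h g)"
      using h_cmp[OF rst_hom[OF H(2)] H(1)] h_rst[OF H(2)] by simp
    then have "rle B (FM F (f \<cdot> Rst A g)) (FM F g)"
      by (rule F_below_join[of "{g}", OF _ k, rotated 2])
        (use J.is_join_singleton[OF hg] H gH in \<open>auto intro: B.rle_refl\<close>)
    then have "rle B (FM F f \<cdot>\<^bsub>B\<^esub> Rst B (FM F g)) (FM F g)"
      using F_cmp[OF rst_hom[OF H(2)] H(1)] gH by simp
    then show "compatible B x y"
      unfolding fg by (subst B.compatible_iff_rle) (use fH gH in simp_all)
  qed
  from B.ex_join[OF ob this] obtain m where m: "is_join B (FO F a) (FO F b) (FM F ` below t) m"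
    by blast
  then have "FM extension t = m"
    using B.join_of_eq[OF m] tJ by (simp add: extension_def)
  then show ?thesis using m by simp
qed

text \<open>Independence of the presentation: any family \<open>S\<close> with join \<open>t\<close>
  may replace \<open>below t\<close>. Functoriality and preservation of joins then amount to
  choosing a convenient family.\<close>

lemma extension_joinI:
  assumes S: "S \<subseteq> Hom A a b" and t: "is_join J a b (h ` S) t"
  shows "is_join B (FO F a) (FO F b) (FM F ` S) (FM extension t)"
proof -
  have tH: "t \<in> Hom J a b" using J.is_joinD[OF t] by (simp add: Hom_def)
  note E = B.is_joinD[OF extension_join[OF tH]]
  show ?thesis
  proof (rule B.is_joinI[OF E(2-4)])
    fix x assume "x \<in> FM F ` S"
    then show "rle B x (FM extension t)"
      using E(5) S J.is_joinD(5)[OF t] by (auto simp: below_Hom[OF tH])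
  next
    fix u assume u: "u \<in> Ar B" "Dom B u = FO F a" "Cod B u = FO F b"
      "\<And>x. x \<in> FM F ` S \<Longrightarrow> rle B x u"
    show "rle B (FM extension t) u"
    proof (rule E(6)[OF u(1-3)])
      fix x assume "x \<in> FM F ` below t"
      then show "rle B x u"
        using F_below_join[OF S _ t _ u(1-3)] u(4) by (auto simp: below_Hom[OF tH])
    qed
  qed
qed

lemma extension_unit: "f \<in> Hom A a b \<Longrightarrow> FM extension (h f) = FM F f"
proof -
  assume f: "f \<in> Hom A a b"
  have "is_join B (FO F a) (FO F b) (FM F ` {f}) (FM extension (h f))"
    by (rule extension_joinI) (use f J.is_join_singleton[OF h_hom[OF f]] in auto)
  moreover have "is_join B (FO F a) (FO F b) {FM F f} (FM F f)"
    by (rule B.is_join_singleton) (use F_Hom[OF f] in \<open>simp add: Hom_def\<close>)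
  ultimately show ?thesis using B.is_join_unique by simp
qed

lemma dense_below: "t \<in> Hom J a b \<Longrightarrow> is_join J a b (h ` below t) t"
  using dense by (simp add: below_Hom)

text \<open>The family of all composites of arrows below \<open>u\<close> and \<open>t\<close>
  presents \<open>u \<cdot> t\<close>, because composition preserves joins in both variables. It
  need not be all of \<open>below\<close> of the composite, which \<open>extension_joinI\<close>
  permits.\<close>

lemma extension_cmp:
  assumes t: "t \<in> Hom J a b" and u: "u \<in> Hom J b c"
  shows "FM extension (u \<cdot>\<^bsub>J\<^esub> t) = FM extension u \<cdot>\<^bsub>B\<^esub> FM extension t"
proof -
  define Q where "Q = (\<lambda>(k, g). k \<cdot> g) ` (below u \<times> below t)"
  have Q: "Q \<subseteq> Hom A a c"
    using cmp_hom by (auto simp: Q_def below_Hom[OF t] below_Hom[OF u])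
  have "h ` Q = (\<lambda>(y, x). y \<cdot>\<^bsub>J\<^esub> x) ` (h ` below u \<times> h ` below t)"
    unfolding Q_def image_image using h_cmp
    by (force simp: below_Hom[OF t] below_Hom[OF u] image_iff)
  then have "is_join J a c (h ` Q) (u \<cdot>\<^bsub>J\<^esub> t)"
    using J.is_join_cmp[OF dense_below[OF t] dense_below[OF u]] by simp
  then have "is_join B (FO F a) (FO F c) (FM F ` Q) (FM extension (u \<cdot>\<^bsub>J\<^esub> t))"
    by (rule extension_joinI[OF Q])
  moreover have "FM F ` Q = (\<lambda>(y, x). y \<cdot>\<^bsub>B\<^esub> x) ` (FM F ` below u \<times> FM F ` below t)"
    unfolding Q_def image_image using F_cmp
    by (force simp: below_Hom[OF t] below_Hom[OF u] image_iff)
  ultimately show ?thesis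
    using B.is_join_unique B.is_join_cmp[OF extension_join[OF t] extension_join[OF u]] by metis
qed

lemma extension_rst:
  assumes t: "t \<in> Hom J a b"
  shows "FM extension (Rst J t) = Rst B (FM extension t)"
proof -
  have R: "Rst A ` below t \<subseteq> Hom A a a"
    using rst_hom by (auto simp: below_Hom[OF t])
  have "h ` Rst A ` below t = Rst J ` h ` below t"
    unfolding image_image using h_rst by (auto simp: below_Hom[OF t] intro!: image_cong)
  then have "is_join J a a (h ` Rst A ` below t) (Rst J t)"
    using J.is_join_rst[OF dense_below[OF t]] by simp
  then have "is_join B (FO F a) (FO F a) (FM F ` Rst A ` below t) (FM extension (Rst J t))"
    by (rule extension_joinI[OF R])
  moreover have "FM F ` Rst A ` below t = Rst B ` FM F ` below t"
    unfolding image_image using F_Hom(4) by (auto simp: below_Hom[OF t] intro!: image_cong)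
  ultimately show ?thesis
    using B.is_join_unique B.is_join_rst[OF extension_join[OF t]] by metis
qed

text \<open>The union of the families \<open>below t\<close> presents \<open>g\<close>; regrouping
  it in \<open>B\<close> gives the join of the extended maps.\<close>

lemma extension_preserves_join:
  assumes S: "is_join J a b S g"
  shows "is_join B (FO F a) (FO F b) (FM extension ` S) (FM extension g)"
proof -
  have SH: "t \<in> Hom J a b" if "t \<in> S" for t using J.is_joinD(1)[OF S] that by blast
  have U: "(\<Union>t\<in>S. below t) \<subseteq> Hom A a b" using below_Hom[OF SH] by auto
  have "is_join J a b (\<Union>t\<in>S. h ` below t) g"
    by (rule iffD2[OF J.is_join_UN[where m = "\<lambda>t. t"]]) (use dense_below[OF SH] S in simp_all)
  then have "is_join J a b (h ` (\<Union>t\<in>S. below t)) g" by (simp add: image_UN)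
  from extension_joinI[OF U this]
  have "is_join B (FO F a) (FO F b) (\<Union>t\<in>S. FM F ` below t) (FM extension g)"
    by (simp add: image_UN)
  then show ?thesis
    by (rule iffD1[OF B.is_join_UN, rotated]) (rule extension_join[OF SH])
qed

lemma join_restriction_functor_extension: "join_restriction_functor J B extension"
proof -
  have H: "t \<in> Hom J (Dom J t) (Cod J t)" if "t \<in> Ar J" for t using that by (simp add: Hom_def)
  have E: "FM extension t \<in> Ar B" "Dom B (FM extension t) = FO F (Dom J t)"
      "Cod B (FM extension t) = FO F (Cod J t)" if "t \<in> Ar J" for t
    using B.is_joinD(2-4)[OF extension_join[OF H[OF that]]] by auto
  have "FO F \<in> Ob A \<rightarrow>\<^sub>E Ob B"
    using F unfolding cover_to_join_map_def restriction_functor_def by blast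
  then have "FO extension \<in> Ob J \<rightarrow>\<^sub>E Ob B" by (simp add: extension_def Ob_J)
  moreover have "FM extension \<in> Ar J \<rightarrow>\<^sub>E Ar B"
    using E(1) by (auto simp: extension_def)
  moreover have FOe: "FO extension = FO F" by (simp add: extension_def)
  moreover have "FM extension (Ide J a) = Ide B (FO F a)" if "a \<in> Ob J" for a
    using extension_unit[OF ide_hom[of a]] that h_ide[of a] F_simps(2)[of a] by (simp add: Ob_J)
  moreover have "FM extension (u \<cdot>\<^bsub>J\<^esub> t) = FM extension u \<cdot>\<^bsub>B\<^esub> FM extension t"
    if "t \<in> Ar J" "u \<in> Ar J" "Dom J u = Cod J t" for t u
    using extension_cmp[of t "Dom J t" "Cod J t" u "Cod J u"] that by (simp add: Hom_def)
  moreover have "FM extension (Rst J t) = Rst B (FM extension t)" if "t \<in> Ar J" for t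
    by (rule extension_rst[OF H[OF that]])
  ultimately have "restriction_functor J B extension"
    using E unfolding restriction_functor_def by simp
  then show ?thesis
    unfolding join_restriction_functor_def FOe using extension_preserves_join by blast
qed

lemma extension_factors: "F = fcomp A extension unit_fctr"
proof -
  have X: "FO F \<in> extensional (Ob A)" "FM F \<in> extensional (Ar A)"
    using F unfolding cover_to_join_map_def restriction_functor_def by (auto simp: PiE_iff)
  have "FO F = compose (Ob A) (FO extension) (FO unit_fctr)"
    by (rule extensionalityI[OF X(1)]) (auto simp: compose_def unit_fctr_def extension_def)
  moreover have "FM F = compose (Ar A) (FM extension) (FM unit_fctr)"
  proof (rule extensionalityI[OF X(2)])
    fix f assume "f \<in> Ar A"
    then show "FM F f = compose (Ar A) (FM extension) (FM unit_fctr) f"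
      using extension_unit[of f "Dom A f" "Cod A f"] by (simp add: compose_def unit_fctr_def Hom_def)
  qed (simp add: compose_def)
  ultimately show ?thesis by (simp add: fcomp_def)
qed

lemma extension_unique:
  assumes G: "join_restriction_functor J B G" and FG: "F = fcomp A G unit_fctr"
  shows "G = extension"
proof -
  have Gx: "FO G \<in> extensional (Ob A)" "FM G \<in> extensional (Ar J)"
    using G Ob_J unfolding join_restriction_functor_def restriction_functor_def
    by (auto simp: PiE_iff)
  have Fx: "FO F \<in> extensional (Ob A)"
    using F unfolding cover_to_join_map_def restriction_functor_def by (auto simp: PiE_iff)
  have FO: "FO G = FO F"
  proof (rule extensionalityI[OF Gx(1) Fx])
    fix a assume "a \<in> Ob A"
    then show "FO G a = FO F a" unfolding FG by (simp add: fcomp_def compose_def unit_fctr_def)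
  qed
  have Gh: "FM G (h f) = FM F f" if "f \<in> Ar A" for f
    unfolding FG using that by (simp add: fcomp_def compose_def unit_fctr_def)
  have "FM G = FM extension"
  proof (rule extensionalityI[OF Gx(2)])
    show "FM extension \<in> extensional (Ar J)" by (simp add: extension_def)
    fix t assume t: "t \<in> Ar J"
    define a b where "a = Dom J t" and "b = Cod J t"
    have tH: "t \<in> Hom J a b" using t by (simp add: Hom_def a_def b_def)
    have ob: "a \<in> Ob J" "b \<in> Ob J" using t J.dom_obj J.cod_obj by (auto simp: a_def b_def)
    note d = dense_below[OF tH]
    have "is_join B (FO G a) (FO G b) (FM G ` h ` below t) (FM G t)"
      using G ob d J.is_join_compatible_family[OF d] unfolding join_restriction_functor_def by blast
    moreover have "FM G ` h ` below t = FM F ` below t"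
      unfolding image_image using Gh by (auto simp: below_Hom[OF tH] Hom_def intro!: image_cong)
    ultimately show "FM G t = FM extension t"
      using B.is_join_unique[OF _ extension_join[OF tH]] FO by simp
  qed
  then show ?thesis using FO by (simp add: extension_def)
qed

end

theorem relative_join_completion_unit:
  "relative_join_completion TYPE('p \<times> 'n) A C J unit_fctr"
  unfolding relative_join_completion_def
proof (intro conjI allI impI)
  show "join_restriction_category J" by (rule J.join_restriction_category_axioms)
  show "cover_to_join_map A C J unit_fctr" by (rule cover_to_join_unit)
  fix B :: "('p, 'n) rcat" and F
  assume B: "join_restriction_category B" and F: "cover_to_join_map A C B F"
  show "\<exists>!F'. join_restriction_functor J B F' \<and> F = fcomp A F' unit_fctr"
  proof (rule ex1I)
    show "join_restriction_functor J B (extension B F) \<and> F = fcomp A (extension B F) unit_fctr"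
      using join_restriction_functor_extension[OF B F] extension_factors[OF B F] by simp
    fix G assume "join_restriction_functor J B G \<and> F = fcomp A G unit_fctr"
    then show "G = extension B F" using extension_unique[OF B F] by simp
  qed
qed

end

section \<open>Partial sections of the glueings\<close>

locale Psi_of_OC = coverage_embedding A C emb
  for A :: "('o, 'm) rcat" (structure) and C and emb :: "'m set \<Rightarrow> 'u" +
  fixes AA :: "('o, 'u gorder, 'u locp_map) pcat" and s :: "'m \<Rightarrow> 'u locp_map"
  assumes Psi: "is_Psi A Locp (OC emb A C) AA s"
begin

section \<open>The glueing data and its restriction idempotents\<close>

abbreviation P where "P \<equiv> FM (OC emb A C)"

sublocale K: join_partite_category_in Locp AA
proof -
  interpret partite_internal_category Locp AA using Psi by (simp add: is_Psi_def)
  show "join_partite_category_in Locp AA" ..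
qed

sublocale J: join_restriction_category "Phi Locp AA"
  by (rule K.join_restriction_category_Phi)

lemma Idx_AA [simp]: "Idx AA = Ob A"
  using Psi by (simp add: is_Psi_def)

lemma PO_AA [simp]: "i \<in> Ob A \<Longrightarrow> PO AA i = L i"
  using Psi OC_FO by (simp add: is_Psi_def)

text \<open>\<open>q f\<close> is the piece of \<sigma> whose partial inverse is \<open>s f\<close>.
  \<open>glueing\<close> provides the pieces existentially and for one pair of objects, so a
  \<open>q\<close> is obtained afresh in each proof.\<close>

definition section_inverses :: "'o \<Rightarrow> 'o \<Rightarrow> ('m \<Rightarrow> 'u locp_map) \<Rightarrow> bool" where
  "section_inverses i j q \<longleftrightarrow>
    (\<forall>f\<in>Hom A i j. q f \<in> Ar Locp \<and> src (q f) = PA AA i j \<and> tgt (q f) = L i \<and>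
      s f \<in> Ar Locp \<and> src (s f) = L i \<and> tgt (s f) = PA AA i j \<and>
      s f \<cdot>\<^bsub>Locp\<^esub> q f = Rst Locp (q f) \<and> q f \<cdot>\<^bsub>Locp\<^esub> s f = Rst Locp (s f)) \<and>
    is_join Locp (PA AA i j) (L i) (q ` Hom A i j) (Sg AA i j) \<and>
    (\<forall>f\<in>Hom A i j. \<forall>g\<in>Hom A i j.
      eq_extent A Locp (OC emb A C) f g = q g \<cdot>\<^bsub>Locp\<^esub> s f)"

lemma section_inversesD:
  assumes "section_inverses i j q"
  shows "f \<in> Hom A i j \<Longrightarrow> q f \<in> Ar Locp \<and> src (q f) = PA AA i j \<and> tgt (q f) = L i \<and>
      s f \<in> Ar Locp \<and> src (s f) = L i \<and> tgt (s f) = PA AA i j \<and>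
      s f \<cdot>\<^bsub>Locp\<^esub> q f = Rst Locp (q f) \<and> q f \<cdot>\<^bsub>Locp\<^esub> s f = Rst Locp (s f)"
    "is_join Locp (PA AA i j) (L i) (q ` Hom A i j) (Sg AA i j)"
    "f \<in> Hom A i j \<Longrightarrow> g \<in> Hom A i j \<Longrightarrow>
      eq_extent A Locp (OC emb A C) f g = q g \<cdot>\<^bsub>Locp\<^esub> s f"
  using assms by (simp_all add: section_inverses_def)

lemma ex_section_inverses:
  assumes "i \<in> Ob A" "j \<in> Ob A"
  shows "\<exists>q. section_inverses i j q"
proof -
  have "glueing Locp (L i) (Hom A i j) (eq_extent A Locp (OC emb A C)) (PA AA i j) (Sg AA i j) s"
    using Psi assms OC_FO by (simp add: is_Psi_def)
  then show ?thesis
    by (auto simp: glueing_def section_inverses_def partial_inverse_def Locp_Hom Locp_simps(3,4))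
qed

lemma extent_sym:
  assumes "f \<in> Hom A i j" "g \<in> Hom A i j"
  shows "eq_extent A Locp (OC emb A C) f g = eq_extent A Locp (OC emb A C) g f"
    "eq_extent A Locp (OC emb A C) f g \<in> ridem Locp (L i)"
proof -
  have ob: "i \<in> Ob A" "j \<in> Ob A" using assms dom_obj cod_obj by (auto simp: Hom_def)
  then have "local_atlas Locp (L i) (Hom A i j) (eq_extent A Locp (OC emb A C))"
    using Psi OC_FO by (simp add: is_Psi_def glueing_def)
  then show "eq_extent A Locp (OC emb A C) f g = eq_extent A Locp (OC emb A C) g f"
    "eq_extent A Locp (OC emb A C) f g \<in> ridem Locp (L i)"
    using assms unfolding local_atlas_def by blast+
qed

lemma HomA:
  assumes "f \<in> Hom A i j"
  shows "f \<in> Ar A" "Dom A f = i" "Cod A f = j" "i \<in> Ob A" "j \<in> Ob A"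
  using assms dom_obj cod_obj by (auto simp: Hom_def)

lemma s_simps:
  assumes "f \<in> Hom A i j"
  shows "s f \<in> Ar Locp" "src (s f) = L i" "tgt (s f) = PA AA i j"
  using ex_section_inverses[OF HomA(4,5)[OF assms]] section_inversesD(1) assms by blast+

lemma agreement_ridem: "f \<in> Hom A i j \<Longrightarrow> agreement A f g \<subseteq> ridem A i"
  by (auto simp: agreement_def Hom_def)

lemma extent_eq:
  assumes f: "f \<in> Hom A i j"
  shows "eq_extent A Locp (OC emb A C) f g =
    open_part (L i) (emb (ideal_hull A C i (agreement A f g)))"
proof -
  have "eq_extent A Locp (OC emb A C) f g =
      join_of Locp (L i) (L i) (P ` agreement A f g)"
    using HomA[OF f] OC_FO by (simp add: eq_extent_def agreement_def)
  also have "\<dots> = open_part (L i) (emb (ideal_hull A C i (agreement A f g)))"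
    by (rule Locp.join_of_eq[OF OC_ridem_join[OF agreement_ridem[OF f]]])
  finally show ?thesis .
qed

lemma P_rle_extent:
  assumes f: "f \<in> Hom A i j" and e: "e \<in> agreement A f g"
  shows "rle Locp (P e) (eq_extent A Locp (OC emb A C) f g)"
proof -
  note r = agreement_ridem[OF f]
  have "e \<in> ideal_hull A C i (agreement A f g)" using e hull_superset by (rule rev_subsetD)
  then show ?thesis
    unfolding extent_eq[OF f] using OC_ridem_rle_hull_iff[OF r subsetD[OF r e]] by simp
qed

text \<open>\<open>Rst (s f)\<close> is \<open>q f \<cdot> s f\<close>, the extent of
  \<open>f = f\<close>, and the agreement set of \<open>f\<close> with itself has
  \<open>Rst f\<close> as its greatest element.\<close>

lemma rst_s:
  assumes f: "f \<in> Hom A i j"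
  shows "Rst Locp (s f) = P (Rst A f)"
proof -
  note F = HomA[OF f]
  have r: "Rst A f \<in> ridem A i" by (rule rst_ridem) (use F in simp_all)
  have "ideal_hull A C i (agreement A f f) = ideal_gen A C i (Rst A f)"
  proof
    have m: "Rst A f \<in> ideal_gen A C i (Rst A f)"
      unfolding ideal_gen_eq using hull_superset by blast
    show "ideal_hull A C i (agreement A f f) \<subseteq> ideal_gen A C i (Rst A f)"
      by (rule hull_least[OF closed_ideal_gen[OF r]])
        (use closed_idealD(2)[OF closed_ideal_gen[OF r] m] F in \<open>auto simp: agreement_def\<close>)
    have "Rst A f \<in> agreement A f f" using r F by (simp add: agreement_def rle_refl)
    then show "ideal_gen A C i (Rst A f) \<subseteq> ideal_hull A C i (agreement A f f)"
      unfolding ideal_gen_eq by (intro hull_mono) simp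
  qed
  then have "eq_extent A Locp (OC emb A C) f f = P (Rst A f)"
    using extent_eq[OF f] OC_ridem[OF r] by simp
  moreover obtain q where sys: "section_inverses i j q"
    using ex_section_inverses[OF F(4,5)] by blast
  ultimately show ?thesis
    using section_inversesD(1)[OF sys f] section_inversesD(3)[OF sys f f] by simp
qed

text \<open>As \<open>q f\<close> is a restriction of \<open>Sg\<close>, the composite
  \<open>q f \<cdot> s f\<close> is \<open>Sg \<cdot> Rst (q f) \<cdot> s f\<close>. Writing
  \<open>Rst (q f)\<close> as \<open>s f \<cdot> q f\<close> shows that this restriction leaves
  \<open>s f\<close> unchanged.\<close>

lemma s_sec:
  assumes f: "f \<in> Hom A i j"
  shows "K.sec i j (s f)"
proof -
  note F = HomA[OF f] and S = s_simps[OF f]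
  obtain q where sys: "section_inverses i j q" using ex_section_inverses[OF F(4,5)] by blast
  note q0 = section_inversesD(1)[OF sys] and j = section_inversesD(2)[OF sys]
    and ext = section_inversesD(3)[OF sys]
  have q: "q f \<in> Ar Locp" "src (q f) = PA AA i j" "tgt (q f) = L i"
      "s f \<cdot>\<^bsub>Locp\<^esub> q f = Rst Locp (q f)" "q f \<cdot>\<^bsub>Locp\<^esub> s f = Rst Locp (s f)"
      "rle Locp (q f) (Sg AA i j)"
    using q0[OF f] Locp.is_joinD(5)[OF j] f by auto
  have [simp]: "Dom Locp (s f) = L i" "Cod Locp (s f) = PA AA i j" "Dom Locp (q f) = PA AA i j"
      "Cod Locp (q f) = L i" "s f \<in> Ar Locp" "q f \<in> Ar Locp"
    using S q by (simp_all add: Locp_simps(3,4))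
  have "q f \<cdot>\<^bsub>Locp\<^esub> s f = (Sg AA i j \<cdot>\<^bsub>Locp\<^esub> Rst Locp (q f)) \<cdot>\<^bsub>Locp\<^esub> s f"
    by (simp only: Locp.rleD(5)[OF q(6)])
  also have "\<dots> = Sg AA i j \<cdot>\<^bsub>Locp\<^esub> Rst Locp (q f) \<cdot>\<^bsub>Locp\<^esub> s f"
    using F by simp
  also have "Rst Locp (q f) \<cdot>\<^bsub>Locp\<^esub> s f = (s f \<cdot>\<^bsub>Locp\<^esub> q f) \<cdot>\<^bsub>Locp\<^esub> s f"
    by (simp only: q(4))
  also have "\<dots> = s f \<cdot>\<^bsub>Locp\<^esub> q f \<cdot>\<^bsub>Locp\<^esub> s f"
    by (rule Locp.assoc) simp_all
  also have "\<dots> = s f" unfolding q(5) by simp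
  finally have "Sg AA i j \<cdot>\<^bsub>Locp\<^esub> s f = Rst Locp (s f)" using q(5) by simp
  then show ?thesis
    by (intro K.secI) (use F in simp_all)
qed

text \<open>With \<open>y = q g \<cdot> s f\<close> the extent, \<open>s g \<cdot> y\<close> is
  \<open>Rst (q g) \<cdot> s f\<close>, which is a restriction of \<open>s f\<close>. Precomposing
  with \<open>x\<close>, which lies below \<open>y\<close>, gives the claim.\<close>

lemma s_restrict_le:
  assumes f: "f \<in> Hom A i j" and g: "g \<in> Hom A i j" and x: "x \<in> ridem Locp (L i)"
    and le: "rle Locp x (eq_extent A Locp (OC emb A C) f g)"
  shows "rle Locp (s g \<cdot>\<^bsub>Locp\<^esub> x) (s f \<cdot>\<^bsub>Locp\<^esub> x)"
proof -
  note F = HomA[OF f]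
  define y where "y = eq_extent A Locp (OC emb A C) f g"
  have yr: "y \<in> ridem Locp (L i)" unfolding y_def by (rule extent_sym(2)[OF f g])
  note [simp] = Locp.ridemD[OF x] Locp.ridemD[OF yr]
  obtain q where sys: "section_inverses i j q" using ex_section_inverses[OF F(4,5)] by blast
  note q0 = section_inversesD(1)[OF sys] and j = section_inversesD(2)[OF sys]
    and ext = section_inversesD(3)[OF sys]
  have q: "q g \<in> Ar Locp" "src (q g) = PA AA i j" "tgt (q g) = L i"
      "s g \<cdot>\<^bsub>Locp\<^esub> q g = Rst Locp (q g)" "y = q g \<cdot>\<^bsub>Locp\<^esub> s f"
    using q0[OF g] ext[OF f g] by (auto simp: y_def)
  have [simp]: "Dom Locp (s f) = L i" "Cod Locp (s f) = PA AA i j" "Dom Locp (q g) = PA AA i j"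
      "Dom Locp (s g) = L i" "Cod Locp (s g) = PA AA i j" "s g \<in> Ar Locp"
      "Cod Locp (q g) = L i" "s f \<in> Ar Locp" "q g \<in> Ar Locp"
    using s_simps[OF f] s_simps[OF g] q by (simp_all add: Locp_simps(3,4))
  have "s g \<cdot>\<^bsub>Locp\<^esub> y = (s g \<cdot>\<^bsub>Locp\<^esub> q g) \<cdot>\<^bsub>Locp\<^esub> s f"
    unfolding q(5) by (rule Locp.assoc[symmetric]) simp_all
  also have "\<dots> = Rst Locp (q g) \<cdot>\<^bsub>Locp\<^esub> s f" by (simp only: q(4))
  also have "\<dots> = s f \<cdot>\<^bsub>Locp\<^esub> Rst Locp (q g \<cdot>\<^bsub>Locp\<^esub> s f)" by (rule Locp.rst_past) simp_all
  finally have "rle Locp (s g \<cdot>\<^bsub>Locp\<^esub> y) (s f)"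
    using Locp.rle_cmp_rst[of "q g \<cdot>\<^bsub>Locp\<^esub> s f" "s f"] by simp
  then have "rle Locp ((s g \<cdot>\<^bsub>Locp\<^esub> y) \<cdot>\<^bsub>Locp\<^esub> x) (s f \<cdot>\<^bsub>Locp\<^esub> x)"
    by (rule Locp.rle_cmp_right) simp_all
  moreover have "y \<cdot>\<^bsub>Locp\<^esub> x = x"
    using le Locp.ridem_rle_iff[OF x yr] by (simp add: y_def)
  ultimately show ?thesis by simp
qed

lemma s_restrict_eq:
  assumes f: "f \<in> Hom A i j" and g: "g \<in> Hom A i j" and x: "x \<in> ridem Locp (L i)"
    and le: "rle Locp x (eq_extent A Locp (OC emb A C) f g)"
  shows "s f \<cdot>\<^bsub>Locp\<^esub> x = s g \<cdot>\<^bsub>Locp\<^esub> x"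
  using Locp.rle_antisym s_restrict_le[OF f g x le] s_restrict_le[OF g f x]
    le extent_sym(1)[OF f g] by metis

text \<open>\<open>f \<cdot> e\<close> and \<open>f\<close> agree on \<open>Rst f \<cdot> e\<close>,
  so their sections coincide there. This idempotent is the whole restriction of
  \<open>f \<cdot> e\<close>, while on the other side \<open>s f\<close> absorbs the factor coming
  from \<open>Rst f\<close>.\<close>

lemma s_cmp_ridem:
  assumes f: "f \<in> Hom A i j" and e: "e \<in> ridem A i"
  shows "s (f \<cdot> e) = s f \<cdot>\<^bsub>Locp\<^esub> P e"
proof -
  note F = HomA[OF f] and E = ridemD[OF e]
  have eH: "e \<in> Hom A i i" using e by (simp add: ridem_def)
  have fe: "f \<cdot> e \<in> Hom A i j" by (rule cmp_hom[OF eH f])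
  have rf: "Rst A f \<in> ridem A i" by (rule rst_ridem[OF F(1,2)])
  have rfe: "Rst A (f \<cdot> e) = Rst A f \<cdot> e" using rst_of_cmp_rst[of e f] F E by simp
  have d: "Rst A f \<cdot> e \<in> ridem A i" by (rule ridem_cmp[OF rf e])
  have c: "f \<cdot> Rst A f \<cdot> e = f \<cdot> e" "(f \<cdot> e) \<cdot> Rst A f \<cdot> e = f \<cdot> e"
    using cmp_rst_self[of "f \<cdot> e"] F E unfolding rfe by simp_all
  have "rle A (Rst A f \<cdot> e) (Rst A f)" by (rule ridem_cmp_rle[OF rf e])
  then have "rle A (Rst A f \<cdot> e) (Rst A (f \<cdot> e) \<cdot> Rst A f)"
    using ridem_swap[OF d rf] ridem_rle_iff[OF d rf] rle_refl[of "Rst A f \<cdot> e"] F E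
    by (simp add: rfe[symmetric])
  then have ag: "Rst A f \<cdot> e \<in> agreement A (f \<cdot> e) f"
    using d F E c by (simp add: agreement_def)
  have "s (f \<cdot> e) \<cdot>\<^bsub>Locp\<^esub> P (Rst A f \<cdot> e) = s f \<cdot>\<^bsub>Locp\<^esub> P (Rst A f \<cdot> e)"
    by (rule s_restrict_eq[OF fe f OC_ridem_ridem[OF d] P_rle_extent[OF fe ag]])
  moreover have "s (f \<cdot> e) \<cdot>\<^bsub>Locp\<^esub> P (Rst A f \<cdot> e) = s (f \<cdot> e)"
    using Locp.cmp_rst_self[OF s_simps(1)[OF fe]] unfolding rst_s[OF fe] rfe .
  moreover have "s f \<cdot>\<^bsub>Locp\<^esub> P (Rst A f \<cdot> e) = s f \<cdot>\<^bsub>Locp\<^esub> Rst Locp (s f) \<cdot>\<^bsub>Locp\<^esub> P e"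
    using OC_ridem_cmp[OF rf e] rst_s[OF f] by simp
  moreover have "s f \<cdot>\<^bsub>Locp\<^esub> Rst Locp (s f) \<cdot>\<^bsub>Locp\<^esub> P e = s f \<cdot>\<^bsub>Locp\<^esub> P e"
    by (rule Locp.cmp_rst_self_assoc)
      (use s_simps[OF f] Locp.ridemD[OF OC_ridem_ridem[OF e]] in \<open>simp_all add: Locp_simps(3)\<close>)
  ultimately show ?thesis by simp
qed

lemma sec_join_s:
  assumes t: "K.sec i j t"
  shows "is_join Locp (L i) (PA AA i j) (s ` {g \<in> Hom A i j. rle Locp (s g) t}) t"
proof -
  have ij: "i \<in> Ob A" "j \<in> Ob A" using K.secD(1,2)[OF t] by simp_all
  have T [simp]: "t \<in> Ar Locp" "Dom Locp t = L i" "Cod Locp t = PA AA i j"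
    and T6: "Sg AA i j \<cdot>\<^bsub>Locp\<^esub> t = Rst Locp t"
    using K.secD[OF t] ij by simp_all
  obtain q where sys: "section_inverses i j q" using ex_section_inverses[OF ij] by blast
  note q = section_inversesD(1)[OF sys] and j = section_inversesD(2)[OF sys]
    and ext = section_inversesD(3)[OF sys]
  \<comment> \<open>\<open>Sg\<close> is the join of the \<open>q f\<close> and is total, so the
    idempotents \<open>Rst (q f)\<close> join to an identity and cut \<open>t\<close> into
    pieces.\<close>
  have "is_join Locp (L i) (PA AA i j)
      ((\<lambda>x. x \<cdot>\<^bsub>Locp\<^esub> t) ` Rst Locp ` q ` Hom A i j) (Rst Locp (Sg AA i j) \<cdot>\<^bsub>Locp\<^esub> t)"
    by (rule Locp.is_join_precomp[OF Locp.is_join_rst[OF j]]) simp_all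
  then have jt: "is_join Locp (L i) (PA AA i j) ((\<lambda>f. Rst Locp (q f) \<cdot>\<^bsub>Locp\<^esub> t) ` Hom A i j) t"
    using ij by (simp add: image_image)
  have below: "rle Locp (Rst Locp (q f) \<cdot>\<^bsub>Locp\<^esub> t) u"
    if f: "f \<in> Hom A i j" and u: "u \<in> Ar Locp" "Dom Locp u = L i" "Cod Locp u = PA AA i j"
      and le: "\<And>g. g \<in> Hom A i j \<Longrightarrow> rle Locp (s g) t \<Longrightarrow> rle Locp (s g) u" for f u
  proof -
    \<comment> \<open>\<open>q f\<close> is a restriction of \<open>Sg\<close>, and
      \<open>Sg \<cdot> t = Rst t\<close>; hence \<theta> equals its own restriction and is an
      element of the locale \<open>L i\<close>.\<close>
    define \<theta> where "\<theta> = q f \<cdot>\<^bsub>Locp\<^esub> t"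
    have [simp]: "q f \<in> Ar Locp" "Dom Locp (q f) = PA AA i j" "Cod Locp (q f) = L i"
        "s f \<in> Ar Locp" "Dom Locp (s f) = L i" "Cod Locp (s f) = PA AA i j"
      using q[OF f] by (simp_all add: Locp_simps(3,4))
    have qs: "rle Locp (q f) (Sg AA i j)" using Locp.is_joinD(5)[OF j] f by blast
    have "\<theta> = (Sg AA i j \<cdot>\<^bsub>Locp\<^esub> Rst Locp (q f)) \<cdot>\<^bsub>Locp\<^esub> t"
      unfolding \<theta>_def by (simp only: Locp.rleD(5)[OF qs])
    also have "\<dots> = Sg AA i j \<cdot>\<^bsub>Locp\<^esub> Rst Locp (q f) \<cdot>\<^bsub>Locp\<^esub> t" using ij by simp
    also have "Rst Locp (q f) \<cdot>\<^bsub>Locp\<^esub> t = t \<cdot>\<^bsub>Locp\<^esub> Rst Locp (q f \<cdot>\<^bsub>Locp\<^esub> t)"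
      by (rule Locp.rst_past) simp_all
    also have "Sg AA i j \<cdot>\<^bsub>Locp\<^esub> t \<cdot>\<^bsub>Locp\<^esub> Rst Locp (q f \<cdot>\<^bsub>Locp\<^esub> t) =
        (Sg AA i j \<cdot>\<^bsub>Locp\<^esub> t) \<cdot>\<^bsub>Locp\<^esub> Rst Locp (q f \<cdot>\<^bsub>Locp\<^esub> t)" using ij by simp
    also have "\<dots> = Rst Locp (q f \<cdot>\<^bsub>Locp\<^esub> t)"
      unfolding T6 by simp
    finally have "\<theta> \<in> ridem Locp (L i)" by (simp add: Locp.rst_ridem)
    then obtain D where D: "D \<subseteq> ridem A i" "is_join Locp (L i) (L i) (P ` D) \<theta>"
      by (rule ridem_Locp_OC)
    have eq: "s f \<cdot>\<^bsub>Locp\<^esub> \<theta> = Rst Locp (q f) \<cdot>\<^bsub>Locp\<^esub> t"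
    proof -
      have "s f \<cdot>\<^bsub>Locp\<^esub> \<theta> = (s f \<cdot>\<^bsub>Locp\<^esub> q f) \<cdot>\<^bsub>Locp\<^esub> t" unfolding \<theta>_def by simp
      then show ?thesis using q[OF f] by simp
    qed
    have le_t: "rle Locp (s f \<cdot>\<^bsub>Locp\<^esub> \<theta>) t"
      unfolding eq by (rule Locp.is_joinD(5)[OF jt]) (use f in simp)
    have "is_join Locp (L i) (PA AA i j) ((\<lambda>x. s f \<cdot>\<^bsub>Locp\<^esub> x) ` P ` D) (s f \<cdot>\<^bsub>Locp\<^esub> \<theta>)"
      by (rule Locp.is_join_postcomp[OF D(2)]) simp_all
    moreover have "(\<lambda>x. s f \<cdot>\<^bsub>Locp\<^esub> x) ` P ` D = (\<lambda>e. s (f \<cdot> e)) ` D"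
      unfolding image_image using s_cmp_ridem[OF f] D(1) by (auto intro!: image_cong)
    ultimately have js: "is_join Locp (L i) (PA AA i j) ((\<lambda>e. s (f \<cdot> e)) ` D) (s f \<cdot>\<^bsub>Locp\<^esub> \<theta>)"
      by simp
    \<comment> \<open>Each \<open>s (f \<cdot> e)\<close> lies below
      \<open>s f \<cdot> \<theta>\<close> and so below \<open>t\<close>; it is therefore one of the
      sections that \<open>u\<close> bounds by assumption.\<close>
    have "rle Locp (s f \<cdot>\<^bsub>Locp\<^esub> \<theta>) u"
    proof (rule Locp.is_joinD(6)[OF js u])
      fix x assume x: "x \<in> (\<lambda>e. s (f \<cdot> e)) ` D"
      then obtain e where e: "e \<in> D" "x = s (f \<cdot> e)" by blast
      have "e \<in> Hom A i i" using e D(1) by (auto simp: ridem_def)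
      then have "f \<cdot> e \<in> Hom A i j" by (rule cmp_hom[OF _ f])
      moreover have "rle Locp x t"
        by (rule Locp.rle_trans[OF Locp.is_joinD(5)[OF js x] le_t])
      ultimately show "rle Locp x u" using le e(2) by blast
    qed
    then show ?thesis by (simp only: eq)
  qed
  show ?thesis
  proof (rule Locp.is_joinI)
    fix u assume u: "u \<in> Ar Locp" "Dom Locp u = L i" "Cod Locp u = PA AA i j"
      and le: "\<And>f. f \<in> s ` {g \<in> Hom A i j. rle Locp (s g) t} \<Longrightarrow> rle Locp f u"
    show "rle Locp t u"
    proof (rule Locp.is_joinD(6)[OF jt u])
      fix x assume "x \<in> (\<lambda>f. Rst Locp (q f) \<cdot>\<^bsub>Locp\<^esub> t) ` Hom A i j"
      then show "rle Locp x u" using below[OF _ u] le by blast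
    qed
  qed auto
qed

text \<open>Postcomposing with \<open>q k\<close> moves the inequality from sections to elements of
  \<open>L i\<close>: \<open>s k\<close> becomes \<open>Rst (s k)\<close>, and each
  \<open>s x\<close> becomes the extent of \<open>x = k\<close>, which is the hull of an agreement
  set inside \<open>D\<close>.\<close>

lemma s_conservative:
  assumes S: "S \<subseteq> Hom A i j" and k: "k \<in> Hom A i j"
    and t: "is_join Locp (L i) (PA AA i j) (s ` S) t" and kt: "rle Locp (s k) t"
    and D: "closed_ideal A C i D" "\<And>x. x \<in> S \<Longrightarrow> agreement A x k \<subseteq> D"
  shows "Rst A k \<in> D"
proof -
  note F = HomA[OF k]
  have rk: "Rst A k \<in> ridem A i" by (rule rst_ridem[OF F(1,2)])
  have Dr: "D \<subseteq> ridem A i" by (rule closed_idealD(1)[OF D(1)])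
  \<comment> \<open>The element of \<open>L i\<close> given by \<open>D\<close>, written as a hull
    to fit \<open>OC_ridem_rle_hull_iff\<close>; a closed ideal is its own hull.\<close>
  define u where "u = open_part (L i) (emb (ideal_hull A C i D))"
  have u: "u \<in> Ar Locp" "src u = L i" "tgt u = L i"
    unfolding u_def by (simp_all add: open_part_Ar[OF pointfree_space_OC_obj hull_carrier[OF Dr]])
  obtain q where sys: "section_inverses i j q" using ex_section_inverses[OF F(4,5)] by blast
  note q0 = section_inversesD(1)[OF sys] and j = section_inversesD(2)[OF sys]
    and ext = section_inversesD(3)[OF sys]
  have q: "q k \<in> Ar Locp" "src (q k) = PA AA i j" "tgt (q k) = L i"
      "q k \<cdot>\<^bsub>Locp\<^esub> s k = Rst Locp (s k)"
    using q0[OF k] by auto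
  have "rle Locp (q k \<cdot>\<^bsub>Locp\<^esub> s k) (q k \<cdot>\<^bsub>Locp\<^esub> t)"
    by (rule Locp.rle_cmp_left[OF kt]) (use q s_simps[OF k] in \<open>simp_all add: Locp_simps(3,4)\<close>)
  then have 1: "rle Locp (P (Rst A k)) (q k \<cdot>\<^bsub>Locp\<^esub> t)"
    unfolding q(4) rst_s[OF k] .
  have "is_join Locp (L i) (L i) ((\<lambda>x. q k \<cdot>\<^bsub>Locp\<^esub> x) ` s ` S) (q k \<cdot>\<^bsub>Locp\<^esub> t)"
    by (rule Locp.is_join_postcomp[OF t]) (use q in \<open>simp_all add: Locp_simps(3,4)\<close>)
  then have "rle Locp (q k \<cdot>\<^bsub>Locp\<^esub> t) u"
  proof (rule Locp.is_joinD(6))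
    fix y assume "y \<in> (\<lambda>x. q k \<cdot>\<^bsub>Locp\<^esub> x) ` s ` S"
    then obtain x where x: "x \<in> S" "y = q k \<cdot>\<^bsub>Locp\<^esub> s x" by blast
    have xH: "x \<in> Hom A i j" using x S by blast
    have "y = open_part (L i) (emb (ideal_hull A C i (agreement A x k)))"
      using ext[OF xH k] extent_eq[OF xH] x(2) by simp
    moreover have "ideal_hull A C i (agreement A x k) \<subseteq> ideal_hull A C i D"
      by (rule hull_mono[OF D(2)[OF x(1)]])
    ultimately show "rle Locp y u"
      unfolding u_def
      using open_part_rle_iff[OF pointfree_space_OC_obj hull_carrier[OF agreement_ridem[OF xH]]
          hull_carrier[OF Dr], of k] by (simp add: OC_obj_simps)
  qed (use u in \<open>simp_all add: Locp_simps(3,4)\<close>)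
  from Locp.rle_trans[OF 1 this] have "Rst A k \<in> ideal_hull A C i D"
    unfolding u_def OC_ridem_rle_hull_iff[OF Dr rk] .
  then show ?thesis using hull_closed[OF D(1)] by simp
qed

text \<open>Condition (ii) of a coverage moves the cover to \<open>Rst f\<close>, where
  \<open>OC_ridem_cover\<close> makes it a join. Postcomposing with \<open>s f\<close> brings it
  back, since \<open>f \<cdot> Rst x = x\<close> for \<open>x\<close> in the sieve.\<close>

lemma s_cover:
  assumes f: "f \<in> Hom A i j" and X: "X \<in> C f"
  shows "is_join Locp (L i) (PA AA i j) (s ` X) (s f)"
proof -
  note F = HomA[OF f]
  have sv: "sieve A f X" by (rule cover_sieve[OF F(1) X])
  then have "Rst A ` X \<in> C (Rst A f)" using cover_rst F X by blast
  from OC_ridem_cover[OF rst_ridem[OF F(1,2)] this]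
  have "is_join Locp (L i) (L i) (P ` Rst A ` X) (P (Rst A f))" .
  then have "is_join Locp (L i) (PA AA i j) ((\<lambda>x. s f \<cdot>\<^bsub>Locp\<^esub> x) ` P ` Rst A ` X)
      (s f \<cdot>\<^bsub>Locp\<^esub> P (Rst A f))"
    by (rule Locp.is_join_postcomp) (use s_simps[OF f] in \<open>simp_all add: Locp_simps(3,4)\<close>)
  moreover have "s f \<cdot>\<^bsub>Locp\<^esub> P (Rst A f) = s f"
    using s_cmp_ridem[OF f rst_ridem[OF F(1,2)]] F by simp
  moreover have "s f \<cdot>\<^bsub>Locp\<^esub> P (Rst A x) = s x" if "x \<in> X" for x
  proof -
    have x: "rle A x f" using sv that by (simp add: sieve_def)
    then have "Rst A x \<in> ridem A i" using rst_ridem rleD F by auto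
    from s_cmp_ridem[OF f this] rleD(5)[OF x] show ?thesis by simp
  qed
  ultimately show ?thesis by (simp add: image_image cong: image_cong)
qed

lemma s_ide: "i \<in> Ob A \<Longrightarrow> s (Ide A i) = Unt AA i"
  using Psi by (simp add: is_Psi_def)

lemma s_cmp: "f \<in> Hom A i j \<Longrightarrow> g \<in> Hom A j k \<Longrightarrow> s (g \<cdot> f) = K.scmp i j k (s g) (s f)"
  using Psi HomA unfolding is_Psi_def K.scmp_def by metis

section \<open>The unit as a dense and conservative functor\<close>

definition sArr where "sArr f = (Dom A f, Cod A f, s f)"

lemma sArr_Hom: "f \<in> Hom A i j \<Longrightarrow> sArr f = (i, j, s f)"
  by (simp add: sArr_def Hom_def)

lemma sArr_join_iff:
  assumes "i \<in> Ob A" "j \<in> Ob A" "S \<subseteq> Hom A i j" "K.sec i j t"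
  shows "is_join (Phi Locp AA) i j (sArr ` S) (i, j, t) \<longleftrightarrow>
    is_join Locp (L i) (PA AA i j) (s ` S) t"
proof -
  have "sArr ` S = (\<lambda>s. (i, j, s)) ` s ` S"
    unfolding image_image using sArr_Hom assms(3) by (auto intro!: image_cong)
  moreover have "K.sec i j x" if "x \<in> s ` S" for x using that s_sec assms(3) by auto
  ultimately show ?thesis using K.Phi_is_join_iff[of i j "s ` S" t] assms by simp
qed

sublocale dense_conservative A C "Phi Locp AA" sArr
proof
  show "Ob (Phi Locp AA) = Ob A" by (simp add: K.Phi_simps)
next
  fix f a b assume "f \<in> Hom A a b"
  then show "sArr f \<in> Hom (Phi Locp AA) a b" by (auto simp: K.Phi_Hom sArr_Hom s_sec)
next
  fix a assume a: "a \<in> Ob A"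
  then show "sArr (Ide A a) = Ide (Phi Locp AA) a"
    using sArr_Hom[OF ide_hom[OF a]] s_ide[OF a] by (simp add: K.Phi_simps)
next
  fix f a b g c assume f: "f \<in> Hom A a b" and g: "g \<in> Hom A b c"
  then show "sArr (g \<cdot> f) = sArr g \<cdot>\<^bsub>Phi Locp AA\<^esub> sArr f"
    using s_cmp[OF f g] cmp_hom[OF f g] by (simp add: K.Phi_simps sArr_Hom)
next
  fix f a b assume f: "f \<in> Hom A a b"
  note F = HomA[OF f]
  \<comment> \<open>\<open>Rst f\<close> is read as the identity arrow precomposed with an
    idempotent, so that \<open>s_cmp_ridem\<close> computes its section from that of the
    identity.\<close>
  have "s (Rst A f) = Unt AA a \<cdot>\<^bsub>Locp\<^esub> Rst Locp (s f)"
    using s_cmp_ridem[OF ide_hom[OF F(4)] rst_ridem[OF F(1,2)]] rst_s[OF f] s_ide[OF F(4)] F by simp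
  then show "sArr (Rst A f) = Rst (Phi Locp AA) (sArr f)"
    using rst_hom[OF f] f by (simp add: K.Phi_simps sArr_Hom)
next
  fix f a b X assume f: "f \<in> Hom A a b" and X: "X \<in> C f"
  note F = HomA[OF f]
  have "X \<subseteq> Hom A a b"
    using cover_sieve[OF F(1) X] rleD F by (fastforce simp: sieve_def Hom_def)
  then show "is_join (Phi Locp AA) a b (sArr ` X) (sArr f)"
    using sArr_join_iff[OF F(4,5) _ s_sec[OF f]] s_cover[OF f X] sArr_Hom[OF f] by simp
next
  fix t a b assume "t \<in> Hom (Phi Locp AA) a b"
  then obtain t' where t: "t = (a, b, t')" "K.sec a b t'" by (auto simp: K.Phi_Hom)
  have ob: "a \<in> Ob A" "b \<in> Ob A" using K.secD(1,2)[OF t(2)] by simp_all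
  have "{g \<in> Hom A a b. rle (Phi Locp AA) (sArr g) t} = {g \<in> Hom A a b. rle Locp (s g) t'}"
    using K.Phi_rle_iff[OF s_sec t(2)] by (auto simp: t(1) sArr_Hom)
  then show "is_join (Phi Locp AA) a b (sArr ` {g \<in> Hom A a b. rle (Phi Locp AA) (sArr g) t}) t"
    using sArr_join_iff[OF ob _ t(2), of "{g \<in> Hom A a b. rle Locp (s g) t'}"]
      sec_join_s[OF t(2)] by (simp add: t(1))
next
  fix S a b k t D
  assume S: "S \<subseteq> Hom A a b" and k: "k \<in> Hom A a b"
    and t: "is_join (Phi Locp AA) a b (sArr ` S) t" and le: "rle (Phi Locp AA) (sArr k) t"
    and D: "closed_ideal A C a D" "\<And>x. x \<in> S \<Longrightarrow> agreement A x k \<subseteq> D"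
  have "t \<in> Hom (Phi Locp AA) a b" using J.is_joinD[OF t] by (simp add: Hom_def)
  then obtain t' where t': "t = (a, b, t')" "K.sec a b t'" by (auto simp: K.Phi_Hom)
  have "rle Locp (s k) t'"
    using K.Phi_rle_iff[OF s_sec[OF k] t'(2)] le by (simp add: t' sArr_Hom[OF k])
  then show "Rst A k \<in> D"
    using s_conservative[OF S k _ _ D] sArr_join_iff[OF HomA(4,5)[OF k] S t'(2)] t by (simp add: t'(1))
qed

lemma unit_fctr_eq: "unit_fctr = unit_functor A s"
  by (simp add: unit_fctr_def unit_functor_def sArr_def)

end

theorem theorem8p30:
  fixes A :: "('o, 'm) rcat"
    and C :: "'m \<Rightarrow> 'm set set"
    and emb :: "'m set \<Rightarrow> 'u"
    and AA :: "('o, 'u gorder, 'u locp_map) pcat"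
    and s :: "'m \<Rightarrow> 'u locp_map"
  assumes "restriction_category A"
    and "coverage A C"
    and "inj emb"
    and "is_Psi A Locp (OC emb A C) AA s"
  shows "relative_join_completion TYPE('p \<times> 'n) A C (Phi Locp AA) (unit_functor A s)"
proof -
  interpret coverage A C by fact
  interpret Psi_of_OC A C emb AA s
    by unfold_locales (use assms(3,4) in auto)
  show ?thesis using relative_join_completion_unit unfolding unit_fctr_eq .
qed

end
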